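(* Let $\lambda\ge0$, $p_0=\frac{2\lambda}{2\lambda+1}$, and $p\ge p_0$ with $p>0$. There is a constant $c>0$, independent of $f$ and $z$, such that for every $f\in H^p_\lambda(\mathbb{D})$, $$|f(z)|\le c\,\frac{(1-|z|)^{-1/p}}{|1-z^2|^{2\lambda/p}}\|f\|_{H^p_\lambda},\qquad z\in\mathbb{D}.$$
   Context: Fix $\lambda\ge0$; $\mathbb{D}$ is the open unit disk in $\mathbb{C}$. For a complex-valued function $f$ put $D_{\bar z}f(z)=\partial_{\bar z}f(z)-\lambda\frac{f(z)-f(\bar z)}{z-\bar z}$, $z=x+iy$ (at real points the quotient is read as its limit $-i\,\partial_y f$). A $C^2$ (real sense) function $f:\mathbb{D}\to\mathbb{C}$ is $\lambda$-analytic if $D_{\bar z}f=0$ in $\mathbb{D}$. $dm_\lambda(\theta)=\tilde c_\lambda|\sin\theta|^{2\lambda}d\theta$ on $[-\pi,\pi]$, $\tilde c_\lambda=c_\lambda/(2\lambda+2)$, $c_\lambda=\frac{\Gamma(\lambda+2)}{\Gamma(\lambda+1/2)\Gamma(1/2)}$. For $0<p<\infty$, $M_p(f;r)=\left\{\int_{-\pi}^{\pi}|f(re^{i\theta})|^pdm_\lambda(\theta)\right\}^{1/p}$, $0\le r<1$, and $M_\infty(f;r)=\sup_\theta|f(re^{i\theta})|$. $H^p_\lambda(\mathbb{D})$ is the set of $\lambda$-analytic functions $f$ on $\mathbb{D}$ with $\|f\|_{H^p_\lambda}:=\sup_{0\le r<1}M_p(f;r)<\infty$. *)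

theory Defs
  imports "HOL-Analysis.Analysis"
begin

text \<open>\<open>Ck k f S\<close>: \<open>f\<close> is \<open>k\<close> times continuously differentiable in the real sense on the
  open set \<open>S\<close>. Here \<open>frechet_derivative f (at z)\<close> is the real derivative of \<open>f\<close> at \<open>z\<close>.\<close>

fun Ck :: "nat \<Rightarrow> (complex \<Rightarrow> complex) \<Rightarrow> complex set \<Rightarrow> bool" where
  "Ck 0 f S \<longleftrightarrow> continuous_on S f"
| "Ck (Suc k) f S \<longleftrightarrow> (\<forall>z\<in>S. f differentiable (at z)) \<and>
     (\<forall>v. Ck k (\<lambda>z. frechet_derivative f (at z) v) S)"

definition partial_x :: "(complex \<Rightarrow> complex) \<Rightarrow> complex \<Rightarrow> complex" where
  "partial_x f z = frechet_derivative f (at z) 1"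

definition partial_y :: "(complex \<Rightarrow> complex) \<Rightarrow> complex \<Rightarrow> complex" where
  "partial_y f z = frechet_derivative f (at z) \<i>"

definition partial_zbar :: "(complex \<Rightarrow> complex) \<Rightarrow> complex \<Rightarrow> complex" where
  "partial_zbar f z = (partial_x f z + \<i> * partial_y f z) / 2"

text \<open>At real points the difference quotient is replaced by its limit.\<close>

definition reflection_quotient :: "(complex \<Rightarrow> complex) \<Rightarrow> complex \<Rightarrow> complex" where
  "reflection_quotient f z =
     (if Im z = 0 then - \<i> * partial_y f z else (f z - f (cnj z)) / (z - cnj z))"

definition D_zbar :: "real \<Rightarrow> (complex \<Rightarrow> complex) \<Rightarrow> complex \<Rightarrow> complex" where
  "D_zbar lam f z = partial_zbar f z - of_real lam * reflection_quotient f z"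

text \<open>Functions on the disk are total functions whose values outside \<open>ball 0 1\<close> are irrelevant.\<close>

definition lambda_analytic :: "real \<Rightarrow> (complex \<Rightarrow> complex) \<Rightarrow> bool" where
  "lambda_analytic lam f \<longleftrightarrow> Ck 2 f (ball 0 1) \<and> (\<forall>z\<in>ball 0 1. D_zbar lam f z = 0)"

definition c_const :: "real \<Rightarrow> real" where
  "c_const lam = Gamma (lam + 2) / (Gamma (lam + 1 / 2) * Gamma (1 / 2))"

definition c_tilde :: "real \<Rightarrow> real" where
  "c_tilde lam = c_const lam / (2 * lam + 2)"

text \<open>For \<open>lam = 0\<close> the convention \<open>0 powr 0 = 0\<close> changes the density only at the zeros of \<open>sin\<close>,
  hence does not change the measure.\<close>

definition m_measure :: "real \<Rightarrow> real measure" where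
  "m_measure lam = density (restrict_space lborel {-pi..pi})
     (\<lambda>\<theta>. ennreal (c_tilde lam * \<bar>sin \<theta>\<bar> powr (2 * lam)))"

text \<open>The exponent \<open>p\<close> ranges over \<open>]0, \<infinity>]\<close>. For \<open>f\<close> continuous on the disk and \<open>0 \<le> r < 1\<close> the
  integrand is bounded, so the Bochner integral and the real supremum below have their usual
  meaning.\<close>

definition M_mean :: "real \<Rightarrow> ereal \<Rightarrow> (complex \<Rightarrow> complex) \<Rightarrow> real \<Rightarrow> real" where
  "M_mean lam p f r =
     (if p = \<infinity> then (SUP \<theta>\<in>{-pi..pi}. norm (f (rcis r \<theta>)))
      else (\<integral>\<theta>. norm (f (rcis r \<theta>)) powr real_of_ereal p \<partial>m_measure lam) powr (1 / real_of_ereal p))"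

definition hardy_space :: "real \<Rightarrow> ereal \<Rightarrow> (complex \<Rightarrow> complex) set" where
  "hardy_space lam p = {f. lambda_analytic lam f \<and> bdd_above (M_mean lam p f ` {0..<1})}"

text \<open>A real supremum, meaningful for \<open>f \<in> hardy_space lam p\<close>.\<close>

definition hardy_norm :: "real \<Rightarrow> ereal \<Rightarrow> (complex \<Rightarrow> complex) \<Rightarrow> real" where
  "hardy_norm lam p f = (SUP r\<in>{0..<1}. M_mean lam p f r)"

text \<open>The reciprocal \<open>1 / p\<close> as a real number, with \<open>1 / \<infinity> = 0\<close>.\<close>

definition recip_exponent :: "ereal \<Rightarrow> real" where
  "recip_exponent p = real_of_ereal (1 / p)"

end

theory Submission
  imports Defs
begin

text \<open>
  Write \<open>z = x + \<i>y\<close>, let \<open>u\<close> and \<open>\<i>v\<close> be the parts of \<open>f\<close> that are even and odd under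
  \<open>z \<mapsto> cnj z\<close>, and put \<open>G z = \<bar>f z\<bar> + \<bar>f (cnj z)\<bar>\<close> (\<open>sym_mod\<close>). The growth estimate is a
  sub-mean-value inequality in disguise: the disc of radius \<open>d = (1 - \<bar>z\<bar>) / 2\<close> about \<open>z\<close> has measure
  comparable to \<open>d\<^sup>2 (\<bar>y\<bar> + d)\<^bsup>2\<lambda>\<^esup>\<close> with respect to \<open>\<bar>y\<bar>\<^bsup>2\<lambda>\<^esup> dx dy\<close>, the integral of \<open>G\<^bsup>p\<^esup>\<close> over it is, in
  polar coordinates about \<open>0\<close>, at most a multiple of \<open>d\<close> times the \<open>p\<close>-th power of the Hardy norm, and
  \<open>\<bar>1 - z\<^sup>2\<bar>\<close> is at most a multiple of \<open>\<bar>y\<bar> + d\<close>. So it suffices that \<open>G\<^bsup>p\<^esup>\<close> at \<open>z\<close> is at most a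
  constant times its weighted mean over the disc (\<open>sub_mean_value\<close>).

  For the exponent \<open>2\<close> this mean value inequality, up to a small multiple of the supremum of \<open>G\<close>, comes
  from two facts. Off the real axis \<open>\<lambda>\<close>-analyticity is a Cauchy-Riemann equation with a right-hand side
  of size \<open>\<lambda> G / \<bar>y\<bar>\<close>, so \<open>f\<close> differs little from its mean over a circle much smaller than \<open>\<bar>y\<bar>\<close>
  (\<open>far_circle_estimate\<close>). For centres on the real axis, \<open>u\<close> and \<open>v\<close> satisfy the generalised
  Cauchy-Riemann system \<open>u\<^sub>x = v\<^sub>y + 2\<lambda>v/y\<close>, \<open>u\<^sub>y = - v\<^sub>x\<close>, for which \<open>\<bar>u\<bar>\<^sup>2 + \<bar>v\<bar>\<^sup>2\<close> is subharmonic with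
  respect to the weighted Laplacian; hence its means over circles, with weight \<open>\<bar>sin \<theta>\<bar>\<^bsup>2\<lambda>\<^esup>\<close>, increase with
  the radius (\<open>real_circle_mean_mono\<close>). A point at small height \<open>y\<close> is therefore handled by passing from a
  disc of radius comparable to \<open>y\<close> to a disc of radius \<open>2 \<bar>y\<bar>\<close> centred on the axis and from there to
  a large concentric disc, which loses only a constant because the measures scale alike
  (\<open>local_square_estimate\<close>).

  The passage from the exponent \<open>2\<close> to \<open>p\<close> is an absorption argument of Hardy-Littlewood type: at
  a maximum point of \<open>G w (d - \<bar>w - z\<bar>)\<^bsup>N\<^esup>\<close> the values of \<open>G\<close> on a smaller disc are bounded by a constant
  multiple of the value at the centre, so the supremum term can be subtracted and powers of \<open>G\<close> may be
  exchanged against each other. For \<open>p = \<infinity>\<close> the assertion is immediate.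
\<close>

section \<open>Plane integrals in polar coordinates\<close>

text \<open>The area integral is written as an iterated integral, so that only one-dimensional substitutions
  and Tonelli's theorem are needed below.\<close>

definition plane_integral :: "(complex \<Rightarrow> real) \<Rightarrow> ennreal" where
  "plane_integral h = (\<integral>\<^sup>+x. \<integral>\<^sup>+y. ennreal (h (Complex x y)) \<partial>lborel \<partial>lborel)"

text \<open>The substitution rule for compact intervals applies on \<open>[-b, b]\<close> with \<open>b < \<pi>/2\<close>; the
  identity follows by monotone convergence as \<open>b\<close> increases to \<open>\<pi>/2\<close>.\<close>

lemma nn_integral_tan_substitution:
  fixes g :: "real \<Rightarrow> real"
  assumes [measurable]: "g \<in> borel_measurable borel" and nn: "\<And>y. g y \<ge> 0"
  shows "(\<integral>\<^sup>+y. g y \<partial>lborel) =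
    (\<integral>\<^sup>+t. ennreal (indicator {-pi/2<..<pi/2} t * (g (tan t) / (cos t)\<^sup>2)) \<partial>lborel)"
proof -
  define b where "b n = pi/2 - 1 / real (n+1)" for n
  have b: "b n < pi/2" for n by (simp add: b_def)
  have binc: "b n \<le> b m" if "n \<le> m" for n m
    using that by (auto simp: b_def intro!: divide_left_mono)
  have b0: "0 \<le> b n" for n
  proof -
    have "b 0 = pi/2 - 1" by (simp add: b_def)
    then show ?thesis using pi_ge_two binc[of 0 n] by linarith
  qed
  have blim: "\<exists>n. t < b n" if "t < pi/2" for t
  proof -
    from that obtain n where "1 / real (Suc n) < pi/2 - t" 
      using nat_approx_posE[of "pi/2 - t"] by auto
    then show ?thesis by (intro exI[of _ n]) (auto simp: b_def)
  qed
  have cosb: "cos t \<noteq> 0" if "t \<in> {- b n..b n}" for t n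
    using that b[of n] cos_gt_zero_pi[of t] by auto
  have step: "(\<integral>\<^sup>+y. g y * indicator {tan (- b n)..tan (b n)} y \<partial>lborel) =
     (\<integral>\<^sup>+t. g (tan t) * (1 / (cos t)\<^sup>2) * indicator {- b n..b n} t \<partial>lborel)" for n
  proof (rule nn_integral_substitution)
    show "set_borel_measurable borel {tan (- b n)..tan (b n)} g"
      unfolding set_borel_measurable_def by measurable
    show "(tan has_real_derivative 1 / (cos x)\<^sup>2) (at x)" if "x \<in> {- b n..b n}" for x
      using DERIV_tan[OF cosb[OF that]] by (simp add: field_simps)
    show "continuous_on {- b n..b n} (\<lambda>x. 1 / (cos x)\<^sup>2)"
      using cosb by (intro continuous_intros) auto
    show "- b n \<le> b n" using b0[of n] by simp
  qed auto
  have inc1: "incseq (\<lambda>n y. ennreal (g y * indicator {tan (- b n)..tan (b n)} y))"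
  proof (intro monoI le_funI ennreal_leI mult_left_mono nn)
    fix m n :: nat and y assume "m \<le> n"
    have "tan (b m) \<le> tan (b n)"
      using b0[of m] b[of n] binc[OF \<open>m \<le> n\<close>]
      by (cases "b m = b n") (auto intro!: less_imp_le[OF tan_monotone])
    then show "indicator {tan (- b m)..tan (b m)} y \<le> (indicator {tan (- b n)..tan (b n)} y :: real)"
      by (auto simp: indicator_def)
  qed
  have inc2: "incseq (\<lambda>n t. ennreal (g (tan t) * (1 / (cos t)\<^sup>2) * indicator {- b n..b n} t))"
    using binc by (intro monoI le_funI ennreal_leI mult_left_mono) (fastforce simp: indicator_def nn)+
  have sup1: "(SUP n. ennreal (g y * indicator {tan (- b n)..tan (b n)} y)) = ennreal (g y)" for y
  proof (rule antisym)
    show "(SUP n. ennreal (g y * indicator {tan (- b n)..tan (b n)} y)) \<le> ennreal (g y)"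
      by (intro SUP_least) (auto simp: indicator_def nn)
    obtain n where n: "\<bar>arctan y\<bar> < b n"
    proof -
      have "\<bar>arctan y\<bar> < pi/2" using arctan_lbound[of y] arctan_ubound[of y] by linarith
      from blim[OF this] show ?thesis using that by blast
    qed
    have "y \<in> {tan (- b n)..tan (b n)}"
    proof -
      have "tan (- b n) < tan (arctan y)" "tan (arctan y) < tan (b n)"
        using n b[of n] by (auto intro!: tan_monotone simp del: tan_minus)
      then show ?thesis by (simp add: tan_arctan del: tan_minus)
    qed
    then show "ennreal (g y) \<le> (SUP n. ennreal (g y * indicator {tan (- b n)..tan (b n)} y))"
      by (intro SUP_upper2[of n]) auto
  qed
  have sup2: "(SUP n. ennreal (g (tan t) * (1 / (cos t)\<^sup>2) * indicator {- b n..b n} t)) =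
     ennreal (indicator {-pi/2<..<pi/2} t * (g (tan t) / (cos t)\<^sup>2))" for t
  proof (rule antisym)
    show "(SUP n. ennreal (g (tan t) * (1 / (cos t)\<^sup>2) * indicator {- b n..b n} t)) \<le>
     ennreal (indicator {-pi/2<..<pi/2} t * (g (tan t) / (cos t)\<^sup>2))"
    proof (intro SUP_least ennreal_leI)
      fix n
      show "g (tan t) * (1 / (cos t)\<^sup>2) * indicator {- b n..b n} t \<le> indicator {-pi/2<..<pi/2} t * (g (tan t) / (cos t)\<^sup>2)"
        using b[of n] nn by (auto simp: indicator_def)
    qed
    show "ennreal (indicator {-pi/2<..<pi/2} t * (g (tan t) / (cos t)\<^sup>2)) \<le> 
      (SUP n. ennreal (g (tan t) * (1 / (cos t)\<^sup>2) * indicator {- b n..b n} t))"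
    proof (cases "t \<in> {-pi/2<..<pi/2}")
      case True
      then have "\<bar>t\<bar> < pi/2" by auto
      from blim[OF this] obtain n where n: "\<bar>t\<bar> < b n" by blast
      then have "t \<in> {- b n..b n}" by auto
      then show ?thesis using True by (intro SUP_upper2[of n]) simp_all
    qed auto
  qed
  have "(\<integral>\<^sup>+y. g y \<partial>lborel) = (\<integral>\<^sup>+y. (SUP n. ennreal (g y * indicator {tan (- b n)..tan (b n)} y)) \<partial>lborel)"
    by (simp only: sup1)
  also have "\<dots> = (SUP n. \<integral>\<^sup>+t. g (tan t) * (1 / (cos t)\<^sup>2) * indicator {- b n..b n} t \<partial>lborel)"
    by (subst nn_integral_monotone_convergence_SUP[OF inc1]) (simp_all only: step, measurable)
  also have "\<dots> = (\<integral>\<^sup>+t. (SUP n. ennreal (g (tan t) * (1 / (cos t)\<^sup>2) * indicator {- b n..b n} t)) \<partial>lborel)"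
  proof (rule nn_integral_monotone_convergence_SUP[OF inc2, symmetric])
    have "tan \<in> borel_measurable (borel :: real measure)"
      unfolding tan_def by measurable
    then show "(\<lambda>t. ennreal (g (tan t) * (1 / (cos t)\<^sup>2) * indicator {- b n..b n} t)) \<in> borel_measurable lborel" for n
      by measurable
  qed
  finally show ?thesis by (simp only: sup2)
qed

lemma measurable_Complex [measurable]:
  assumes [measurable]: "f \<in> borel_measurable M" "g \<in> borel_measurable M"
  shows "(\<lambda>x. Complex (f x) (g x)) \<in> borel_measurable M"
  unfolding Complex_eq by measurable

lemma measurable_rcis [measurable]:
  assumes [measurable]: "f \<in> borel_measurable M" "g \<in> borel_measurable M"
  shows "(\<lambda>x. rcis (f x) (g x)) \<in> borel_measurable M"
proof -
  have "rcis r t = Complex (r * cos t) (r * sin t)" for r t by (simp add: complex_eq_iff)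
  then show ?thesis by simp
qed

lemma measurable_tan [measurable]:
  "(tan :: real \<Rightarrow> real) \<in> borel_measurable borel"
  unfolding tan_def by measurable

text \<open>For fixed \<open>x\<close> substitute \<open>y = x s\<close> and then \<open>s = tan t\<close>; after exchanging the integrals,
  substitute \<open>x = r cos t\<close>. The Jacobians multiply to \<open>\<bar>r\<bar>\<close>. Here \<open>r\<close> runs through all reals and
  \<open>t\<close> through a half circle.\<close>

lemma plane_integral_half_polar:
  fixes h :: "complex \<Rightarrow> real"
  assumes [measurable]: "h \<in> borel_measurable borel" and nn: "\<And>z. h z \<ge> 0"
  shows "plane_integral h =
    (\<integral>\<^sup>+r. \<integral>\<^sup>+t. ennreal (indicator {-pi/2<..<pi/2} t * (\<bar>r\<bar> * h (rcis r t))) \<partial>lborel \<partial>lborel)"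
proof -
  have "plane_integral h = (\<integral>\<^sup>+x. \<integral>\<^sup>+t. ennreal (indicator {-pi/2<..<pi/2} t * 
      (\<bar>x\<bar> * h (Complex x (x * tan t)) / (cos t)\<^sup>2)) \<partial>lborel \<partial>lborel)"
    unfolding plane_integral_def
  proof (rule nn_integral_cong_AE)
    have "AE x::real in lborel. x \<noteq> 0" by (rule AE_lborel_singleton)
    then show "AE x in lborel. (\<integral>\<^sup>+y. ennreal (h (Complex x y)) \<partial>lborel) =
      (\<integral>\<^sup>+t. ennreal (indicator {-pi/2<..<pi/2} t * (\<bar>x\<bar> * h (Complex x (x * tan t)) / (cos t)\<^sup>2)) \<partial>lborel)"
    proof eventually_elim
      fix x :: real assume x: "x \<noteq> 0"
      have "(\<integral>\<^sup>+y. ennreal (h (Complex x y)) \<partial>lborel) = \<bar>x\<bar> * (\<integral>\<^sup>+s. ennreal (h (Complex x (0 + x * s))) \<partial>lborel)"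
        by (rule nn_integral_real_affine) (use x in measurable)
      also have "\<dots> = (\<integral>\<^sup>+s. ennreal (\<bar>x\<bar> * h (Complex x (x * s))) \<partial>lborel)"
        by (simp add: nn_integral_cmult ennreal_mult nn)
      also have "\<dots> = (\<integral>\<^sup>+t. ennreal (indicator {-pi/2<..<pi/2} t * (\<bar>x\<bar> * h (Complex x (x * tan t)) / (cos t)\<^sup>2)) \<partial>lborel)"
        by (rule nn_integral_tan_substitution) (auto simp: nn)
      finally show "(\<integral>\<^sup>+y. ennreal (h (Complex x y)) \<partial>lborel) = \<dots>" .
    qed
  qed
  also have "\<dots> = (\<integral>\<^sup>+t. \<integral>\<^sup>+x. ennreal (indicator {-pi/2<..<pi/2} t * 
      (\<bar>x\<bar> * h (Complex x (x * tan t)) / (cos t)\<^sup>2)) \<partial>lborel \<partial>lborel)"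
    by (rule lborel_pair.Fubini') measurable
  also have "\<dots> = (\<integral>\<^sup>+t. \<integral>\<^sup>+r. ennreal (indicator {-pi/2<..<pi/2} t * (\<bar>r\<bar> * h (rcis r t))) \<partial>lborel \<partial>lborel)"
  proof (rule nn_integral_cong)
    fix t :: real
    show "(\<integral>\<^sup>+x. ennreal (indicator {-pi/2<..<pi/2} t * (\<bar>x\<bar> * h (Complex x (x * tan t)) / (cos t)\<^sup>2)) \<partial>lborel)
       = (\<integral>\<^sup>+r. ennreal (indicator {-pi/2<..<pi/2} t * (\<bar>r\<bar> * h (rcis r t))) \<partial>lborel)"
    proof (cases "t \<in> {-pi/2<..<pi/2}")
      case True
      then have c: "cos t > 0" by (intro cos_gt_zero_pi) auto
      have "(\<integral>\<^sup>+x. ennreal (indicator {-pi/2<..<pi/2} t * (\<bar>x\<bar> * h (Complex x (x * tan t)) / (cos t)\<^sup>2)) \<partial>lborel)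
        = \<bar>cos t\<bar> * (\<integral>\<^sup>+r. ennreal (indicator {-pi/2<..<pi/2} t * (\<bar>0 + cos t * r\<bar> * h (Complex (0 + cos t * r) ((0 + cos t * r) * tan t)) / (cos t)\<^sup>2)) \<partial>lborel)"
        by (rule nn_integral_real_affine) (use c in \<open>measurable, simp\<close>)
      also have "\<dots> = (\<integral>\<^sup>+r. ennreal (\<bar>cos t\<bar> * (indicator {-pi/2<..<pi/2} t * (\<bar>0 + cos t * r\<bar> * h (Complex (0 + cos t * r) ((0 + cos t * r) * tan t)) / (cos t)\<^sup>2))) \<partial>lborel)"
        by (subst ennreal_mult'[OF abs_ge_zero], subst nn_integral_cmult) measurable
      also have "\<dots> = (\<integral>\<^sup>+r. ennreal (indicator {-pi/2<..<pi/2} t * (\<bar>r\<bar> * h (rcis r t))) \<partial>lborel)"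
      proof (intro nn_integral_cong arg_cong[where f=ennreal])
        fix r
        have "Complex (0 + cos t * r) ((0 + cos t * r) * tan t) = rcis r t"
          using c by (simp add: complex_eq_iff tan_def)
        then show "\<bar>cos t\<bar> * (indicator {-pi/2<..<pi/2} t * (\<bar>0 + cos t * r\<bar> * h (Complex (0 + cos t * r) ((0 + cos t * r) * tan t)) / (cos t)\<^sup>2))
           = indicator {-pi/2<..<pi/2} t * (\<bar>r\<bar> * h (rcis r t))"
          using c by (simp add: abs_mult power2_eq_square)
      qed
      finally show ?thesis .
    qed auto
  qed
  also have "\<dots> = (\<integral>\<^sup>+r. \<integral>\<^sup>+t. ennreal (indicator {-pi/2<..<pi/2} t * (\<bar>r\<bar> * h (rcis r t))) \<partial>lborel \<partial>lborel)"
    by (rule lborel_pair.Fubini') measurable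
  finally show ?thesis .
qed

lemma nn_integral_add_reflection:
  fixes F :: "real \<Rightarrow> ennreal"
  assumes [measurable]: "F \<in> borel_measurable borel"
  shows "(\<integral>\<^sup>+r. F r \<partial>lborel) = (\<integral>\<^sup>+r. indicator {0<..} r * (F r + F (- r)) \<partial>lborel)"
proof -
  have "(\<integral>\<^sup>+r. F r \<partial>lborel) = (\<integral>\<^sup>+r. indicator {0<..} r * F r + indicator {..<0} r * F r \<partial>lborel)"
  proof (rule nn_integral_cong_AE)
    have "AE x::real in lborel. x \<noteq> 0" by (rule AE_lborel_singleton)
    then show "AE r in lborel. F r = indicator {0<..} r * F r + indicator {..<0} r * F r"
      by eventually_elim (auto simp: indicator_def)
  qed
  also have "\<dots> = (\<integral>\<^sup>+r. indicator {0<..} r * F r \<partial>lborel) + (\<integral>\<^sup>+r. indicator {..<0} r * F r \<partial>lborel)"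
    by (rule nn_integral_add) measurable
  also have "(\<integral>\<^sup>+r. indicator {..<0} r * F r \<partial>lborel) = (\<integral>\<^sup>+r. indicator {0<..} r * F (- r) \<partial>lborel)"
    by (subst nn_integral_real_affine[of _ "-1" 0]) (auto simp: indicator_def intro!: nn_integral_cong)
  also have "(\<integral>\<^sup>+r. indicator {0<..} r * F r \<partial>lborel) + \<dots> = (\<integral>\<^sup>+r. indicator {0<..} r * F r + indicator {0<..} r * F (- r) \<partial>lborel)"
    by (rule nn_integral_add[symmetric]) measurable
  finally show ?thesis by (simp add: distrib_left)
qed

text \<open>Together with \<open>rcis (-r) t = rcis r (t + \<pi>)\<close> this turns the half circle with signed radii into
  the full circle with positive radii.\<close>

lemma nn_integral_half_period:
  fixes k :: "real \<Rightarrow> ennreal"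
  assumes [measurable]: "k \<in> borel_measurable borel" and per: "\<And>t. k (t + 2 * pi) = k t"
  shows "(\<integral>\<^sup>+t. indicator {-pi/2<..<pi/2} t * k t \<partial>lborel) + (\<integral>\<^sup>+t. indicator {-pi/2<..<pi/2} t * k (t + pi) \<partial>lborel)
    = (\<integral>\<^sup>+t. indicator {-pi..pi} t * k t \<partial>lborel)"
proof -
  let ?I = "\<lambda>A. (\<integral>\<^sup>+t. indicator A t * k t \<partial>lborel)"
  have "(\<integral>\<^sup>+t. indicator {-pi/2<..<pi/2} t * k (t + pi) \<partial>lborel) = 
     (\<integral>\<^sup>+t. indicator {-pi/2<..<0} t * k (t + pi) + indicator {0<..<pi/2} t * k (t + pi) \<partial>lborel)"
  proof (rule nn_integral_cong_AE)
    have "AE x::real in lborel. x \<noteq> 0" by (rule AE_lborel_singleton)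
    then show "AE t in lborel. indicator {-pi/2<..<pi/2} t * k (t + pi) = indicator {-pi/2<..<0} t * k (t + pi) + indicator {0<..<pi/2} t * k (t + pi)"
      by eventually_elim (auto simp: indicator_def)
  qed
  also have "\<dots> = (\<integral>\<^sup>+t. indicator {-pi/2<..<0} t * k (t + pi) \<partial>lborel) + (\<integral>\<^sup>+t. indicator {0<..<pi/2} t * k (t + pi) \<partial>lborel)"
    by (rule nn_integral_add) measurable
  also have "(\<integral>\<^sup>+t. indicator {-pi/2<..<0} t * k (t + pi) \<partial>lborel) = ?I {pi/2<..<pi}"
    by (subst nn_integral_real_affine[of "\<lambda>t. indicator {pi/2<..<pi} t * k t" 1 pi]) (auto simp: indicator_def add.commute intro!: nn_integral_cong)
  also have "(\<integral>\<^sup>+t. indicator {0<..<pi/2} t * k (t + pi) \<partial>lborel) = ?I {-pi<..<-pi/2}"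
  proof -
    have "k (t - pi) = k (t + pi)" for t using per[of "t - pi"] by (simp add: add.commute)
    then show ?thesis
      by (subst nn_integral_real_affine[of "\<lambda>t. indicator {-pi<..<-pi/2} t * k t" 1 "-pi"]) (auto simp: indicator_def intro!: nn_integral_cong)
  qed
  finally have "?I {-pi/2<..<pi/2} + (\<integral>\<^sup>+t. indicator {-pi/2<..<pi/2} t * k (t + pi) \<partial>lborel) = 
     ?I {-pi/2<..<pi/2} + (?I {pi/2<..<pi} + ?I {-pi<..<-pi/2})" by simp
  also have "\<dots> = (\<integral>\<^sup>+t. indicator {-pi/2<..<pi/2} t * k t + (indicator {pi/2<..<pi} t * k t + indicator {-pi<..<-pi/2} t * k t) \<partial>lborel)"
    by (simp add: nn_integral_add)
  also have "\<dots> = ?I {-pi..pi}"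
  proof (rule nn_integral_cong_AE)
    have "AE x::real in lborel. x \<notin> {-pi,-pi/2,pi/2,pi}" by (intro AE_not_in finite_imp_null_set_lborel) simp
    then show "AE t in lborel. indicator {-pi/2<..<pi/2} t * k t + (indicator {pi/2<..<pi} t * k t + indicator {-pi<..<-pi/2} t * k t) = indicator {-pi..pi} t * k t"
    proof eventually_elim
      fix t :: real assume "t \<notin> {-pi,-pi/2,pi/2,pi}"
      then show "indicator {-pi/2<..<pi/2} t * k t + (indicator {pi/2<..<pi} t * k t + indicator {-pi<..<-pi/2} t * k t) = indicator {-pi..pi} t * k t"
        using pi_gt_zero by (auto simp: indicator_def)
    qed
  qed
  finally show ?thesis .
qed

lemma plane_integral_polar0:
  fixes h :: "complex \<Rightarrow> real"
  assumes [measurable]: "h \<in> borel_measurable borel" and nn: "\<And>z. h z \<ge> 0"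
  shows "plane_integral h =
    (\<integral>\<^sup>+r. indicator {0<..} r * (ennreal r * (\<integral>\<^sup>+t. indicator {-pi..pi} t * ennreal (h (rcis r t)) \<partial>lborel)) \<partial>lborel)"
proof -
  have "plane_integral h = (\<integral>\<^sup>+r. indicator {0<..} r * ((\<integral>\<^sup>+t. ennreal (indicator {-pi/2<..<pi/2} t * (\<bar>r\<bar> * h (rcis r t))) \<partial>lborel) + 
     (\<integral>\<^sup>+t. ennreal (indicator {-pi/2<..<pi/2} t * (\<bar>-r\<bar> * h (rcis (-r) t))) \<partial>lborel)) \<partial>lborel)"
    unfolding plane_integral_half_polar[OF assms]
    by (rule nn_integral_add_reflection[of "\<lambda>r. \<integral>\<^sup>+t. ennreal (indicator {-pi/2<..<pi/2} t * (\<bar>r\<bar> * h (rcis r t))) \<partial>lborel"]) measurable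
  also have "\<dots> = (\<integral>\<^sup>+r. indicator {0<..} r * (ennreal r * (\<integral>\<^sup>+t. indicator {-pi..pi} t * ennreal (h (rcis r t)) \<partial>lborel)) \<partial>lborel)"
  proof (intro nn_integral_cong)
    fix r :: real
    show "indicator {0<..} r * ((\<integral>\<^sup>+t. ennreal (indicator {-pi/2<..<pi/2} t * (\<bar>r\<bar> * h (rcis r t))) \<partial>lborel) + 
     (\<integral>\<^sup>+t. ennreal (indicator {-pi/2<..<pi/2} t * (\<bar>-r\<bar> * h (rcis (-r) t))) \<partial>lborel)) = indicator {0<..} r * (ennreal r * (\<integral>\<^sup>+t. indicator {-pi..pi} t * ennreal (h (rcis r t)) \<partial>lborel))"
    proof (cases "r > 0")
      case True
      have split: "(\<integral>\<^sup>+t. indicator {-pi..pi} t * ennreal (h (rcis r t)) \<partial>lborel) =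
         (\<integral>\<^sup>+t. indicator {-pi/2<..<pi/2} t * ennreal (h (rcis r t)) \<partial>lborel) + (\<integral>\<^sup>+t. indicator {-pi/2<..<pi/2} t * ennreal (h (rcis r (t + pi))) \<partial>lborel)"
      proof (rule nn_integral_half_period[symmetric])
        show "(\<lambda>t. ennreal (h (rcis r t))) \<in> borel_measurable borel" by measurable
        have "rcis r (t + 2 * pi) = rcis r t" for t
          by (simp add: complex_eq_iff)
        then show "ennreal (h (rcis r (t + 2 * pi))) = ennreal (h (rcis r t))" for t
          by simp
      qed
      have "ennreal r * (\<integral>\<^sup>+t. indicator {-pi..pi} t * ennreal (h (rcis r t)) \<partial>lborel) = (\<integral>\<^sup>+t. ennreal r * (indicator {-pi/2<..<pi/2} t * ennreal (h (rcis r t))) \<partial>lborel) + (\<integral>\<^sup>+t. ennreal r * (indicator {-pi/2<..<pi/2} t * ennreal (h (rcis r (t + pi)))) \<partial>lborel)"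
        unfolding split distrib_left
      proof (intro arg_cong2[where f="(+)"] nn_integral_cmult[symmetric])
        show "(\<lambda>t. indicator {-pi/2<..<pi/2} t * ennreal (h (rcis r t))) \<in> borel_measurable lborel" by measurable
        show "(\<lambda>t. indicator {-pi/2<..<pi/2} t * ennreal (h (rcis r (t + pi)))) \<in> borel_measurable lborel" by measurable
      qed
      also have "\<dots> = (\<integral>\<^sup>+t. ennreal (indicator {-pi/2<..<pi/2} t * (\<bar>r\<bar> * h (rcis r t))) \<partial>lborel) + 
     (\<integral>\<^sup>+t. ennreal (indicator {-pi/2<..<pi/2} t * (\<bar>-r\<bar> * h (rcis (-r) t))) \<partial>lborel)"
      proof -
        have e: "rcis r (t + pi) = rcis (-r) t" for t
          by (rule complex_eqI) (simp_all only: Re_rcis Im_rcis cos_periodic_pi sin_periodic_pi mult_minus_left mult_minus_right)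
        have nrc: "\<bar>- r\<bar> = \<bar>r\<bar>" by simp
        have rr: "\<bar>r\<bar> = r" "0 \<le> r" using True by auto
        have i: "ennreal r * (indicator {-pi/2<..<pi/2} t * ennreal x) = ennreal (indicator {-pi/2<..<pi/2} t * (\<bar>r\<bar> * x))" for x t
          unfolding rr(1) indicator_def by (simp add: ennreal_mult'[OF rr(2)])
        show ?thesis unfolding i e nrc ..
      qed
      finally have "ennreal r * (\<integral>\<^sup>+t. indicator {-pi..pi} t * ennreal (h (rcis r t)) \<partial>lborel) = \<dots>" .
      then show ?thesis by (simp only:)
    next
      case False
      then have "indicator {0<..} r = (0 :: ennreal)" by (simp add: indicator_def)
      then show ?thesis by (simp only: mult_zero_left)
    qed
  qed
  finally show ?thesis .
qed

lemma plane_integral_shift: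
  fixes h :: "complex \<Rightarrow> real"
  assumes [measurable]: "h \<in> borel_measurable borel"
  shows "plane_integral (\<lambda>z. h (c + z)) = plane_integral h"
proof -
  have "plane_integral h = (\<integral>\<^sup>+x. \<integral>\<^sup>+y. ennreal (h (Complex x (Im c + y))) \<partial>lborel \<partial>lborel)"
    unfolding plane_integral_def
    by (subst nn_integral_real_affine[of "\<lambda>y. ennreal (h (Complex _ y))" 1 "Im c"]) auto
  also have "\<dots> = (\<integral>\<^sup>+x. \<integral>\<^sup>+y. ennreal (h (Complex (Re c + x) (Im c + y))) \<partial>lborel \<partial>lborel)"
    by (subst nn_integral_real_affine[of "\<lambda>x. \<integral>\<^sup>+y. ennreal (h (Complex x (Im c + y))) \<partial>lborel" 1 "Re c"]) auto
  also have "\<dots> = plane_integral (\<lambda>z. h (c + z))"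
    unfolding plane_integral_def by (intro nn_integral_cong arg_cong[where f=ennreal] arg_cong[where f=h]) (simp add: complex_eq_iff)
  finally show ?thesis by simp
qed

text \<open>Circles about arbitrary centres are needed: about the point at which \<open>f\<close> is estimated, about
  real points, and about the origin.\<close>

lemma plane_integral_polar:
  fixes h :: "complex \<Rightarrow> real"
  assumes [measurable]: "h \<in> borel_measurable borel" and nn: "\<And>z. h z \<ge> 0"
  shows "plane_integral h =
    (\<integral>\<^sup>+r. indicator {0<..} r * (ennreal r * (\<integral>\<^sup>+t. indicator {-pi..pi} t * ennreal (h (c + rcis r t)) \<partial>lborel)) \<partial>lborel)"
proof -
  have "plane_integral h = plane_integral (\<lambda>z. h (c + z))"
    by (rule plane_integral_shift[symmetric]) fact
  also have "\<dots> = (\<integral>\<^sup>+r. indicator {0<..} r * (ennreal r * (\<integral>\<^sup>+t. indicator {-pi..pi} t * ennreal (h (c + rcis r t)) \<partial>lborel)) \<partial>lborel)"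
    by (rule plane_integral_polar0) (measurable, rule nn)
  finally show ?thesis .
qed

lemma plane_integral_mono:
  assumes "\<And>z. h z \<le> k z"
  shows "plane_integral h \<le> plane_integral k"
  unfolding plane_integral_def by (intro nn_integral_mono ennreal_leI assms)

lemma plane_integral_add:
  assumes [measurable]: "h \<in> borel_measurable borel" "k \<in> borel_measurable borel"
    and "\<And>z. h z \<ge> 0" "\<And>z. k z \<ge> 0"
  shows "plane_integral (\<lambda>z. h z + k z) = plane_integral h + plane_integral k"
  unfolding plane_integral_def using assms(3,4) by (simp add: nn_integral_add)

lemma plane_integral_cmult:
  assumes [measurable]: "h \<in> borel_measurable borel" and "a \<ge> 0"
  shows "plane_integral (\<lambda>z. a * h z) = ennreal a * plane_integral h"
  unfolding plane_integral_def using assms(2) by (simp add: nn_integral_cmult ennreal_mult')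

section \<open>Monotonicity of weighted circle means\<close>

text \<open>Agrees with \<open>\<bar>sin t\<bar>\<^bsup>2\<lambda>\<^esup>\<close> away from the zeros of the sine. The power of \<open>sin\<^sup>2\<close> is differentiable
  there without a distinction of signs, and the separate value for \<open>\<lambda> = 0\<close> keeps the function
  continuous although \<open>0 powr 0 = 0\<close>.\<close>

definition sin_weight :: "real \<Rightarrow> real \<Rightarrow> real" where
  "sin_weight lam t = (if lam = 0 then 1 else ((sin t)\<^sup>2) powr lam)"

lemma sin_weight_nonneg: "sin_weight lam t \<ge> 0"
  by (simp add: sin_weight_def)

lemma continuous_on_sin_weight:
  assumes "lam \<ge> 0"
  shows "continuous_on A (sin_weight lam)"
proof (cases "lam = 0")
  case False
  then have "sin_weight lam = (\<lambda>t. ((sin t)\<^sup>2) powr lam)" by (auto simp: sin_weight_def)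
  moreover have "continuous_on A (\<lambda>t. ((sin t)\<^sup>2) powr lam)"
    using assms False by (intro continuous_on_powr' continuous_intros) auto
  ultimately show ?thesis by simp
qed (simp add: sin_weight_def)

lemma sin_weight_has_derivative:
  assumes "sin t \<noteq> 0"
  shows "(sin_weight lam has_real_derivative (2 * lam * cos t / sin t) * sin_weight lam t) (at t)"
proof (cases "lam = 0")
  case True
  then have "sin_weight lam = (\<lambda>t. 1)" by (auto simp: sin_weight_def)
  then show ?thesis using True by simp
next
  case False
  then have e: "sin_weight lam = (\<lambda>t. ((sin t)\<^sup>2) powr lam)" by (auto simp: sin_weight_def)
  have p: "(sin t)\<^sup>2 > 0" using assms by simp
  have "((\<lambda>t. ((sin t)\<^sup>2) powr lam) has_real_derivative lam * ((sin t)\<^sup>2) powr (lam - 1) * (2 * sin t * cos t)) (at t)"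
    by (rule derivative_eq_intros refl p | simp)+
  also have "((sin t)\<^sup>2) powr (lam - 1) = ((sin t)\<^sup>2) powr lam / (sin t)\<^sup>2"
    using p by (simp add: powr_diff)
  finally show ?thesis unfolding e using assms by (simp add: field_simps power2_eq_square)
qed

lemma inner_has_real_derivative:
  fixes P Q :: "real \<Rightarrow> 'a::real_inner"
  assumes "(P has_vector_derivative P') (at x)" "(Q has_vector_derivative Q') (at x)"
  shows "((\<lambda>x. P x \<bullet> Q x) has_real_derivative P x \<bullet> Q' + P' \<bullet> Q x) (at x)"
  unfolding has_field_derivative_def
  by (rule has_derivative_eq_rhs[OF has_derivative_inner[OF assms[unfolded has_vector_derivative_def]]])
    (simp add: fun_eq_iff algebra_simps)

text \<open>Integrate \<open>\<phi>\<^sub>t\<close> in \<open>t\<close>, differentiate the result in \<open>r\<close> under the integral sign, and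
  differentiate again in \<open>t\<close>. Only one of the two mixed derivatives is assumed to exist.\<close>

lemma mixed_partials_commute:
  fixes \<phi> \<phi>r \<phi>t \<phi>tr :: "real \<Rightarrow> real \<Rightarrow> complex"
  assumes r: "\<And>r t. r \<in> {-R<..<R} \<Longrightarrow> ((\<lambda>r. \<phi> r t) has_vector_derivative \<phi>r r t) (at r)"
    and t: "\<And>r t. r \<in> {-R<..<R} \<Longrightarrow> ((\<lambda>t. \<phi> r t) has_vector_derivative \<phi>t r t) (at t)"
    and tr: "\<And>r t. r \<in> {-R<..<R} \<Longrightarrow> ((\<lambda>r. \<phi>t r t) has_vector_derivative \<phi>tr r t) (at r)"
    and c1: "continuous_on ({-R<..<R} \<times> UNIV) (\<lambda>p. \<phi>t (fst p) (snd p))"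
    and c2: "continuous_on ({-R<..<R} \<times> UNIV) (\<lambda>p. \<phi>tr (fst p) (snd p))"
    and r0: "r \<in> {-R<..<R}"
  shows "((\<lambda>t. \<phi>r r t) has_vector_derivative \<phi>tr r t0) (at t0)"
proof -
  let ?a = "t0 - 1" and ?b = "t0 + 1"
  have slice1: "continuous_on A (\<phi>t s)" if "s \<in> {-R<..<R}" for s A
    using continuous_on_compose2[OF c1 continuous_on_Pair[OF continuous_on_const continuous_on_id], of s A] that by (auto simp: image_subset_iff)
  have slice2: "continuous_on A (\<phi>tr s)" if "s \<in> {-R<..<R}" for s A
    using continuous_on_compose2[OF c2 continuous_on_Pair[OF continuous_on_const continuous_on_id], of s A] that by (auto simp: image_subset_iff)
  have ftc: "integral {?a..t} (\<phi>t s) = \<phi> s t - \<phi> s ?a" if "s \<in> {-R<..<R}" "t \<in> {?a..?b}" for s t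
    using that by (intro integral_unique fundamental_theorem_of_calculus)
      (auto intro!: has_vector_derivative_at_within[OF t])
  have key: "integral {?a..t} (\<phi>tr r) = \<phi>r r t - \<phi>r r ?a" if "t \<in> {?a..?b}" for t
  proof -
    have "((\<lambda>s. integral (cbox ?a t) (\<phi>t s)) has_vector_derivative integral (cbox ?a t) (\<phi>tr r)) (at r within {-R<..<R})"
    proof (rule leibniz_rule_vector_derivative[where U="{-R<..<R}" and f="\<phi>t" and fx="\<phi>tr"])
      show "((\<lambda>x. \<phi>t x s) has_vector_derivative \<phi>tr x s) (at x within {-R<..<R})" if "x \<in> {-R<..<R}" for x s
        by (rule has_vector_derivative_at_within[OF tr[OF that]])
      show "\<phi>t x integrable_on cbox ?a t" if "x \<in> {-R<..<R}" for x
        using integrable_continuous_interval[OF slice1[OF that]] by simp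
      show "continuous_on ({-R<..<R} \<times> cbox ?a t) (\<lambda>(x, t). \<phi>tr x t)"
        by (rule continuous_on_eq[OF continuous_on_subset[OF c2]]) auto
    qed (use r0 in auto)
    then have "((\<lambda>s. integral {?a..t} (\<phi>t s)) has_vector_derivative integral {?a..t} (\<phi>tr r)) (at r)"
      using r0 by (simp add: at_within_open[of r "{-R<..<R}"])
    then have "((\<lambda>s. \<phi> s t - \<phi> s ?a) has_vector_derivative integral {?a..t} (\<phi>tr r)) (at r)"
      by (rule has_vector_derivative_transform_within_open[of _ _ _ "{-R<..<R}"]) (use r0 ftc that in auto)
    moreover have "((\<lambda>s. \<phi> s t - \<phi> s ?a) has_vector_derivative (\<phi>r r t - \<phi>r r ?a)) (at r)"
      using r0 by (intro has_vector_derivative_diff r)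
    ultimately show ?thesis by (rule vector_derivative_unique_at)
  qed
  have "((\<lambda>t. integral {?a..t} (\<phi>tr r)) has_vector_derivative \<phi>tr r t0) (at t0 within {?a..?b})"
    by (rule integral_has_vector_derivative) (use slice2[OF r0] in auto)
  then have "((\<lambda>t. integral {?a..t} (\<phi>tr r)) has_vector_derivative \<phi>tr r t0) (at t0)"
    by (simp add: at_within_interior[of t0 "{?a..?b}"])
  then have "((\<lambda>t. \<phi>r r t - \<phi>r r ?a) has_vector_derivative \<phi>tr r t0) (at t0)"
    by (rule has_vector_derivative_transform_within_open[of _ _ _ "{?a<..<?b}"]) (use key in auto)
  then have "((\<lambda>t. (\<phi>r r t - \<phi>r r ?a) + \<phi>r r ?a) has_vector_derivative (\<phi>tr r t0 + 0)) (at t0)"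
    by (rule has_vector_derivative_add) simp
  then show ?thesis by simp
qed

text \<open>The relations \<open>CR1\<close> and \<open>CR2\<close> are the generalised Cauchy-Riemann system in polar coordinates
  about a real point; with \<open>S\<close> the weight, the first one reads \<open>r U\<^sub>r S = \<partial>\<^sub>t (S V)\<close>. Integration by
  parts in \<open>t\<close>, without boundary terms since \<open>V\<close> vanishes on the axis, gives for \<open>B = r M'\<close>
  \[ B = - \int (4 \langle U_t, V \rangle + 4 \lambda |V|^2) S, \qquad
     r B' + 4 \lambda B = \int (4 r^2 |U_r|^2 + 4 |U_t|^2) S \ge 0. \]
  Hence \<open>r\<^bsup>4\<lambda>\<^esup> B\<close> is nondecreasing; as it vanishes at \<open>r = 0\<close>, \<open>B \<ge> 0\<close> and \<open>M' \<ge> 0\<close>.\<close>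

lemma weighted_circle_mean_mono:
  fixes U V Ur Ut Vr Vt Utr :: "real \<Rightarrow> real \<Rightarrow> complex" and lam R a b :: real
  defines "M \<equiv> \<lambda>r. integral {-pi..pi} (\<lambda>t. ((norm (U r t))\<^sup>2 + (norm (V r t))\<^sup>2) * sin_weight lam t)"
  assumes lam: "lam \<ge> 0"
    and Ur: "\<And>r t. r \<in> {-R<..<R} \<Longrightarrow> ((\<lambda>r. U r t) has_vector_derivative Ur r t) (at r)"
    and Ut: "\<And>r t. r \<in> {-R<..<R} \<Longrightarrow> ((\<lambda>t. U r t) has_vector_derivative Ut r t) (at t)"
    and Utr: "\<And>r t. r \<in> {-R<..<R} \<Longrightarrow> ((\<lambda>r. Ut r t) has_vector_derivative Utr r t) (at r)"
    and Vr: "\<And>r t. r \<in> {-R<..<R} \<Longrightarrow> ((\<lambda>r. V r t) has_vector_derivative Vr r t) (at r)"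
    and Vt: "\<And>r t. r \<in> {-R<..<R} \<Longrightarrow> ((\<lambda>t. V r t) has_vector_derivative Vt r t) (at t)"
    and cU: "continuous_on ({-R<..<R} \<times> UNIV) (\<lambda>p. U (fst p) (snd p))"
    and cUr: "continuous_on ({-R<..<R} \<times> UNIV) (\<lambda>p. Ur (fst p) (snd p))"
    and cUt: "continuous_on ({-R<..<R} \<times> UNIV) (\<lambda>p. Ut (fst p) (snd p))"
    and cUtr: "continuous_on ({-R<..<R} \<times> UNIV) (\<lambda>p. Utr (fst p) (snd p))"
    and cV: "continuous_on ({-R<..<R} \<times> UNIV) (\<lambda>p. V (fst p) (snd p))"
    and cVr: "continuous_on ({-R<..<R} \<times> UNIV) (\<lambda>p. Vr (fst p) (snd p))"
    and CR1: "\<And>r t. r \<in> {0<..<R} \<Longrightarrow> sin t \<noteq> 0 \<Longrightarrow> r *\<^sub>R Ur r t = Vt r t + (2 * lam * cos t / sin t) *\<^sub>R V r t"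
    and CR2: "\<And>r t. r \<in> {0<..<R} \<Longrightarrow> r *\<^sub>R Vr r t = - Ut r t - (2 * lam) *\<^sub>R V r t"
    and V_axis: "\<And>r t. r \<in> {-R<..<R} \<Longrightarrow> sin t = 0 \<Longrightarrow> V r t = 0"
    and V0: "\<And>t. V 0 t = 0"
    and ab: "0 < a" "a \<le> b" "b < R"
  shows "M a \<le> M b"
proof -
  let ?S = "sin_weight lam" and ?J = "{-R<..<R}"
  have R: "0 < R" using ab by simp
  have Urt: "((\<lambda>t. Ur r t) has_vector_derivative Utr r t) (at t)" if "r \<in> ?J" for r t
    by (rule mixed_partials_commute[OF Ur Ut Utr cUt cUtr that])
  have cS: "continuous_on A (\<lambda>p. ?S (snd p))" for A :: "(real \<times> real) set"
    by (rule continuous_on_compose2[OF continuous_on_sin_weight[OF lam, of UNIV]]) (auto intro: continuous_intros)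
  have sl: "continuous_on A (F r)" if "continuous_on (?J \<times> UNIV) (\<lambda>p. F (fst p) (snd p))" "r \<in> ?J" 
    for F :: "real \<Rightarrow> real \<Rightarrow> 'x::topological_space" and A r
    using continuous_on_compose2[OF that(1) continuous_on_Pair[OF continuous_on_const continuous_on_id], of r A] that(2) by (auto simp: image_subset_iff)
  note slices = sl[OF cU] sl[OF cUr] sl[OF cUt] sl[OF cUtr] sl[OF cV] sl[OF cVr] continuous_on_sin_weight[OF lam]
  note cont = cU cUr cUt cUtr cV cVr cS
  have intble: "(\<lambda>t. f t * ?S t) integrable_on {-pi..pi}" if "continuous_on {-pi..pi} f" for f
    by (intro integrable_continuous_interval continuous_intros that slices)
  have leib: "((\<lambda>r. integral {-pi..pi} (\<lambda>t. F r t * ?S t)) has_real_derivative integral {-pi..pi} (\<lambda>t. F' r t * ?S t)) (at r)"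
    if F: "\<And>r t. r \<in> ?J \<Longrightarrow> ((\<lambda>r. F r t) has_real_derivative F' r t) (at r)"
      and cF: "continuous_on (?J \<times> UNIV) (\<lambda>p. F (fst p) (snd p))"
      and cF': "continuous_on (?J \<times> UNIV) (\<lambda>p. F' (fst p) (snd p))"
      and r: "r \<in> ?J" for F F' r
  proof -
    have "((\<lambda>r. integral (cbox (-pi) pi) (\<lambda>t. F r t * ?S t)) has_field_derivative 
        integral (cbox (-pi) pi) (\<lambda>t. F' r t * ?S t)) (at r within ?J)"
    proof (rule leibniz_rule_field_derivative[where U="?J" and f="\<lambda>r t. F r t * ?S t" and fx="\<lambda>r t. F' r t * ?S t"])
      show "((\<lambda>r. F r t * ?S t) has_field_derivative F' r t * ?S t) (at r within ?J)" if "r \<in> ?J" for r t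
        using F[OF that] by (intro DERIV_cmult_right) (rule has_field_derivative_at_within)
      show "(\<lambda>t. F r t * ?S t) integrable_on cbox (-pi) pi" if "r \<in> ?J" for r
        using intble[OF sl[OF cF that]] by simp
      have "continuous_on (?J \<times> cbox (-pi) pi) (\<lambda>p. F' (fst p) (snd p) * ?S (snd p))"
        by (intro continuous_intros continuous_on_subset[OF cF'] cS) auto
      then show "continuous_on (?J \<times> cbox (-pi) pi) (\<lambda>(x, t). F' x t * ?S t)"
        by (simp add: case_prod_beta)
    qed (use r in auto)
    then show ?thesis using r by (simp add: at_within_open[of r ?J])
  qed
  \<comment> \<open>Integration by parts against \<open>V S\<close>, whose derivative is known from \<open>CR1\<close>; the weight need
    not be differentiable at \<open>0\<close>, which the fundamental theorem tolerates as an exceptional point.\<close>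
  have ibp: "integral {-pi..pi} (\<lambda>t. (W' t \<bullet> V r t + W t \<bullet> (r *\<^sub>R Ur r t)) * ?S t) = 0"
    if W: "\<And>t. (W has_vector_derivative W' t) (at t)" and r: "r \<in> {0<..<R}" for W W' :: "real \<Rightarrow> complex" and r
  proof -
    have rJ: "r \<in> ?J" using r by auto
    have "((\<lambda>t. (W' t \<bullet> V r t + W t \<bullet> (r *\<^sub>R Ur r t)) * ?S t) has_integral
       (W pi \<bullet> V r pi) * ?S pi - (W (-pi) \<bullet> V r (-pi)) * ?S (-pi)) {-pi..pi}"
    proof (rule fundamental_theorem_of_calculus_interior_strong[where S="{0}"])
      show "continuous_on {-pi..pi} (\<lambda>t. (W t \<bullet> V r t) * ?S t)"
        by (intro continuous_intros slices rJ continuous_at_imp_continuous_on ballI has_vector_derivative_continuous[OF W])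
      fix t assume t: "t \<in> {-pi<..<pi} - {0}"
      then have s: "sin t \<noteq> 0"
        using sin_gt_zero[of t] sin_gt_zero[of "-t"] by force
      have "((\<lambda>t. W t \<bullet> V r t) has_real_derivative W t \<bullet> Vt r t + W' t \<bullet> V r t) (at t)"
        by (rule inner_has_real_derivative[OF W Vt[OF rJ]])
      from DERIV_mult[OF this sin_weight_has_derivative[OF s, of lam]]
      have "((\<lambda>t. (W t \<bullet> V r t) * ?S t) has_real_derivative (W' t \<bullet> V r t + W t \<bullet> (r *\<^sub>R Ur r t)) * ?S t) (at t)"
        unfolding CR1[OF r s] by (rule DERIV_cong) (simp add: inner_add_right algebra_simps)
      then show "((\<lambda>t. (W t \<bullet> V r t) * ?S t) has_vector_derivative (W' t \<bullet> V r t + W t \<bullet> (r *\<^sub>R Ur r t)) * ?S t) (at t)"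
        by (simp add: has_real_derivative_iff_has_vector_derivative)
    qed auto
    then show ?thesis using V_axis[OF rJ, of pi] V_axis[OF rJ, of "-pi"] by (simp add: integral_unique)
  qed
  define Mr where "Mr r = integral {-pi..pi} (\<lambda>t. (2 * (U r t \<bullet> Ur r t + V r t \<bullet> Vr r t)) * ?S t)" for r
  define B where "B r = integral {-pi..pi} (\<lambda>t. (- 4 * (Ut r t \<bullet> V r t) - 4 * lam * (V r t \<bullet> V r t)) * ?S t)" for r
  define Br where "Br r = integral {-pi..pi} (\<lambda>t. (- 4 * (Utr r t \<bullet> V r t + Ut r t \<bullet> Vr r t) - 8 * lam * (V r t \<bullet> Vr r t)) * ?S t)" for r
  have dM: "(M has_real_derivative Mr r) (at r)" if "r \<in> ?J" for r
    unfolding M_def Mr_def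
  proof (rule leib[OF _ _ _ that])
    show "((\<lambda>r. (norm (U r t))\<^sup>2 + (norm (V r t))\<^sup>2) has_real_derivative 2 * (U r t \<bullet> Ur r t + V r t \<bullet> Vr r t)) (at r)" 
      if "r \<in> ?J" for r t
      unfolding power2_norm_eq_inner
      by (rule DERIV_cong[OF DERIV_add[OF inner_has_real_derivative[OF Ur Ur] inner_has_real_derivative[OF Vr Vr]]]) (use that in \<open>auto simp: inner_commute\<close>)
  qed (intro continuous_intros cont)+
  have dB: "(B has_real_derivative Br r) (at r)" if "r \<in> ?J" for r
    unfolding B_def Br_def
  proof (rule leib[OF _ _ _ that])
    show "((\<lambda>r. - 4 * (Ut r t \<bullet> V r t) - 4 * lam * (V r t \<bullet> V r t)) has_real_derivative 
       - 4 * (Utr r t \<bullet> V r t + Ut r t \<bullet> Vr r t) - 8 * lam * (V r t \<bullet> Vr r t)) (at r)" 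
      if "r \<in> ?J" for r t
      by (rule DERIV_cong[OF DERIV_diff[OF DERIV_cmult[OF inner_has_real_derivative[OF Utr Vr]] DERIV_cmult[OF inner_has_real_derivative[OF Vr Vr]]]])
        (use that in \<open>auto simp: inner_commute\<close>)
  qed (intro continuous_intros cont)+
  have rMr: "r * Mr r = B r" if r: "r \<in> {0<..<R}" for r
  proof -
    have rJ: "r \<in> ?J" using r by auto
    have "r * Mr r - B r = integral {-pi..pi} (\<lambda>t. r * ((2 * (U r t \<bullet> Ur r t + V r t \<bullet> Vr r t)) * ?S t)) - B r"
      unfolding Mr_def by simp
    also have "\<dots> = integral {-pi..pi} (\<lambda>t. r * ((2 * (U r t \<bullet> Ur r t + V r t \<bullet> Vr r t)) * ?S t) - 
       (- 4 * (Ut r t \<bullet> V r t) - 4 * lam * (V r t \<bullet> V r t)) * ?S t)"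
      unfolding B_def by (rule integral_diff[symmetric]) (intro integrable_continuous_interval continuous_intros slices rJ)+
    also have "\<dots> = integral {-pi..pi} (\<lambda>t. 2 * ((Ut r t \<bullet> V r t + U r t \<bullet> (r *\<^sub>R Ur r t)) * ?S t))"
    proof (rule integral_cong)
      fix t
      have "r * (V r t \<bullet> Vr r t) = V r t \<bullet> (r *\<^sub>R Vr r t)" by simp
      then have "r * (V r t \<bullet> Vr r t) = - (Ut r t \<bullet> V r t) - 2 * lam * (V r t \<bullet> V r t)"
        unfolding CR2[OF r] by (simp add: inner_diff_right inner_commute)
      then show "r * ((2 * (U r t \<bullet> Ur r t + V r t \<bullet> Vr r t)) * ?S t) - (- 4 * (Ut r t \<bullet> V r t) - 4 * lam * (V r t \<bullet> V r t)) * ?S t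
         = 2 * ((Ut r t \<bullet> V r t + U r t \<bullet> (r *\<^sub>R Ur r t)) * ?S t)"
        by (simp add: algebra_simps) algebra
    qed
    also have "\<dots> = 0" using ibp[OF Ut[OF rJ] r] by simp
    finally show ?thesis by simp
  qed
  have rBr: "r * Br r + 4 * lam * B r \<ge> 0" if r: "r \<in> {0<..<R}" for r
  proof -
    have rJ: "r \<in> ?J" using r by auto
    have ib: "integral {-pi..pi} (\<lambda>t. 4 * r * ((Utr r t \<bullet> V r t + Ur r t \<bullet> (r *\<^sub>R Ur r t)) * ?S t)) = 0"
      using ibp[OF Urt[OF rJ] r] by simp
    have "r * Br r + 4 * lam * B r = integral {-pi..pi} (\<lambda>t. r * ((- 4 * (Utr r t \<bullet> V r t + Ut r t \<bullet> Vr r t) - 8 * lam * (V r t \<bullet> Vr r t)) * ?S t))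
       + integral {-pi..pi} (\<lambda>t. 4 * lam * ((- 4 * (Ut r t \<bullet> V r t) - 4 * lam * (V r t \<bullet> V r t)) * ?S t))
       + integral {-pi..pi} (\<lambda>t. 4 * r * ((Utr r t \<bullet> V r t + Ur r t \<bullet> (r *\<^sub>R Ur r t)) * ?S t))"
      unfolding Br_def B_def ib by simp
    also have "\<dots> = integral {-pi..pi} (\<lambda>t. r * ((- 4 * (Utr r t \<bullet> V r t + Ut r t \<bullet> Vr r t) - 8 * lam * (V r t \<bullet> Vr r t)) * ?S t)
       + 4 * lam * ((- 4 * (Ut r t \<bullet> V r t) - 4 * lam * (V r t \<bullet> V r t)) * ?S t)
       + 4 * r * ((Utr r t \<bullet> V r t + Ur r t \<bullet> (r *\<^sub>R Ur r t)) * ?S t))"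
      by (subst integral_add[symmetric], (intro integrable_continuous_interval continuous_intros slices rJ)+)+ simp
    also have "\<dots> = integral {-pi..pi} (\<lambda>t. (4 * r\<^sup>2 * (Ur r t \<bullet> Ur r t) + 4 * (Ut r t \<bullet> Ut r t)) * ?S t)"
    proof (rule integral_cong)
      fix t
      have 1: "r * (V r t \<bullet> Vr r t) = V r t \<bullet> (r *\<^sub>R Vr r t)" "r * (Ut r t \<bullet> Vr r t) = Ut r t \<bullet> (r *\<^sub>R Vr r t)" by simp_all
      have 2: "r * (V r t \<bullet> Vr r t) = - (Ut r t \<bullet> V r t) - 2 * lam * (V r t \<bullet> V r t)"
        unfolding 1 CR2[OF r] by (simp add: inner_diff_right inner_commute)
      have 3: "r * (Ut r t \<bullet> Vr r t) = - (Ut r t \<bullet> Ut r t) - 2 * lam * (Ut r t \<bullet> V r t)"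
        unfolding 1 CR2[OF r] by (simp add: inner_diff_right inner_commute)
      have "r * (- 4 * (Utr r t \<bullet> V r t + Ut r t \<bullet> Vr r t) - 8 * lam * (V r t \<bullet> Vr r t))
       + 4 * lam * (- 4 * (Ut r t \<bullet> V r t) - 4 * lam * (V r t \<bullet> V r t))
       + 4 * r * (Utr r t \<bullet> V r t + Ur r t \<bullet> (r *\<^sub>R Ur r t)) = 
        - 4 * (r * (Ut r t \<bullet> Vr r t)) - 8 * lam * (r * (V r t \<bullet> Vr r t)) + 4 * lam * (- 4 * (Ut r t \<bullet> V r t) - 4 * lam * (V r t \<bullet> V r t))
         + 4 * r\<^sup>2 * (Ur r t \<bullet> Ur r t)"
        by (simp add: algebra_simps power2_eq_square)
      also have "\<dots> = 4 * r\<^sup>2 * (Ur r t \<bullet> Ur r t) + 4 * (Ut r t \<bullet> Ut r t)"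
        unfolding 2 3 by (simp add: algebra_simps)
      finally have e: "r * (- 4 * (Utr r t \<bullet> V r t + Ut r t \<bullet> Vr r t) - 8 * lam * (V r t \<bullet> Vr r t))
       + 4 * lam * (- 4 * (Ut r t \<bullet> V r t) - 4 * lam * (V r t \<bullet> V r t))
       + 4 * r * (Utr r t \<bullet> V r t + Ur r t \<bullet> (r *\<^sub>R Ur r t)) = 4 * r\<^sup>2 * (Ur r t \<bullet> Ur r t) + 4 * (Ut r t \<bullet> Ut r t)" .
      show "r * ((- 4 * (Utr r t \<bullet> V r t + Ut r t \<bullet> Vr r t) - 8 * lam * (V r t \<bullet> Vr r t)) * ?S t)
       + 4 * lam * ((- 4 * (Ut r t \<bullet> V r t) - 4 * lam * (V r t \<bullet> V r t)) * ?S t)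
       + 4 * r * ((Utr r t \<bullet> V r t + Ur r t \<bullet> (r *\<^sub>R Ur r t)) * ?S t) = (4 * r\<^sup>2 * (Ur r t \<bullet> Ur r t) + 4 * (Ut r t \<bullet> Ut r t)) * ?S t"
        unfolding e[symmetric] by (simp only: distrib_right mult.assoc)
    qed
    also have "\<dots> \<ge> 0"
      by (rule integral_nonneg) (auto intro!: integrable_continuous_interval continuous_intros slices rJ mult_nonneg_nonneg sin_weight_nonneg)
    finally show ?thesis .
  qed
  have B0: "B 0 = 0" unfolding B_def V0 by simp
  \<comment> \<open>The integrating factor; the value \<open>1\<close> at \<open>r = 0\<close> for \<open>\<lambda> = 0\<close> keeps it continuous.\<close>
  define wt where "wt r = (if lam = 0 then 1 else r powr (4 * lam))" for r
  have Bnn: "B r \<ge> 0" if r: "r \<in> {0<..<R}" for r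
  proof -
    have "wt 0 * B 0 \<le> wt r * B r"
    proof (rule DERIV_nonneg_imp_increasing_open[where f="\<lambda>r. wt r * B r"])
      fix x assume x: "0 < x" "x < r"
      have "(wt has_real_derivative 4 * lam * (wt x / x)) (at x)"
      proof (cases "lam = 0")
        case True
        then have "wt = (\<lambda>_. 1)" by (simp add: wt_def fun_eq_iff)
        then show ?thesis using True by simp
      next
        case False
        then have e: "wt = (\<lambda>r. r powr (4 * lam))" by (simp add: wt_def fun_eq_iff)
        show ?thesis unfolding e using x
          by (auto intro!: derivative_eq_intros simp: powr_diff)
      qed
      from DERIV_mult[OF this dB[of x]] x r
      have d: "((\<lambda>r. wt r * B r) has_real_derivative 4 * lam * (wt x / x) * B x + Br x * wt x) (at x)" by auto
      have "4 * lam * (wt x / x) * B x + Br x * wt x = (wt x / x) * (x * Br x + 4 * lam * B x)"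
        using x by (simp add: field_simps)
      also have "\<dots> \<ge> 0" using rBr[of x] x r by (intro mult_nonneg_nonneg) (auto simp: wt_def)
      finally show "\<exists>y. ((\<lambda>r. wt r * B r) has_real_derivative y) (at x) \<and> y \<ge> 0" using d by blast
    next
      have "continuous_on {0..r} wt" 
      proof (cases "lam = 0")
        case False
        then have "wt = (\<lambda>r. r powr (4 * lam))" by (simp add: wt_def fun_eq_iff)
        moreover have "continuous_on {0..r} (\<lambda>r. r powr (4 * lam))"
          using False lam by (intro continuous_on_powr' continuous_intros) auto
        ultimately show ?thesis by simp
      qed (simp add: wt_def)
      moreover have "continuous_on {0..r} B"
        using r by (intro continuous_at_imp_continuous_on ballI DERIV_isCont[OF dB]) auto
      ultimately show "continuous_on {0..r} (\<lambda>r. wt r * B r)" by (intro continuous_intros)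
    qed (use r in auto)
    moreover have "wt r > 0" using r by (simp add: wt_def)
    ultimately show ?thesis using B0 by (simp add: zero_le_mult_iff)
  qed
  show "M a \<le> M b"
  proof (rule DERIV_nonneg_imp_nondecreasing[where f=M])
    fix x assume "a \<le> x" "x \<le> b"
    then have x: "x \<in> {0<..<R}" using ab by auto
    then have "x * Mr x \<ge> 0" using rMr Bnn by simp
    then have "Mr x \<ge> 0" using x by (simp add: zero_le_mult_iff)
    then show "\<exists>y. (M has_real_derivative y) (at x) \<and> y \<ge> 0" using dM[of x] x by auto
  qed (rule ab)
qed

section \<open>Circle estimates for lambda-analytic functions\<close>

lemma has_derivative_partials:
  assumes "f differentiable (at z)"
  shows "(f has_derivative (\<lambda>h. Re h *\<^sub>R partial_x f z + Im h *\<^sub>R partial_y f z)) (at z)"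
proof -
  have d: "(f has_derivative frechet_derivative f (at z)) (at z)"
    using assms by (simp add: frechet_derivative_works)
  then have l: "linear (frechet_derivative f (at z))"
    by (rule has_derivative_linear)
  have "frechet_derivative f (at z) h = Re h *\<^sub>R partial_x f z + Im h *\<^sub>R partial_y f z" for h
  proof -
    have h: "h = Re h *\<^sub>R 1 + Im h *\<^sub>R \<i>" by (simp add: complex_eq_iff)
    show ?thesis unfolding partial_x_def partial_y_def
      by (subst h) (simp only: linear_add[OF l] linear_scale[OF l])
  qed
  then have "frechet_derivative f (at z) = (\<lambda>h. Re h *\<^sub>R partial_x f z + Im h *\<^sub>R partial_y f z)" by blast
  then show ?thesis using d by simp
qed

lemma Ck2_D:
  assumes "Ck 2 f S"
  shows "\<And>z. z \<in> S \<Longrightarrow> f differentiable (at z)"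
    "\<And>z. z \<in> S \<Longrightarrow> partial_x f differentiable (at z)"
    "\<And>z. z \<in> S \<Longrightarrow> partial_y f differentiable (at z)"
    "continuous_on S (partial_x (partial_x f))" "continuous_on S (partial_y (partial_x f))"
    "continuous_on S (partial_x (partial_y f))" "continuous_on S (partial_y (partial_y f))"
  using assms unfolding numeral_2_eq_2 One_nat_def Ck.simps partial_x_def[abs_def] partial_y_def[abs_def] by blast+

lemma has_vector_derivative_rcis_radius: "((\<lambda>r. c + rcis r t) has_vector_derivative cis t) (at r)"
proof -
  have "((\<lambda>r. c + r *\<^sub>R cis t) has_vector_derivative 0 + (0 + 1 *\<^sub>R cis t)) (at r)"
    by (auto intro!: derivative_eq_intros)
  then show ?thesis by (simp add: rcis_def scaleR_conv_of_real)
qed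

lemma has_vector_derivative_rcis_angle: "((\<lambda>t. c + rcis r t) has_vector_derivative rcis r t * \<i>) (at t)"
proof -
  have "((\<lambda>t. c + of_real r * exp (\<i> * of_real t)) has_vector_derivative 0 + of_real r * (\<i> * 1 * exp (\<i> * of_real t))) (at t)"
    by (rule derivative_eq_intros has_vector_derivative_real_field refl | simp)+
  then show ?thesis by (simp add: rcis_def cis_conv_exp mult_ac)
qed

lemma has_vector_derivative_along_curve:
  assumes "g differentiable (at (\<gamma> x))" "(\<gamma> has_vector_derivative \<gamma>') (at x)"
  shows "((\<lambda>x. g (\<gamma> x)) has_vector_derivative Re \<gamma>' *\<^sub>R partial_x g (\<gamma> x) + Im \<gamma>' *\<^sub>R partial_y g (\<gamma> x)) (at x)"
  unfolding has_vector_derivative_def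
  by (rule has_derivative_eq_rhs[OF has_derivative_compose[OF assms(2)[unfolded has_vector_derivative_def] has_derivative_partials[OF assms(1)]]])
    (simp add: fun_eq_iff scaleR_add_right)

lemma polar_derivatives:
  assumes "g differentiable (at (c + rcis r t))"
  shows "((\<lambda>r. g (c + rcis r t)) has_vector_derivative
            cos t *\<^sub>R partial_x g (c + rcis r t) + sin t *\<^sub>R partial_y g (c + rcis r t)) (at r)"
    and "((\<lambda>t. g (c + rcis r t)) has_vector_derivative
            (- r * sin t) *\<^sub>R partial_x g (c + rcis r t) + (r * cos t) *\<^sub>R partial_y g (c + rcis r t)) (at t)"
  using has_vector_derivative_along_curve[OF assms has_vector_derivative_rcis_radius]
    has_vector_derivative_along_curve[OF assms has_vector_derivative_rcis_angle] by simp_all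

lemma continuous_on_polar:
  assumes "continuous_on S g" "\<And>p. p \<in> A \<Longrightarrow> c + rcis (fst p) (snd p) \<in> S"
  shows "continuous_on A (\<lambda>p. g (c + rcis (fst p) (snd p)))"
proof (rule continuous_on_compose2[OF assms(1)])
  have "(\<lambda>p. c + rcis (fst p) (snd p)) = (\<lambda>p. c + of_real (fst p) * exp (\<i> * of_real (snd p)))"
    by (simp add: rcis_def cis_conv_exp)
  then show "continuous_on A (\<lambda>p. c + rcis (fst p) (snd p))"
    by (simp only:) (intro continuous_intros)
qed (use assms(2) in auto)

text \<open>The equation away from the axis: \<open>(f z - f (cnj z)) / \<i>\<close> is twice the function \<open>v\<close>.\<close>

lemma lambda_analyticD:
  assumes "lambda_analytic lam f" "z \<in> ball 0 1" "Im z \<noteq> 0"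
  shows "partial_x f z + \<i> * partial_y f z = of_real (lam / Im z) * ((f z - f (cnj z)) / \<i>)"
proof -
  have "D_zbar lam f z = 0" using assms by (auto simp: lambda_analytic_def)
  then have "partial_x f z + \<i> * partial_y f z = 2 * (of_real lam * ((f z - f (cnj z)) / (z - cnj z)))"
    using assms(3) by (simp add: D_zbar_def partial_zbar_def reflection_quotient_def)
  also have "z - cnj z = 2 * (of_real (Im z) * \<i>)" by (simp add: complex_diff_cnj mult_ac)
  also have "2 * (of_real lam * (w / (2 * (of_real (Im z) * \<i>)))) = of_real (lam / Im z) * (w / \<i>)" for w
    using assms(3) by (simp only: of_real_divide) (simp add: field_simps del: complex_i_mult_minus)
  finally show ?thesis .
qed

lemma lambda_analytic_C2:
  assumes "lambda_analytic lam f"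
  shows "Ck 2 f (ball 0 1)"
  using assms by (simp add: lambda_analytic_def)

lemma continuous_on_differentiable:
  fixes g :: "complex \<Rightarrow> complex"
  assumes "\<And>z. z \<in> S \<Longrightarrow> g differentiable (at z)"
  shows "continuous_on S g"
  using assms by (intro continuous_at_imp_continuous_on ballI differentiable_imp_continuous_within) auto

lemma cnj_real_center: "cnj (of_real x0 + rcis r t) = of_real x0 + rcis r (-t)"
  by (simp add: complex_eq_iff)

lemma rcis_norm_less:
  assumes "\<bar>r\<bar> < 1 - norm c"
  shows "c + rcis r t \<in> ball 0 1"
  using assms norm_triangle_ineq[of c "rcis r t"] by (simp add: norm_mult rcis_def)

text \<open>With \<open>u\<close>, \<open>v\<close> read off from the even and odd parts of \<open>f\<close> on the circles about \<open>x0\<close>, the equation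
  at \<open>z\<close> and at \<open>cnj z\<close> yields the system of \<open>weighted_circle_mean_mono\<close>, and \<open>w\<close> equals
  \<open>2 (\<bar>u\<bar>\<^sup>2 + \<bar>v\<bar>\<^sup>2)\<close> by the parallelogram law.\<close>

lemma real_circle_mean_mono:
  fixes x0 :: real
  assumes f: "lambda_analytic lam f" and lam: "lam \<ge> 0"
    and ab: "0 < a" "a \<le> b" "b < 1 - \<bar>x0\<bar>"
  defines "w \<equiv> \<lambda>z. (norm (f z))\<^sup>2 + (norm (f (cnj z)))\<^sup>2"
  shows "integral {-pi..pi} (\<lambda>t. w (of_real x0 + rcis a t) * sin_weight lam t)
     \<le> integral {-pi..pi} (\<lambda>t. w (of_real x0 + rcis b t) * sin_weight lam t)"
proof -
  define R where "R = 1 - \<bar>x0\<bar>"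
  let ?J = "{-R<..<R}" and ?D = "ball (0::complex) 1"
  let ?z = "\<lambda>r t. of_real x0 + rcis r t"
  note C2 = Ck2_D[OF lambda_analytic_C2[OF f]]
  have zD: "?z r t \<in> ?D" if "r \<in> ?J" for r t
    using that by (intro rcis_norm_less) (auto simp: R_def)
  define F where "F r t = f (?z r t)" for r t
  define Fx where "Fx r t = partial_x f (?z r t)" for r t
  define Fy where "Fy r t = partial_y f (?z r t)" for r t
  define Fr where "Fr r t = cos t *\<^sub>R Fx r t + sin t *\<^sub>R Fy r t" for r t
  define Ft where "Ft r t = (- r * sin t) *\<^sub>R Fx r t + (r * cos t) *\<^sub>R Fy r t" for r t
  define Fxr where "Fxr r t = cos t *\<^sub>R partial_x (partial_x f) (?z r t) + sin t *\<^sub>R partial_y (partial_x f) (?z r t)" for r t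
  define Fyr where "Fyr r t = cos t *\<^sub>R partial_x (partial_y f) (?z r t) + sin t *\<^sub>R partial_y (partial_y f) (?z r t)" for r t
  define Ftr where "Ftr r t = (- sin t) *\<^sub>R Fx r t + (- r * sin t) *\<^sub>R Fxr r t + (cos t *\<^sub>R Fy r t + (r * cos t) *\<^sub>R Fyr r t)" for r t
  have cs: "continuous_on (?J \<times> UNIV) (\<lambda>p. g (?z (fst p) (snd p)))" if "continuous_on ?D g" for g :: "complex \<Rightarrow> complex"
    by (rule continuous_on_polar[OF that]) (use zD in \<open>simp add: mem_Times_iff\<close>)
  have cF: "continuous_on (?J \<times> UNIV) (\<lambda>p. F (fst p) (snd p))"
    unfolding F_def by (intro cs continuous_on_differentiable C2)
  have cFx: "continuous_on (?J \<times> UNIV) (\<lambda>p. Fx (fst p) (snd p))"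
    unfolding Fx_def by (intro cs continuous_on_differentiable C2)
  have cFy: "continuous_on (?J \<times> UNIV) (\<lambda>p. Fy (fst p) (snd p))"
    unfolding Fy_def by (intro cs continuous_on_differentiable C2)
  have cFr: "continuous_on (?J \<times> UNIV) (\<lambda>p. Fr (fst p) (snd p))"
    unfolding Fr_def by (intro continuous_intros cFx cFy)
  have cFt: "continuous_on (?J \<times> UNIV) (\<lambda>p. Ft (fst p) (snd p))"
    unfolding Ft_def by (intro continuous_intros cFx cFy)
  have cFtr: "continuous_on (?J \<times> UNIV) (\<lambda>p. Ftr (fst p) (snd p))"
    unfolding Ftr_def Fxr_def Fyr_def by (intro continuous_intros cFx cFy cs C2)
  have flip: "continuous_on (?J \<times> UNIV) (\<lambda>p. g (fst p) (- snd p))" 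
    if "continuous_on (?J \<times> UNIV) (\<lambda>p. g (fst p) (snd p))" for g :: "real \<Rightarrow> real \<Rightarrow> complex"
  proof -
    have "continuous_on (?J \<times> UNIV) (\<lambda>p::real\<times>real. (fst p, - snd p))" by (intro continuous_intros)
    from continuous_on_compose2[OF that this] show ?thesis by (auto simp: image_subset_iff)
  qed
  have dFr: "((\<lambda>r. F r t) has_vector_derivative Fr r t) (at r)" if "r \<in> ?J" for r t
    unfolding F_def Fr_def Fx_def Fy_def by (rule polar_derivatives(1)) (intro C2 zD that)
  have dFxr: "((\<lambda>r. Fx r t) has_vector_derivative Fxr r t) (at r)" if "r \<in> ?J" for r t
    unfolding Fx_def Fxr_def by (rule polar_derivatives(1)) (intro C2 zD that)
  have dFyr: "((\<lambda>r. Fy r t) has_vector_derivative Fyr r t) (at r)" if "r \<in> ?J" for r t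
    unfolding Fy_def Fyr_def by (rule polar_derivatives(1)) (intro C2 zD that)
  have dFt: "((\<lambda>t. F r t) has_vector_derivative Ft r t) (at t)" if "r \<in> ?J" for r t
    unfolding F_def Ft_def Fx_def Fy_def by (rule polar_derivatives(2)) (intro C2 zD that)
  have dFt': "((\<lambda>t. F r (- t)) has_vector_derivative - Ft r (- t)) (at t)" if "r \<in> ?J" for r t
  proof -
    have "((\<lambda>t. - t :: real) has_vector_derivative -1) (at t)" by (auto intro!: derivative_eq_intros)
    from vector_diff_chain_at[OF this, of "F r"] dFt[OF that] show ?thesis by (simp add: o_def)
  qed
  have dFtr: "((\<lambda>r. Ft r t) has_vector_derivative Ftr r t) (at r)" if "r \<in> ?J" for r t
  proof -
    have "((\<lambda>r. - r * sin t) has_real_derivative - sin t) (at r)" "((\<lambda>r. r * cos t) has_real_derivative cos t) (at r)"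
      by (auto intro!: derivative_eq_intros)
    from has_vector_derivative_add[OF has_vector_derivative_scaleR[OF this(1) dFxr[OF that]] has_vector_derivative_scaleR[OF this(2) dFyr[OF that]]]
    show ?thesis unfolding Ft_def Ftr_def by (simp add: algebra_simps)
  qed
  define U where "U r t = (1/2::real) *\<^sub>R (F r t + F r (- t))" for r t
  define V where "V r t = (1/(2*\<i>)) * (F r t - F r (- t))" for r t
  define Ur where "Ur r t = (1/2::real) *\<^sub>R (Fr r t + Fr r (- t))" for r t
  define Ut where "Ut r t = (1/2::real) *\<^sub>R (Ft r t + - Ft r (- t))" for r t
  define Utr where "Utr r t = (1/2::real) *\<^sub>R (Ftr r t + - Ftr r (- t))" for r t
  define Vr where "Vr r t = (1/(2*\<i>)) * (Fr r t - Fr r (- t))" for r t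
  define Vt where "Vt r t = (1/(2*\<i>)) * (Ft r t - - Ft r (- t))" for r t
  have scal: "((\<lambda>x. (1/2::real) *\<^sub>R g x) has_vector_derivative (1/2::real) *\<^sub>R g') (at x)" 
    if "(g has_vector_derivative g') (at x)" for g :: "real \<Rightarrow> complex" and g' x
    using has_vector_derivative_scaleR[OF DERIV_const that, of "1/2"] by simp
  have pde: "Fx r t + \<i> * Fy r t = of_real (2 * lam / (r * sin t)) * V r t" if "r \<in> ?J" "r * sin t \<noteq> 0" for r t
  proof -
    have im: "Im (?z r t) = r * sin t" by simp
    have "of_real (2 * lam / (r * sin t)) * V r t = of_real (lam / (r * sin t)) * ((F r t - F r (- t)) / \<i>)"
      unfolding V_def by simp
    then show ?thesis
      using lambda_analyticD[OF f zD[OF that(1), of t], unfolded im, OF that(2)]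
      by (simp only: Fx_def Fy_def F_def cnj_real_center)
  qed
  have V_neg: "V r (- t) = - V r t" for r t by (simp add: V_def field_simps)
  have CR: "r *\<^sub>R Ur r t = Vt r t + (2 * lam * cos t / sin t) *\<^sub>R V r t \<and>
    r *\<^sub>R Vr r t = - Ut r t - (2 * lam) *\<^sub>R V r t" if r: "r \<in> {0<..<R}" and s: "sin t \<noteq> 0" for r t
  proof -
    have rJ: "r \<in> ?J" and r0: "r \<noteq> 0" using r by auto
    define Q where "Q = of_real (2 * lam / (r * sin t)) * V r t"
    have VQ: "V r t * of_real (2 * lam) = of_real (r * sin t) * Q"
      using r0 s by (simp add: Q_def)
    have VQ2: "V r t * of_real (2 * lam * cos t / sin t) = of_real (r * cos t) * Q"
      using r0 s by (simp add: Q_def field_simps)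
    have 1: "Fx r t = Q - \<i> * Fy r t" using pde[OF rJ, of t] r0 s by (simp add: Q_def algebra_simps)
    have 2: "Fx r (-t) = Q - \<i> * Fy r (-t)" using pde[OF rJ, of "-t"] r0 s by (simp add: Q_def V_neg algebra_simps)
    have ii: "1 / (2 * \<i>) = - \<i> / 2" by (simp add: field_simps)
    have "r *\<^sub>R Ur r t = Vt r t + V r t * of_real (2 * lam * cos t / sin t)"
      unfolding VQ2 Ur_def Vt_def Fr_def Ft_def 1 2 ii by (simp add: scaleR_conv_of_real algebra_simps)
    moreover have "r *\<^sub>R Vr r t = - Ut r t - V r t * of_real (2 * lam)"
      unfolding VQ Ut_def Vr_def Fr_def Ft_def 1 2 ii by (simp add: scaleR_conv_of_real algebra_simps)
    ultimately show ?thesis by (simp add: scaleR_conv_of_real mult.commute)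
  qed
  have sym: "?z r (-t) = ?z r t" if "sin t = 0" for r t using that by (simp add: complex_eq_iff)
  have "integral {-pi..pi} (\<lambda>t. ((norm (U a t))\<^sup>2 + (norm (V a t))\<^sup>2) * sin_weight lam t) \<le>
     integral {-pi..pi} (\<lambda>t. ((norm (U b t))\<^sup>2 + (norm (V b t))\<^sup>2) * sin_weight lam t)"
  proof (rule weighted_circle_mean_mono[where U=U and V=V and R=R and Ur=Ur and Ut=Ut and Vr=Vr and Vt=Vt and Utr=Utr])
    fix r t assume r: "r \<in> ?J"
    show "((\<lambda>r. U r t) has_vector_derivative Ur r t) (at r)"
      unfolding U_def Ur_def by (intro scal has_vector_derivative_add dFr r)
    show "(U r has_vector_derivative Ut r t) (at t)"
      unfolding U_def[abs_def] Ut_def by (intro scal has_vector_derivative_add dFt dFt' r)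
    show "((\<lambda>r. Ut r t) has_vector_derivative Utr r t) (at r)"
      unfolding Ut_def Utr_def by (intro scal has_vector_derivative_add has_vector_derivative_minus dFtr r)
    show "((\<lambda>r. V r t) has_vector_derivative Vr r t) (at r)"
      unfolding V_def Vr_def by (intro has_vector_derivative_mult_right has_vector_derivative_diff dFr r)
    show "(V r has_vector_derivative Vt r t) (at t)"
      unfolding V_def[abs_def] Vt_def by (intro has_vector_derivative_mult_right has_vector_derivative_diff dFt dFt' r)
    show "sin t = 0 \<Longrightarrow> V r t = 0" by (simp add: V_def F_def sym)
  next
    fix r t assume r: "r \<in> {0<..<R}"
    show "sin t \<noteq> 0 \<Longrightarrow> r *\<^sub>R Ur r t = Vt r t + (2 * lam * cos t / sin t) *\<^sub>R V r t" using CR[OF r] by blast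
    show "r *\<^sub>R Vr r t = - Ut r t - (2 * lam) *\<^sub>R V r t"
    proof (cases "sin t = 0")
      case True
      then show ?thesis by (simp add: Vr_def Ut_def V_def Fr_def Ft_def F_def Fx_def Fy_def sym)
    qed (use CR[OF r] in blast)
  next
    show "V 0 t = 0" for t by (simp add: V_def F_def)
  next
    show "continuous_on (?J \<times> UNIV) (\<lambda>p. U (fst p) (snd p))"
      unfolding U_def by (intro continuous_intros cF flip[OF cF])
    show "continuous_on (?J \<times> UNIV) (\<lambda>p. Ur (fst p) (snd p))"
      unfolding Ur_def by (intro continuous_intros cFr flip[OF cFr])
    show "continuous_on (?J \<times> UNIV) (\<lambda>p. Ut (fst p) (snd p))"
      unfolding Ut_def by (intro continuous_intros cFt flip[OF cFt])
    show "continuous_on (?J \<times> UNIV) (\<lambda>p. Utr (fst p) (snd p))"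
      unfolding Utr_def by (intro continuous_intros cFtr flip[OF cFtr])
    show "continuous_on (?J \<times> UNIV) (\<lambda>p. V (fst p) (snd p))"
      unfolding V_def by (intro continuous_intros cF flip[OF cF])
    show "continuous_on (?J \<times> UNIV) (\<lambda>p. Vr (fst p) (snd p))"
      unfolding Vr_def by (intro continuous_intros cFr flip[OF cFr])
  qed (use lam ab in \<open>simp_all add: R_def\<close>)
  moreover have "((norm (U r t))\<^sup>2 + (norm (V r t))\<^sup>2) * sin_weight lam t = (1/2) * (w (?z r t) * sin_weight lam t)" for r t
  proof -
    have "(norm (x + y))\<^sup>2 + (norm (x - y))\<^sup>2 = 2 * ((norm x)\<^sup>2 + (norm y)\<^sup>2)" for x y :: complex
      by (simp add: power2_norm_eq_inner inner_add_left inner_add_right inner_diff_left inner_diff_right algebra_simps)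
    from this[of "F r t" "F r (-t)"] have "(norm (U r t))\<^sup>2 + (norm (V r t))\<^sup>2 = (1/2) * ((norm (F r t))\<^sup>2 + (norm (F r (-t)))\<^sup>2)"
      by (simp add: U_def V_def norm_mult norm_divide power_mult_distrib power_divide)
    then show ?thesis unfolding w_def cnj_real_center F_def[symmetric] by simp
  qed
  ultimately show ?thesis by simp
qed

text \<open>The radial derivative of \<open>f\<close> is \<open>e\<^bsup>-it\<^esup> (f\<^sub>x + \<i> f\<^sub>y)\<close> plus a multiple of the angular derivative. The
  latter integrates to \<open>0\<close> over a circle, and the former is at most \<open>\<lambda> S / \<bar>y\<bar>\<close>; so the circle mean
  changes slowly with the radius, starting from the value at the centre.\<close>

lemma far_circle_estimate:
  assumes f: "lambda_analytic lam f" and lam: "lam \<ge> 0" and y: "Im z0 \<noteq> 0"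
    and r: "0 < r" "r \<le> \<bar>Im z0\<bar> / 2" "r < 1 - norm z0"
    and S: "\<And>z. z \<in> ball z0 r \<Longrightarrow> norm (f z) + norm (f (cnj z)) \<le> S"
  shows "2 * pi * norm (f z0) \<le> integral {-pi..pi} (\<lambda>t. norm (f (z0 + rcis r t))) + 4 * pi * lam * r * S / \<bar>Im z0\<bar>"
proof -
  define R where "R = 1 - norm z0"
  let ?J = "{-R<..<R}" and ?D = "ball (0::complex) 1"
  let ?z = "\<lambda>r t. z0 + rcis r t"
  note C2 = Ck2_D[OF lambda_analytic_C2[OF f]]
  have zD: "?z r t \<in> ?D" if "r \<in> ?J" for r t
    using that by (intro rcis_norm_less) (auto simp: R_def)
  define F where "F r t = f (?z r t)" for r t
  define Fx where "Fx r t = partial_x f (?z r t)" for r t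
  define Fy where "Fy r t = partial_y f (?z r t)" for r t
  define Fr where "Fr r t = cos t *\<^sub>R Fx r t + sin t *\<^sub>R Fy r t" for r t
  define Ft where "Ft r t = (- r * sin t) *\<^sub>R Fx r t + (r * cos t) *\<^sub>R Fy r t" for r t
  have cs: "continuous_on (?J \<times> UNIV) (\<lambda>p. g (?z (fst p) (snd p)))" if "continuous_on ?D g" for g :: "complex \<Rightarrow> complex"
    by (rule continuous_on_polar[OF that]) (use zD in \<open>simp add: mem_Times_iff\<close>)
  have cF: "continuous_on (?J \<times> UNIV) (\<lambda>p. F (fst p) (snd p))"
    unfolding F_def by (intro cs continuous_on_differentiable C2)
  have cFx: "continuous_on (?J \<times> UNIV) (\<lambda>p. Fx (fst p) (snd p))"
    unfolding Fx_def by (intro cs continuous_on_differentiable C2)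
  have cFy: "continuous_on (?J \<times> UNIV) (\<lambda>p. Fy (fst p) (snd p))"
    unfolding Fy_def by (intro cs continuous_on_differentiable C2)
  have cFr: "continuous_on (?J \<times> UNIV) (\<lambda>p. Fr (fst p) (snd p))"
    unfolding Fr_def by (intro continuous_intros cFx cFy)
  have sl: "continuous_on A (G r)" if "continuous_on (?J \<times> UNIV) (\<lambda>p. G (fst p) (snd p))" "r \<in> ?J" 
    for G :: "real \<Rightarrow> real \<Rightarrow> complex" and A r
    using continuous_on_compose2[OF that(1) continuous_on_Pair[OF continuous_on_const continuous_on_id], of r A] that(2) by (auto simp: image_subset_iff)
  have dFr: "((\<lambda>r. F r t) has_vector_derivative Fr r t) (at r)" if "r \<in> ?J" for r t
    unfolding F_def Fr_def Fx_def Fy_def by (rule polar_derivatives(1)) (intro C2 zD that)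
  have dFt: "((\<lambda>t. F r t) has_vector_derivative Ft r t) (at t)" if "r \<in> ?J" for r t
    unfolding F_def Ft_def Fx_def Fy_def by (rule polar_derivatives(2)) (intro C2 zD that)
  define m where "m s = integral {-pi..pi} (F s)" for s
  have dm: "(m has_vector_derivative integral {-pi..pi} (Fr s)) (at s)" if "s \<in> ?J" for s
  proof -
    have "((\<lambda>s. integral (cbox (-pi) pi) (F s)) has_vector_derivative integral (cbox (-pi) pi) (Fr s)) (at s within ?J)"
    proof (rule leibniz_rule_vector_derivative[where U="?J" and f=F and fx=Fr])
      show "((\<lambda>x. F x t) has_vector_derivative Fr x t) (at x within ?J)" if "x \<in> ?J" for x t
        by (rule has_vector_derivative_at_within[OF dFr[OF that]])
      show "F x integrable_on cbox (-pi) pi" if "x \<in> ?J" for x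
        using integrable_continuous_interval[OF sl[OF cF that]] by simp
      show "continuous_on (?J \<times> cbox (-pi) pi) (\<lambda>(x, t). Fr x t)"
        by (rule continuous_on_eq[OF continuous_on_subset[OF cFr]]) auto
    qed (use that in auto)
    then show ?thesis using that by (simp add: m_def[abs_def] at_within_open[of s ?J])
  qed
  have bnd: "norm (integral {-pi..pi} (Fr s)) \<le> 4 * pi * lam * S / \<bar>Im z0\<bar>" if s: "0 < s" "s < r" for s
  proof -
    have sJ: "s \<in> ?J" using s r by (auto simp: R_def)
    \<comment> \<open>The part of the radial derivative that is governed by the equation.\<close>
    define H where "H t = cis (- t) * (Fx s t + \<i> * Fy s t)" for t
    have cH: "continuous_on A H" for A
      unfolding H_def cis_conv_exp by (intro continuous_intros sl[OF cFx sJ] sl[OF cFy sJ])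
    have "(Ft s has_integral F s pi - F s (-pi)) {-pi..pi}"
      by (rule fundamental_theorem_of_calculus) (auto intro!: has_vector_derivative_at_within[OF dFt[OF sJ]])
    then have "(Ft s has_integral 0) {-pi..pi}"
      by (simp add: F_def rcis_def cis.code)
    then have Ft0: "((\<lambda>t. (\<i> / of_real s) * Ft s t) has_integral 0) {-pi..pi}"
      by (rule has_integral_mult_right[of _ 0, simplified])
    have e: "Fr s t = H t - (\<i> / of_real s) * Ft s t" for t
    proof -
      have c: "cis (-t) = of_real (cos t) - \<i> * of_real (sin t)" by (simp add: complex_eq_iff)
      show ?thesis using s unfolding Fr_def H_def Ft_def c
        by (simp add: scaleR_conv_of_real field_simps)
    qed
    have "(H has_integral integral {-pi..pi} H) {-pi..pi}"
      by (intro integrable_integral integrable_continuous_interval cH)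
    from has_integral_diff[OF this Ft0] have "(Fr s has_integral integral {-pi..pi} H) {-pi..pi}"
      unfolding e[abs_def] by simp
    then have eq: "integral {-pi..pi} (Fr s) = integral {-pi..pi} H" by (rule integral_unique)
    have "norm (H t) \<le> 2 * lam * S / \<bar>Im z0\<bar>" for t
    proof -
      have inb: "?z s t \<in> ball z0 r" using s by (simp add: dist_norm)
      then have Sz: "norm (f (?z s t)) + norm (f (cnj (?z s t))) \<le> S" by (rule S)
      have "\<bar>Im (?z s t) - Im z0\<bar> \<le> s"
        using abs_Im_le_cmod[of "rcis s t"] s by simp
      then have im: "\<bar>Im (?z s t)\<bar> \<ge> \<bar>Im z0\<bar> / 2" using s r by linarith
      then have im0: "Im (?z s t) \<noteq> 0" using y by auto
      have "norm (H t) = norm (Fx s t + \<i> * Fy s t)" by (simp add: H_def norm_mult)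
      also have "\<dots> = (lam / \<bar>Im (?z s t)\<bar>) * norm (f (?z s t) - f (cnj (?z s t)))"
        unfolding Fx_def Fy_def lambda_analyticD[OF f zD[OF sJ] im0]
        using lam by (simp only: norm_mult norm_divide norm_of_real) (simp add: abs_divide)
      also have "\<dots> \<le> (lam / (\<bar>Im z0\<bar> / 2)) * S"
      proof (intro mult_mono divide_left_mono)
        show "norm (f (?z s t) - f (cnj (?z s t))) \<le> S" using norm_triangle_ineq4 Sz by (rule order.trans)
      qed (use lam im y im0 in \<open>auto intro!: divide_nonneg_nonneg\<close>)
      finally show ?thesis by (simp add: field_simps)
    qed
    then have "norm (integral {-pi..pi} H) \<le> (2 * lam * S / \<bar>Im z0\<bar>) * (pi - (-pi))"
      by (intro integral_bound cH) auto
    then show ?thesis unfolding eq by (simp add: field_simps)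
  qed
  have "norm (m r - m 0) \<le> (4 * pi * lam * S / \<bar>Im z0\<bar>) * r - (4 * pi * lam * S / \<bar>Im z0\<bar>) * 0"
  proof (rule differentiable_bound_general[where f'="\<lambda>s. integral {-pi..pi} (Fr s)" and \<phi>'="\<lambda>_. 4 * pi * lam * S / \<bar>Im z0\<bar>"])
    show "continuous_on {0..r} m"
      using r by (intro continuous_at_imp_continuous_on ballI has_vector_derivative_continuous[OF dm]) (auto simp: R_def)
    show "(m has_vector_derivative integral {-pi..pi} (Fr s)) (at s)" if "0 < s" "s < r" for s
      using that r by (intro dm) (auto simp: R_def)
    show "((\<lambda>x. (4 * pi * lam * S / \<bar>Im z0\<bar>) * x) has_vector_derivative 4 * pi * lam * S / \<bar>Im z0\<bar>) (at s)" for s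
      by (auto intro!: derivative_eq_intros)
  qed (use r bnd in \<open>auto intro!: continuous_intros\<close>)
  moreover have "m 0 = of_real (2 * pi) * f z0"
    by (simp add: m_def F_def[abs_def] scaleR_conv_of_real)
  moreover have "norm (m r) \<le> integral {-pi..pi} (\<lambda>t. norm (f (z0 + rcis r t)))"
  proof -
    have rJ: "r \<in> ?J" using r by (auto simp: R_def)
    have "norm (m r) \<le> integral {-pi..pi} (\<lambda>t. norm (F r t))"
      unfolding m_def by (intro integral_norm_bound_integral integrable_continuous_interval continuous_intros sl[OF cF rJ]) auto
    then show ?thesis by (simp add: F_def)
  qed
  moreover have "norm (m 0) \<le> norm (m r) + norm (m r - m 0)"
    using norm_triangle_ineq4[of "m r" "m r - m 0"] by simp
  ultimately show ?thesis by (simp add: norm_mult mult_ac)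
qed

section \<open>Disc estimates\<close>

text \<open>The equation couples the values at \<open>z\<close> and \<open>cnj z\<close>, so estimates close up only for a quantity
  that contains both. Up to constants this is \<open>(\<bar>u\<bar>\<^sup>2 + \<bar>v\<bar>\<^sup>2)\<^bsup>1/2\<^esup>\<close>.\<close>

definition sym_mod :: "(complex \<Rightarrow> complex) \<Rightarrow> complex \<Rightarrow> real" where
  "sym_mod f z = norm (f z) + norm (f (cnj z))"

definition weighted_integral :: "real \<Rightarrow> complex set \<Rightarrow> (complex \<Rightarrow> real) \<Rightarrow> ennreal" where
  "weighted_integral lam A h = plane_integral (\<lambda>z. indicator A z * (h z * \<bar>Im z\<bar> powr (2 * lam)))"

lemma sym_mod_nonneg: "sym_mod f z \<ge> 0"
  by (simp add: sym_mod_def)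

lemma norm_le_sym_mod: "norm (f z) \<le> sym_mod f z"
  by (simp add: sym_mod_def)

lemma continuous_on_lambda_analytic:
  assumes "lambda_analytic lam f"
  shows "continuous_on (ball 0 1) f"
  by (intro continuous_on_differentiable Ck2_D(1)[OF lambda_analytic_C2[OF assms]])

lemma continuous_on_lambda_analytic_cnj:
  assumes "lambda_analytic lam f"
  shows "continuous_on (ball 0 1) (\<lambda>z. f (cnj z))"
  by (rule continuous_on_compose2[OF continuous_on_lambda_analytic[OF assms]]) (auto intro!: continuous_intros)

lemma continuous_on_sym_mod:
  assumes "lambda_analytic lam f"
  shows "continuous_on (ball 0 1) (sym_mod f)"
  unfolding sym_mod_def[abs_def]
  by (intro continuous_intros continuous_on_lambda_analytic[OF assms] continuous_on_lambda_analytic_cnj[OF assms])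

lemma measurable_indicator_times:
  fixes g :: "complex \<Rightarrow> real"
  assumes "continuous_on (ball 0 1) g" "A \<subseteq> ball 0 1" "A \<in> sets borel"
  shows "(\<lambda>z. indicator A z * g z) \<in> borel_measurable borel"
  using borel_measurable_continuous_on_indicator[OF assms(3) continuous_on_subset[OF assms(1,2)]] by simp

lemma measurable_indicator_times_weight:
  fixes g :: "complex \<Rightarrow> real"
  assumes "continuous_on (ball 0 1) g" "A \<subseteq> ball 0 1" "A \<in> sets borel"
  shows "(\<lambda>z. indicator A z * (g z * \<bar>Im z\<bar> powr (2 * lam))) \<in> borel_measurable borel"
proof -
  have "Im \<in> borel_measurable borel" by (intro borel_measurable_continuous_onI continuous_intros)
  then have "(\<lambda>z. (indicator A z * g z) * \<bar>Im z\<bar> powr (2 * lam)) \<in> borel_measurable borel"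
    using measurable_indicator_times[OF assms] by measurable
  then show ?thesis by (simp add: mult.assoc)
qed

lemma weighted_integral_mono:
  assumes "A \<subseteq> B" "\<And>z. z \<in> A \<Longrightarrow> h z \<le> k z" "\<And>z. k z \<ge> 0"
  shows "weighted_integral lam A h \<le> weighted_integral lam B k"
  unfolding weighted_integral_def
  by (rule plane_integral_mono) (use assms in \<open>auto simp: indicator_def intro!: mult_right_mono\<close>)

lemma ball_subset_unit:
  assumes "t \<le> 1 - norm (z::complex)"
  shows "ball z t \<subseteq> ball 0 1"
proof
  fix w assume "w \<in> ball z t"
  then have "norm (w - z) < t" by (simp add: dist_norm norm_minus_commute)
  then show "w \<in> ball 0 1" using norm_triangle_ineq[of "w - z" z] assms by simp
qed

lemma sym_circle_estimate:
  assumes f: "lambda_analytic lam f" and lam: "lam \<ge> 0" and y: "Im z0 \<noteq> 0"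
    and r: "0 < r" "r \<le> \<bar>Im z0\<bar> / 2" "r < 1 - norm z0"
    and S: "\<And>z. z \<in> ball z0 r \<Longrightarrow> sym_mod f z \<le> S"
  shows "2 * pi * sym_mod f z0 \<le> integral {-pi..pi} (\<lambda>t. sym_mod f (z0 + rcis r t)) + 8 * pi * lam * r * S / \<bar>Im z0\<bar>"
proof -
  have 1: "2 * pi * norm (f z0) \<le> integral {-pi..pi} (\<lambda>t. norm (f (z0 + rcis r t))) + 4 * pi * lam * r * S / \<bar>Im z0\<bar>"
    by (rule far_circle_estimate[OF f lam y r]) (use S in \<open>simp add: sym_mod_def\<close>)
  have 2: "2 * pi * norm (f (cnj z0)) \<le> integral {-pi..pi} (\<lambda>t. norm (f (cnj z0 + rcis r t))) + 4 * pi * lam * r * S / \<bar>Im (cnj z0)\<bar>"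
  proof (rule far_circle_estimate[OF f lam])
    fix z assume "z \<in> ball (cnj z0) r"
    then have "cnj z \<in> ball z0 r"
      by (metis complex_cnj_cnj complex_cnj_diff complex_mod_cnj dist_norm mem_ball)
    from S[OF this] show "norm (f z) + norm (f (cnj z)) \<le> S" by (simp add: sym_mod_def)
  qed (use y r in auto)
  have e1: "integral {-pi..pi} (\<lambda>t. norm (f (cnj z0 + rcis r t))) = integral {-pi..pi} (\<lambda>t. norm (f (cnj (z0 + rcis r t))))"
  proof -
    have e: "cnj (z0 + rcis r t) = cnj z0 + rcis r (-t)" for t by (simp add: complex_eq_iff)
    show ?thesis unfolding e
      using Henstock_Kurzweil_Integration.integral_reflect_real[of pi "-pi" "\<lambda>t. norm (f (cnj z0 + rcis r t))"] by simp
  qed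
  have e2: "integral {-pi..pi} (\<lambda>t. sym_mod f (z0 + rcis r t)) = 
     integral {-pi..pi} (\<lambda>t. norm (f (z0 + rcis r t))) + integral {-pi..pi} (\<lambda>t. norm (f (cnj (z0 + rcis r t))))"
  proof -
    have c: "continuous_on {-pi..pi} (\<lambda>t. g (z0 + rcis r t))" if "continuous_on (ball 0 1) g" for g :: "complex \<Rightarrow> complex"
    proof -
      have "continuous_on ({r} \<times> UNIV) (\<lambda>p. g (z0 + rcis (fst p) (snd p)))"
        by (rule continuous_on_polar[OF that]) (use r rcis_norm_less[of r z0] in auto)
      from continuous_on_compose2[OF this continuous_on_Pair[OF continuous_on_const continuous_on_id], of r "{-pi..pi}"]
      show ?thesis by (simp add: image_subset_iff)
    qed
    show ?thesis unfolding sym_mod_def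
      by (intro integral_add integrable_continuous_interval continuous_intros c
         c[OF continuous_on_lambda_analytic_cnj[OF f]] continuous_on_lambda_analytic[OF f])
  qed
  have e3: "8 * pi * lam * r * S / \<bar>Im z0\<bar> = 4 * pi * lam * r * S / \<bar>Im z0\<bar> + 4 * pi * lam * r * S / \<bar>Im (cnj z0)\<bar>"
    by (simp add: field_simps)
  have e4: "2 * pi * sym_mod f z0 = 2 * pi * norm (f z0) + 2 * pi * norm (f (cnj z0))"
    by (simp add: sym_mod_def distrib_left)
  show ?thesis unfolding e2 e3 e4 using add_mono[OF 1 2[unfolded e1]] by (simp only: add_ac)
qed

lemma nn_integral_radius:
  assumes "\<rho> \<ge> 0"
  shows "(\<integral>\<^sup>+r. ennreal (indicator {0<..<\<rho>} r * r) \<partial>lborel) = ennreal (\<rho>\<^sup>2 / 2)"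
proof -
  have "((\<lambda>r. r) has_integral \<rho>\<^sup>2 / 2 - 0\<^sup>2 / 2) {0..\<rho>}"
    by (rule fundamental_theorem_of_calculus[OF assms])
      (auto intro!: derivative_eq_intros simp: has_real_derivative_iff_has_vector_derivative[symmetric])
  then have "((\<lambda>r. r) has_integral \<rho>\<^sup>2 / 2) {0<..<\<rho>}"
    by (simp add: has_integral_Icc_iff_Ioo)
  from nn_integral_has_integral_lebesgue[OF _ this] show ?thesis by simp
qed

text \<open>Integration of the circle estimate over the radius. The circle mean of \<open>G\<close> is replaced by that
  of \<open>G\<^sup>2\<close> by means of \<open>G \<le> \<eta> S + G\<^sup>2 / (4 \<eta> S)\<close>. For a negative left-hand side \<open>ennreal\<close> truncates
  to \<open>0\<close>, so no case distinction is needed.\<close>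

lemma sym_disc_estimate:
  assumes f: "lambda_analytic lam f" and lam: "lam \<ge> 0" and y: "Im z0 \<noteq> 0"
    and \<rho>: "0 < \<rho>" "\<rho> \<le> \<bar>Im z0\<bar> / 2" "\<rho> \<le> 1 - norm z0"
    and S: "\<And>z. z \<in> ball z0 \<rho> \<Longrightarrow> sym_mod f z \<le> S" "S > 0" and \<eta>: "\<eta> > 0"
  shows "ennreal (pi * \<rho>\<^sup>2 * (sym_mod f z0 - \<eta> * S - 4 * lam * \<rho> * S / \<bar>Im z0\<bar>)) \<le>
     plane_integral (\<lambda>z. indicator (ball z0 \<rho>) z * ((sym_mod f z)\<^sup>2 / (4 * \<eta> * S)))"
proof -
  define c where "c = 2 * pi * (sym_mod f z0 - \<eta> * S - 4 * lam * \<rho> * S / \<bar>Im z0\<bar>)"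
  define h where "h z = indicator (ball z0 \<rho>) z * ((sym_mod f z)\<^sup>2 / (4 * \<eta> * S))" for z
  have hm: "h \<in> borel_measurable borel"
    unfolding h_def using ball_subset_unit[OF \<rho>(3)] S(2) \<eta>
    by (intro measurable_indicator_times continuous_intros continuous_on_sym_mod[OF f]) auto
  have hn: "h z \<ge> 0" for z using S(2) \<eta> by (simp add: h_def)
  have circ: "ennreal c \<le> (\<integral>\<^sup>+t. indicator {-pi..pi} t * ennreal (h (z0 + rcis r t)) \<partial>lborel)" if r: "0 < r" "r < \<rho>" for r
  proof -
    have in_b: "z0 + rcis r t \<in> ball z0 \<rho>" for t using r by (simp add: dist_norm)
    have cG: "continuous_on {-pi..pi} (\<lambda>t. sym_mod f (z0 + rcis r t))"
    proof -
      have "continuous_on ({r} \<times> UNIV) (\<lambda>p. sym_mod f (z0 + rcis (fst p) (snd p)))"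
        by (rule continuous_on_polar[OF continuous_on_sym_mod[OF f]]) (use r \<rho> rcis_norm_less[of r z0] in auto)
      from continuous_on_compose2[OF this continuous_on_Pair[OF continuous_on_const continuous_on_id], of r "{-pi..pi}"]
      show ?thesis by (simp add: image_subset_iff)
    qed
    have hz: "h (z0 + rcis r t) = (sym_mod f (z0 + rcis r t))\<^sup>2 / (4 * \<eta> * S)" for t
      using in_b by (simp add: h_def)
    have amgm: "G \<le> \<eta> * S + G\<^sup>2 / (4 * \<eta> * S)" for G :: real
    proof -
      have "0 \<le> (G - 2 * \<eta> * S)\<^sup>2 / (4 * \<eta> * S)" using S(2) \<eta> by simp
      also have "\<dots> = G\<^sup>2 / (4 * \<eta> * S) - G + \<eta> * S" using S(2) \<eta> by (simp add: field_simps power2_eq_square)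
      finally show ?thesis by simp
    qed
    have ih: "(\<lambda>t. h (z0 + rcis r t)) integrable_on {-pi..pi}"
      unfolding hz by (intro integrable_continuous_interval continuous_intros cG) (use S(2) \<eta> in auto)
    have "2 * pi * sym_mod f z0 \<le> integral {-pi..pi} (\<lambda>t. sym_mod f (z0 + rcis r t)) + 8 * pi * lam * r * S / \<bar>Im z0\<bar>"
      by (rule sym_circle_estimate[OF f lam y]) (use r \<rho> S in auto)
    also have "integral {-pi..pi} (\<lambda>t. sym_mod f (z0 + rcis r t)) \<le> integral {-pi..pi} (\<lambda>t. \<eta> * S + h (z0 + rcis r t))"
      unfolding hz using S(2) \<eta>
      by (intro integral_le integrable_continuous_interval continuous_intros cG) (auto intro: amgm)
    also have "\<dots> = 2 * pi * (\<eta> * S) + integral {-pi..pi} (\<lambda>t. h (z0 + rcis r t))"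
      by (subst integral_add) (auto intro: ih)
    also have "8 * pi * lam * r * S / \<bar>Im z0\<bar> \<le> 8 * pi * lam * \<rho> * S / \<bar>Im z0\<bar>"
      using r lam S(2) by (intro divide_right_mono mult_right_mono mult_left_mono) auto
    finally have "c \<le> integral {-pi..pi} (\<lambda>t. h (z0 + rcis r t))"
      by (simp add: c_def algebra_simps)
    moreover have "(\<integral>\<^sup>+t. indicator {-pi..pi} t * h (z0 + rcis r t) \<partial>lborel) = integral {-pi..pi} (\<lambda>t. h (z0 + rcis r t))"
      by (rule nn_integral_has_integral_lebesgue) (auto intro: hn integrable_integral ih)
    ultimately show ?thesis by (simp add: ennreal_leI ennreal_mult' ennreal_indicator)
  qed
  have "ennreal (pi * \<rho>\<^sup>2 * (sym_mod f z0 - \<eta> * S - 4 * lam * \<rho> * S / \<bar>Im z0\<bar>)) = ennreal c * ennreal (\<rho>\<^sup>2 / 2)"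
    by (subst ennreal_mult''[symmetric]) (simp_all add: c_def algebra_simps)
  also have "\<dots> = (\<integral>\<^sup>+r. ennreal c * ennreal (indicator {0<..<\<rho>} r * r) \<partial>lborel)"
    by (subst nn_integral_cmult) (use \<rho> in \<open>simp_all add: nn_integral_radius\<close>)
  also have "\<dots> \<le> (\<integral>\<^sup>+r. indicator {0<..} r * (ennreal r * (\<integral>\<^sup>+t. indicator {-pi..pi} t * ennreal (h (z0 + rcis r t)) \<partial>lborel)) \<partial>lborel)"
  proof (rule nn_integral_mono)
    fix r
    show "ennreal c * ennreal (indicator {0<..<\<rho>} r * r) \<le> indicator {0<..} r * (ennreal r * (\<integral>\<^sup>+t. indicator {-pi..pi} t * ennreal (h (z0 + rcis r t)) \<partial>lborel))"
    proof (cases "r \<in> {0<..<\<rho>}")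
      case True
      then have "ennreal r * ennreal c \<le> ennreal r * (\<integral>\<^sup>+t. indicator {-pi..pi} t * ennreal (h (z0 + rcis r t)) \<partial>lborel)"
        by (intro mult_left_mono circ) auto
      then show ?thesis using True by (simp add: mult.commute)
    qed simp
  qed
  also have "\<dots> = plane_integral h"
    by (rule plane_integral_polar[symmetric]) (auto intro: hm hn)
  finally show ?thesis by (simp add: h_def[abs_def])
qed

text \<open>Scale the variable by \<open>a / b\<close>; the values of \<open>m\<close> can only decrease under this.\<close>

lemma radial_integral_ratio:
  fixes m :: "real \<Rightarrow> ennreal"
  assumes mono: "\<And>r s. 0 < r \<Longrightarrow> r \<le> s \<Longrightarrow> s < b \<Longrightarrow> m r \<le> m s"
    and [measurable]: "(\<lambda>r. indicator {0<..<a} r * (ennreal (r powr q) * m r)) \<in> borel_measurable borel"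
      "(\<lambda>r. indicator {0<..<b} r * (ennreal (r powr q) * m r)) \<in> borel_measurable borel"
    and ab: "0 < a" "a \<le> b" 
  shows "(\<integral>\<^sup>+r. indicator {0<..<a} r * (ennreal (r powr q) * m r) \<partial>lborel) \<le>
    ennreal ((a / b) powr (q + 1)) * (\<integral>\<^sup>+r. indicator {0<..<b} r * (ennreal (r powr q) * m r) \<partial>lborel)"
proof -
  let ?k = "a / b"
  have k: "0 < ?k" "?k \<le> 1" using ab by auto
  have "(\<integral>\<^sup>+r. indicator {0<..<a} r * (ennreal (r powr q) * m r) \<partial>lborel) = 
    ennreal \<bar>?k\<bar> * (\<integral>\<^sup>+r. indicator {0<..<a} (0 + ?k * r) * (ennreal ((0 + ?k * r) powr q) * m (0 + ?k * r)) \<partial>lborel)"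
    by (rule nn_integral_real_affine) (use k in auto)
  also have "\<dots> \<le> ennreal ?k * (\<integral>\<^sup>+r. ennreal (?k powr q) * (indicator {0<..<b} r * (ennreal (r powr q) * m r)) \<partial>lborel)"
  proof (rule mult_mono[OF _ nn_integral_mono])
    fix r
    show "indicator {0<..<a} (0 + ?k * r) * (ennreal ((0 + ?k * r) powr q) * m (0 + ?k * r)) \<le> ennreal (?k powr q) * (indicator {0<..<b} r * (ennreal (r powr q) * m r))"
    proof (cases "r \<in> {0<..<b}")
      case True
      have "?k * r \<le> 1 * r" using True k by (intro mult_right_mono) auto
      moreover have "0 < ?k * r" using True k by (intro mult_pos_pos) auto
      ultimately have "m (?k * r) \<le> m r" using True by (intro mono) auto
      then have "ennreal ((?k * r) powr q) * m (?k * r) \<le> ennreal ((?k * r) powr q) * m r"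
        by (rule mult_left_mono) simp
      also have "\<dots> = ennreal (?k powr q) * (ennreal (r powr q) * m r)"
      proof -
        have "(?k * r) powr q = ?k powr q * r powr q" using True k by (intro powr_mult)
        then show ?thesis by (simp only: ennreal_mult'[OF powr_ge_zero] mult.assoc)
      qed
      finally show ?thesis using True by (simp add: indicator_def)
    next
      case False
      then have "?k * r \<notin> {0<..<a}" using ab k by (auto simp: field_simps zero_less_mult_iff)
      then show ?thesis by simp
    qed
  qed (use k in auto)
  also have "\<dots> = ennreal ?k * (ennreal (?k powr q) * (\<integral>\<^sup>+r. indicator {0<..<b} r * (ennreal (r powr q) * m r) \<partial>lborel))"
    by (subst nn_integral_cmult) auto
  also have "\<dots> = ennreal (?k powr (q + 1)) * (\<integral>\<^sup>+r. indicator {0<..<b} r * (ennreal (r powr q) * m r) \<partial>lborel)"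
  proof -
    have "?k powr (q + 1) = ?k * ?k powr q" using k(1) by (simp only: powr_add powr_one mult.commute)
    then show ?thesis by (simp only: ennreal_mult'[OF less_imp_le[OF k(1)]] mult.assoc)
  qed
  finally show ?thesis .
qed

text \<open>In polar coordinates about \<open>x0\<close> the weight contributes \<open>r\<^bsup>2\<lambda>\<^esup>\<close> to the radial density, and the
  remaining circle means increase with \<open>r\<close>. So means over concentric discs increase as well, where the
  measure of a disc about a real point is proportional to \<open>r\<^bsup>2\<lambda>+2\<^esup>\<close>.\<close>

lemma real_disc_ratio:
  fixes x0 :: real
  assumes f: "lambda_analytic lam f" and lam: "lam \<ge> 0"
    and ab: "0 < a" "a \<le> b" "b \<le> 1 - \<bar>x0\<bar>"
  defines "w \<equiv> \<lambda>z. (norm (f z))\<^sup>2 + (norm (f (cnj z)))\<^sup>2"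
  shows "weighted_integral lam (ball (of_real x0) a) w
    \<le> ennreal ((a / b) powr (2 * lam + 2)) * weighted_integral lam (ball (of_real x0) b) w"
proof -
  define m where "m r = (\<integral>\<^sup>+t. indicator {-pi..pi} t * ennreal (w (of_real x0 + rcis r t) * \<bar>sin t\<bar> powr (2 * lam)) \<partial>lborel)" for r
  have wn: "w z \<ge> 0" for z by (simp add: w_def)
  have cw: "continuous_on (ball 0 1) w"
    unfolding w_def by (intro continuous_intros continuous_on_lambda_analytic[OF f] continuous_on_lambda_analytic_cnj[OF f])
  define h where "h c z = indicator (ball (of_real x0) c) z * (w z * \<bar>Im z\<bar> powr (2 * lam))" for c and z :: complex
  have hm [measurable]: "h c \<in> borel_measurable borel" if "c \<le> b" for c
    unfolding h_def using that ab ball_subset_unit[of c "of_real x0"]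
    by (intro measurable_indicator_times_weight cw) auto
  have hn: "h c z \<ge> 0" for c z by (simp add: h_def wn)
  have hpol: "indicator {0<..} r * (ennreal r * (\<integral>\<^sup>+t. indicator {-pi..pi} t * ennreal (h c (of_real x0 + rcis r t)) \<partial>lborel))
      = indicator {0<..<c} r * (ennreal (r powr (2 * lam + 1)) * m r)" if c: "c \<le> b" for c r
  proof (cases "r \<in> {0<..<c}")
    case True
    have "h c (of_real x0 + rcis r t) = r powr (2 * lam) * (w (of_real x0 + rcis r t) * \<bar>sin t\<bar> powr (2 * lam))" for t
      using True by (simp add: h_def dist_norm abs_mult powr_mult)
    then have "(\<integral>\<^sup>+t. indicator {-pi..pi} t * ennreal (h c (of_real x0 + rcis r t)) \<partial>lborel) =
        (\<integral>\<^sup>+t. ennreal (r powr (2 * lam)) * (indicator {-pi..pi} t * ennreal (w (of_real x0 + rcis r t) * \<bar>sin t\<bar> powr (2 * lam))) \<partial>lborel)"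
      by (intro nn_integral_cong) (simp add: ennreal_mult' mult_ac)
    also have "\<dots> = ennreal (r powr (2 * lam)) * m r"
      unfolding m_def
    proof (rule nn_integral_cmult)
      have "(\<lambda>t. h c (of_real x0 + rcis r t) / r powr (2 * lam)) \<in> borel_measurable borel"
        using hm[OF c] by measurable
      moreover have "h c (of_real x0 + rcis r t) / r powr (2 * lam) = w (of_real x0 + rcis r t) * \<bar>sin t\<bar> powr (2 * lam)" for t
        using True by (simp add: h_def dist_norm abs_mult powr_mult)
      ultimately show "(\<lambda>t. indicator {-pi..pi} t * ennreal (w (of_real x0 + rcis r t) * \<bar>sin t\<bar> powr (2 * lam))) \<in> borel_measurable lborel"
        by simp
    qed
    finally show ?thesis using True by (simp add: powr_add ennreal_mult' mult_ac)
  next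
    case False
    then show ?thesis
    proof (cases "r > 0")
      case True
      then have "h c (of_real x0 + rcis r t) = 0" for t using False by (simp add: h_def dist_norm)
      then show ?thesis using False by simp
    qed simp
  qed
  have polar: "plane_integral (h c) = (\<integral>\<^sup>+r. indicator {0<..<c} r * (ennreal (r powr (2 * lam + 1)) * m r) \<partial>lborel)" if "c \<le> b" for c
    unfolding hpol[OF that, symmetric] by (rule plane_integral_polar[OF hm[OF that] hn])
  have meas: "(\<lambda>r. indicator {0<..<c} r * (ennreal (r powr (2 * lam + 1)) * m r)) \<in> borel_measurable borel" if "c \<le> b" for c
    unfolding hpol[OF that, symmetric] using hm[OF that] by measurable
  have mM: "m r = ennreal (integral {-pi..pi} (\<lambda>t. w (of_real x0 + rcis r t) * sin_weight lam t))" if r: "0 < r" "r < b" for r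
  proof -
    have "m r = (\<integral>\<^sup>+t. ennreal (indicator {-pi..pi} t * (w (of_real x0 + rcis r t) * sin_weight lam t)) \<partial>lborel)"
      unfolding m_def
    proof (rule nn_integral_cong_AE)
      have "AE x::real in lborel. x \<notin> {-pi,0,pi}" by (intro AE_not_in finite_imp_null_set_lborel) simp
      then show "AE t in lborel. indicator {-pi..pi} t * ennreal (w (of_real x0 + rcis r t) * \<bar>sin t\<bar> powr (2 * lam)) =
         ennreal (indicator {-pi..pi} t * (w (of_real x0 + rcis r t) * sin_weight lam t))"
      proof eventually_elim
        fix t :: real assume t: "t \<notin> {-pi,0,pi}"
        show "indicator {-pi..pi} t * ennreal (w (of_real x0 + rcis r t) * \<bar>sin t\<bar> powr (2 * lam)) =
         ennreal (indicator {-pi..pi} t * (w (of_real x0 + rcis r t) * sin_weight lam t))"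
        proof (cases "t \<in> {-pi..pi}")
          case True
          then have s: "sin t \<noteq> 0" using t sin_gt_zero[of t] sin_gt_zero[of "-t"] by force
          have "sin_weight lam t = \<bar>sin t\<bar> powr (2 * lam)"
          proof -
            have "(sin t)\<^sup>2 = \<bar>sin t\<bar> powr 2" using s by (simp add: powr_numeral)
            then show ?thesis using s by (simp only: sin_weight_def powr_powr) simp
          qed
          then show ?thesis using True by simp
        qed simp
      qed
    qed
    also have "\<dots> = ennreal (integral {-pi..pi} (\<lambda>t. w (of_real x0 + rcis r t) * sin_weight lam t))"
    proof (rule nn_integral_has_integral_lebesgue)
      have "continuous_on ({r} \<times> UNIV) (\<lambda>p. w (of_real x0 + rcis (fst p) (snd p)))"
        by (rule continuous_on_polar[OF cw]) (use r ab rcis_norm_less[of r "of_real x0"] in auto)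
      from continuous_on_compose2[OF this continuous_on_Pair[OF continuous_on_const continuous_on_id], of r "{-pi..pi}"]
      have "continuous_on {-pi..pi} (\<lambda>t. w (of_real x0 + rcis r t))" by (simp add: image_subset_iff)
      then show "((\<lambda>t. w (of_real x0 + rcis r t) * sin_weight lam t) has_integral
         integral {-pi..pi} (\<lambda>t. w (of_real x0 + rcis r t) * sin_weight lam t)) {-pi..pi}"
        by (intro integrable_integral integrable_continuous_interval continuous_intros continuous_on_sin_weight lam)
    qed (simp add: wn sin_weight_nonneg)
    finally show ?thesis .
  qed
  have "plane_integral (h a) \<le> ennreal ((a / b) powr (2 * lam + 1 + 1)) * plane_integral (h b)"
    unfolding polar[OF ab(2)] polar[OF order_refl]
  proof (rule radial_integral_ratio[OF _ meas[OF ab(2)] meas[OF order_refl] ab(1,2)])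
    fix r s assume "0 < r" "r \<le> s" "s < b"
    then show "m r \<le> m s"
      using real_circle_mean_mono[OF f lam, of r s x0] ab by (simp add: mM w_def ennreal_leI)
  qed
  then show ?thesis unfolding weighted_integral_def h_def[abs_def] by (simp add: add.assoc)
qed

section \<open>The local estimate for squares\<close>

lemma ennreal_le_add_diff: "ennreal g \<le> ennreal s + ennreal (g - s)" if "s \<ge> 0"
proof (cases "s \<le> g")
  case True
  then show ?thesis using that by (simp flip: ennreal_plus)
next
  case False
  then show ?thesis by (intro add_increasing2 ennreal_leI) auto
qed

lemma ennreal_solve_le:
  assumes "A > 0" "B \<ge> 0" "s \<ge> 0" "ennreal (A * (g - s)) \<le> ennreal B * W"
  shows "ennreal g \<le> ennreal s + ennreal (B / A) * W"
proof -
  have "ennreal (g - s) = ennreal (1 / A) * ennreal (A * (g - s))"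
    using assms(1) by (subst ennreal_mult'[symmetric]) auto
  also have "\<dots> \<le> ennreal (1 / A) * (ennreal B * W)"
    by (intro mult_left_mono assms) auto
  also have "\<dots> = ennreal (B / A) * W"
    using assms by (simp add: mult.assoc[symmetric] ennreal_mult'[symmetric])
  finally show ?thesis using ennreal_le_add_diff[OF assms(3), of g] add_left_mono order.trans by blast
qed

lemma weighted_integral_cmult:
  assumes "continuous_on (ball 0 1) h" "A \<subseteq> ball 0 1" "A \<in> sets borel" "c \<ge> 0"
  shows "weighted_integral lam A (\<lambda>z. c * h z) = ennreal c * weighted_integral lam A h"
  unfolding weighted_integral_def
  using plane_integral_cmult[OF measurable_indicator_times_weight[OF assms(1-3), of lam] assms(4)]
  by (simp add: mult_ac)

text \<open>The weight can be inserted at the cost of a constant wherever it is bounded below.\<close>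

lemma plane_integral_le_weighted:
  assumes "continuous_on (ball 0 1) h" "A \<subseteq> E" "E \<subseteq> ball 0 1" "E \<in> sets borel" "K \<ge> 0" "c > 0"
    and "\<And>z. h z \<ge> 0" "\<And>z. z \<in> A \<Longrightarrow> 1 \<le> K * \<bar>Im z\<bar> powr (2 * lam)"
  shows "plane_integral (\<lambda>z. indicator A z * (h z / c)) \<le> ennreal (K / c) * weighted_integral lam E h"
proof -
  have "plane_integral (\<lambda>z. indicator A z * (h z / c)) \<le> plane_integral (\<lambda>z. indicator E z * ((K / c * h z) * \<bar>Im z\<bar> powr (2 * lam)))"
  proof (rule plane_integral_mono)
    fix z
    show "indicator A z * (h z / c) \<le> indicator E z * ((K / c * h z) * \<bar>Im z\<bar> powr (2 * lam))"
    proof (cases "z \<in> A")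
      case True
      have "(h z / c) * 1 \<le> (h z / c) * (K * \<bar>Im z\<bar> powr (2 * lam))"
        using assms True by (intro mult_left_mono) auto
      then show ?thesis using True assms(2) by (auto simp: field_simps)
    next
      case False
      then show ?thesis using assms by (auto simp: indicator_def)
    qed
  qed
  also have "\<dots> = ennreal (K / c) * weighted_integral lam E h"
    using weighted_integral_cmult[OF assms(1,3,4), of "K / c" lam] assms by (simp add: weighted_integral_def)
  finally show ?thesis .
qed

text \<open>Let \<open>y\<close> be the distance of \<open>z\<close> to the axis. If \<open>t \<le> 8 y\<close>, the disc estimate at radius \<open>\<kappa> t\<close> suffices,
  since the weight is comparable to \<open>(y + t)\<^bsup>2\<lambda>\<^esup>\<close> there. Otherwise it is applied at radius \<open>\<kappa> y\<close>; the small disc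
  lies in the disc of radius \<open>2 y\<close> about the real part of \<open>z\<close>, and \<open>real_disc_ratio\<close> leads to the radius
  \<open>t / 2\<close>. The powers of \<open>y\<close> cancel, so the constant does not depend on \<open>y\<close>.\<close>

lemma local_square_estimate_off_axis:
  assumes lam: "lam \<ge> 0" and th: "\<theta> > 0"
  shows "\<exists>C>0. \<forall>f z t S. lambda_analytic lam f \<longrightarrow> Im z \<noteq> 0 \<longrightarrow> 0 < t \<longrightarrow> t \<le> 1 - norm z \<longrightarrow> 0 < S \<longrightarrow>
    (\<forall>w\<in>ball z t. sym_mod f w \<le> S) \<longrightarrow>
    ennreal (sym_mod f z) \<le> ennreal (\<theta> * S) +
      ennreal (C / (S * t\<^sup>2 * (\<bar>Im z\<bar> + t) powr (2 * lam))) * weighted_integral lam (ball z t) (\<lambda>w. (sym_mod f w)\<^sup>2)"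
proof -
  \<comment> \<open>With this \<open>\<kappa>\<close> the error term of the disc estimate at radius \<open>\<kappa> s\<close>, \<open>s \<le> 8 y\<close>, is at most \<open>\<theta> S / 2\<close>,
    and the disc keeps at least the distance \<open>y / 2\<close> from the axis.\<close>
  define \<kappa> where "\<kappa> = min (1/16) (\<theta> / (64 * (lam + 1)))"
  have "0 < \<kappa>" using lam th by (simp add: \<kappa>_def)
  moreover have "\<kappa> \<le> 1/16" unfolding \<kappa>_def by (rule min.cobounded1)
  ultimately have k: "0 < \<kappa>" "\<kappa> \<le> 1/16" .
  have klam: "32 * lam * \<kappa> \<le> \<theta> / 2"
  proof -
    have "32 * lam * \<kappa> \<le> 32 * lam * (\<theta> / (64 * (lam + 1)))"
      using lam by (intro mult_left_mono) (auto simp: \<kappa>_def)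
    also have "\<dots> \<le> \<theta> / 2" using lam th by (simp add: field_simps)
    finally show ?thesis .
  qed
  define C where "C = 16 * 18 powr (2 * lam) / (pi * \<kappa>\<^sup>2 * \<theta>)"
  have C: "C > 0" using k th by (simp add: C_def)
  show ?thesis
  proof (intro exI[of _ C] conjI C allI impI)
    fix f z t S
    assume f: "lambda_analytic lam f" and y0: "Im z \<noteq> 0" and t: "0 < t" "t \<le> 1 - norm z" and S: "0 < S"
      and GS: "\<forall>w\<in>ball z t. sym_mod f w \<le> S"
    define y where "y = \<bar>Im z\<bar>"
    have y: "y > 0" using y0 by (simp add: y_def)
    let ?G2 = "\<lambda>w. (sym_mod f w)\<^sup>2"
    let ?W = "weighted_integral lam (ball z t) ?G2"
    have cG2: "continuous_on (ball 0 1) ?G2" by (intro continuous_intros continuous_on_sym_mod[OF f])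
    have basic: "ennreal (pi * (\<kappa> * s)\<^sup>2 * (sym_mod f z - \<theta> * S)) \<le>
       plane_integral (\<lambda>w. indicator (ball z (\<kappa> * s)) w * (?G2 w / (2 * \<theta> * S)))" if s: "0 < s" "s \<le> 8 * y" "s \<le> t" for s
    proof -
      have ks: "\<kappa> * s \<le> (1/16) * s" using k s by (intro mult_right_mono) auto
      have "4 * lam * (\<kappa> * s) * S / y \<le> 4 * lam * (\<kappa> * (8 * y)) * S / y"
        using k s y lam S by (intro divide_right_mono mult_right_mono mult_left_mono) auto
      also have "\<dots> = (32 * lam * \<kappa>) * S" using y by (simp add: field_simps)
      also have "\<dots> \<le> (\<theta> / 2) * S" using klam S by (intro mult_right_mono) auto
      finally have err: "4 * lam * (\<kappa> * s) * S / \<bar>Im z\<bar> \<le> (\<theta> / 2) * S" by (simp add: y_def)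
      have "ennreal (pi * (\<kappa> * s)\<^sup>2 * (sym_mod f z - \<theta> * S)) \<le>
        ennreal (pi * (\<kappa> * s)\<^sup>2 * (sym_mod f z - (\<theta> / 2) * S - 4 * lam * (\<kappa> * s) * S / \<bar>Im z\<bar>))"
        using err by (intro ennreal_leI mult_left_mono) (auto simp: field_simps)
      also have "\<dots> \<le> plane_integral (\<lambda>w. indicator (ball z (\<kappa> * s)) w * (?G2 w / (4 * (\<theta> / 2) * S)))"
      proof (rule sym_disc_estimate[OF f lam y0 _ _ _ _ S])
        show "\<kappa> * s \<le> \<bar>Im z\<bar> / 2" using ks s unfolding y_def by linarith
        show "\<kappa> * s \<le> 1 - norm z" using ks s t by linarith
        have "ball z (\<kappa> * s) \<subseteq> ball z t" using ks s by (intro subset_ball) linarith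
        then show "sym_mod f w \<le> S" if "w \<in> ball z (\<kappa> * s)" for w
          using GS that by blast
      qed (use k s th in auto)
      finally show ?thesis by simp
    qed
    have Im_low: "\<bar>Im w\<bar> \<ge> y / 2" if "w \<in> ball z (\<kappa> * s)" "0 < s" "s \<le> 8 * y" for w s
    proof -
      have "\<kappa> * s \<le> (1/16) * (8 * y)" using k that by (intro mult_mono) auto
      moreover have "\<bar>Im w - Im z\<bar> \<le> norm (z - w)" using abs_Im_le_cmod[of "z - w"] by (simp add: abs_minus_commute)
      moreover have "norm (z - w) < \<kappa> * s" using that(1) by (simp add: dist_norm)
      ultimately show ?thesis unfolding y_def by linarith
    qed
    have goal: "ennreal (sym_mod f z) \<le> ennreal (\<theta> * S) + ennreal (C / (S * t\<^sup>2 * (y + t) powr (2 * lam))) * ?W"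
    proof (cases "t \<le> 8 * y")
      case True
      define K where "K = 18 powr (2 * lam) / (y + t) powr (2 * lam)"
      have "ennreal (pi * (\<kappa> * t)\<^sup>2 * (sym_mod f z - \<theta> * S)) \<le>
       plane_integral (\<lambda>w. indicator (ball z (\<kappa> * t)) w * (?G2 w / (2 * \<theta> * S)))"
        by (rule basic) (use t True in auto)
      also have "\<dots> \<le> ennreal (K / (2 * \<theta> * S)) * ?W"
      proof (rule plane_integral_le_weighted[OF cG2 _ ball_subset_unit[OF t(2)]])
        show "ball z (\<kappa> * t) \<subseteq> ball z t" using k t by (intro subset_ball) auto
        fix w assume "w \<in> ball z (\<kappa> * t)"
        from Im_low[OF this t(1) True] have "y + t \<le> 18 * \<bar>Im w\<bar>" using True by simp
        then have "(y + t) powr (2 * lam) \<le> (18 * \<bar>Im w\<bar>) powr (2 * lam)"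
          using y t lam by (intro powr_mono2) auto
        also have "\<dots> = 18 powr (2 * lam) * \<bar>Im w\<bar> powr (2 * lam)" by (rule powr_mult)
        finally show "1 \<le> K * \<bar>Im w\<bar> powr (2 * lam)" using y t by (simp add: K_def field_simps)
      qed (use th S in \<open>auto simp: K_def\<close>)
      finally have "ennreal (sym_mod f z) \<le> ennreal (\<theta> * S) + ennreal (K / (2 * \<theta> * S) / (pi * (\<kappa> * t)\<^sup>2)) * ?W"
        by (rule ennreal_solve_le[rotated 3]) (use k t th S in \<open>auto simp: K_def\<close>)
      also have "\<dots> \<le> ennreal (\<theta> * S) + ennreal (C / (S * t\<^sup>2 * (y + t) powr (2 * lam))) * ?W"
      proof (intro add_left_mono mult_right_mono ennreal_leI)
        have "C / (S * t\<^sup>2 * (y + t) powr (2 * lam)) = 32 * (K / (2 * \<theta> * S) / (pi * (\<kappa> * t)\<^sup>2))"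
          using y t by (simp add: K_def C_def power_mult_distrib field_simps)
        moreover have "K / (2 * \<theta> * S) / (pi * (\<kappa> * t)\<^sup>2) \<ge> 0" using th S by (simp add: K_def)
        moreover have "a \<le> b" if "b = 32 * a" "0 \<le> a" for a b :: real using that by linarith
        ultimately show "K / (2 * \<theta> * S) / (pi * (\<kappa> * t)\<^sup>2) \<le> C / (S * t\<^sup>2 * (y + t) powr (2 * lam))" by blast
      qed auto
      finally show ?thesis .
    next
      case False
      define x0 where "x0 = Re z"
      define wf where "wf w = (norm (f w))\<^sup>2 + (norm (f (cnj w)))\<^sup>2" for w
      have cwf: "continuous_on (ball 0 1) wf"
        unfolding wf_def by (intro continuous_intros continuous_on_lambda_analytic[OF f] continuous_on_lambda_analytic_cnj[OF f])
      have zx: "norm (z - of_real x0) = y" 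
      proof -
        have "z - of_real x0 = \<i> * of_real (Im z)" by (simp add: x0_def complex_eq_iff)
        then show ?thesis by (simp add: y_def norm_mult)
      qed
      have x0: "\<bar>x0\<bar> \<le> norm z" unfolding x0_def by (rule abs_Re_le_cmod)
      define K where "K = (2 / y) powr (2 * lam)"
      have sub1: "ball z (\<kappa> * y) \<subseteq> ball (complex_of_real x0) (2 * y)"
      proof -
        have ky: "\<kappa> * y \<le> (1/16) * y" using k y by (intro mult_right_mono) auto
        have "norm (of_real x0 - w) < 2 * y" if "norm (z - w) < \<kappa> * y" for w
        proof -
          have "norm (of_real x0 - w) \<le> norm (of_real x0 - z) + norm (z - w)"
            using norm_triangle_ineq[of "of_real x0 - z" "z - w"] by simp
          moreover have "norm (of_real x0 - z) = y" using zx by (simp add: norm_minus_commute)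
          ultimately show ?thesis using that ky y by linarith
        qed
        then show ?thesis by (auto simp: dist_norm)
      qed
      have sub2: "ball (complex_of_real x0) (t / 2) \<subseteq> ball z t"
      proof
        fix w assume "w \<in> ball (complex_of_real x0) (t / 2)"
        then have "norm (of_real x0 - w) < t / 2" by (simp add: dist_norm)
        then show "w \<in> ball z t" using norm_triangle_ineq[of "z - of_real x0" "of_real x0 - w"] zx False t
          by (simp add: dist_norm)
      qed
      have ball_unit: "ball (complex_of_real x0) (2 * y) \<subseteq> ball 0 1"
        using x0 t False by (intro ball_subset_unit) auto
      have "ennreal (pi * (\<kappa> * y)\<^sup>2 * (sym_mod f z - \<theta> * S)) \<le>
       plane_integral (\<lambda>w. indicator (ball z (\<kappa> * y)) w * (?G2 w / (2 * \<theta> * S)))"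
        by (rule basic) (use y False in auto)
      also have "\<dots> \<le> ennreal (K / (2 * \<theta> * S)) * weighted_integral lam (ball (complex_of_real x0) (2 * y)) ?G2"
      proof (rule plane_integral_le_weighted[OF cG2 sub1 ball_unit])
        fix w assume "w \<in> ball z (\<kappa> * y)"
        from Im_low[OF this] have "1 \<le> (2 / y) * \<bar>Im w\<bar>" using y by (simp add: field_simps)
        then have "1 powr (2 * lam) \<le> ((2 / y) * \<bar>Im w\<bar>) powr (2 * lam)" using lam by (intro powr_mono2) auto
        also have "\<dots> = K * \<bar>Im w\<bar> powr (2 * lam)" unfolding K_def using y by (intro powr_mult) 
        finally show "1 \<le> K * \<bar>Im w\<bar> powr (2 * lam)" by simp
      qed (use th S in \<open>auto simp: K_def\<close>)
      also have "weighted_integral lam (ball (complex_of_real x0) (2 * y)) ?G2 \<le> weighted_integral lam (ball (complex_of_real x0) (2 * y)) (\<lambda>w. 2 * wf w)"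
      proof (rule weighted_integral_mono[OF order_refl])
        fix w
        have "0 \<le> (norm (f w) - norm (f (cnj w)))\<^sup>2" by simp
        then show "?G2 w \<le> 2 * wf w" by (simp add: sym_mod_def wf_def power2_eq_square algebra_simps)
      qed (simp add: wf_def)
      also have "\<dots> = ennreal 2 * weighted_integral lam (ball (complex_of_real x0) (2 * y)) wf"
        by (rule weighted_integral_cmult[OF cwf ball_unit]) auto
      also have "weighted_integral lam (ball (complex_of_real x0) (2 * y)) wf \<le>
          ennreal ((2 * y / (t / 2)) powr (2 * lam + 2)) * weighted_integral lam (ball (complex_of_real x0) (t / 2)) wf"
        unfolding wf_def by (rule real_disc_ratio[OF f lam]) (use y False x0 t in auto)
      also have "weighted_integral lam (ball (complex_of_real x0) (t / 2)) wf \<le> ?W"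
        by (rule weighted_integral_mono[OF sub2]) (auto simp: sym_mod_def wf_def power2_eq_square algebra_simps)
      finally have "ennreal (pi * (\<kappa> * y)\<^sup>2 * (sym_mod f z - \<theta> * S)) \<le> 
          ennreal (K / (2 * \<theta> * S)) * (ennreal 2 * (ennreal ((2 * y / (t / 2)) powr (2 * lam + 2)) * ?W))"
        by (simp add: mult_left_mono)
      also have "\<dots> = ennreal (K / (2 * \<theta> * S) * 2 * (2 * y / (t / 2)) powr (2 * lam + 2)) * ?W"
        using th S by (simp only: ennreal_mult'' powr_ge_zero mult.assoc zero_le_numeral mult_nonneg_nonneg)
      finally have "ennreal (sym_mod f z) \<le> ennreal (\<theta> * S) + 
          ennreal (K / (2 * \<theta> * S) * 2 * (2 * y / (t / 2)) powr (2 * lam + 2) / (pi * (\<kappa> * y)\<^sup>2)) * ?W"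
        by (rule ennreal_solve_le[rotated 3]) (use k t th S y in \<open>auto simp: K_def\<close>)
      also have "\<dots> \<le> ennreal (\<theta> * S) + ennreal (C / (S * t\<^sup>2 * (y + t) powr (2 * lam))) * ?W"
      proof (intro add_left_mono mult_right_mono ennreal_leI)
        have "K * (2 * y / (t / 2)) powr (2 * lam + 2) = (K * (4 * y / t) powr (2 * lam)) * (4 * y / t)\<^sup>2"
          using y t by (simp add: powr_add powr_numeral)
        also have "K * (4 * y / t) powr (2 * lam) = (8 / t) powr (2 * lam)"
          unfolding K_def using y t by (subst powr_mult[symmetric]) auto
        finally have e: "K * (2 * y / (t / 2)) powr (2 * lam + 2) = (8 / t) powr (2 * lam) * (4 * y / t)\<^sup>2" .
        have "(8 / t) powr (2 * lam) \<le> (18 / (y + t)) powr (2 * lam)"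
          using False y t lam by (intro powr_mono2) (auto simp: field_simps)
        also have "\<dots> = 18 powr (2 * lam) / (y + t) powr (2 * lam)" using y t by (intro powr_divide)
        finally have e2: "(8 / t) powr (2 * lam) \<le> 18 powr (2 * lam) / (y + t) powr (2 * lam)" .
        have "K / (2 * \<theta> * S) * 2 * (2 * y / (t / 2)) powr (2 * lam + 2) / (pi * (\<kappa> * y)\<^sup>2)
          = (K * (2 * y / (t / 2)) powr (2 * lam + 2)) * (1 / (\<theta> * S * (pi * (\<kappa> * y)\<^sup>2)))" using th S by (simp add: field_simps)
        also have "\<dots> = (8 / t) powr (2 * lam) * (16 / (\<theta> * S * pi * \<kappa>\<^sup>2 * t\<^sup>2))"
          unfolding e using y t by (simp add: power_mult_distrib power_divide field_simps)
        also have "\<dots> \<le> (18 powr (2 * lam) / (y + t) powr (2 * lam)) * (16 / (\<theta> * S * pi * \<kappa>\<^sup>2 * t\<^sup>2))"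
          using th S by (intro mult_right_mono e2) auto
        also have "\<dots> = C / (S * t\<^sup>2 * (y + t) powr (2 * lam))" by (simp add: C_def field_simps)
        finally show "K / (2 * \<theta> * S) * 2 * (2 * y / (t / 2)) powr (2 * lam + 2) / (pi * (\<kappa> * y)\<^sup>2) \<le> C / (S * t\<^sup>2 * (y + t) powr (2 * lam))" .
      qed auto
      finally show ?thesis .
    qed
    then show "ennreal (sym_mod f z) \<le> ennreal (\<theta> * S) +
      ennreal (C / (S * t\<^sup>2 * (\<bar>Im z\<bar> + t) powr (2 * lam))) * weighted_integral lam (ball z t) (\<lambda>w. (sym_mod f w)\<^sup>2)"
      by (simp add: y_def)
  qed
qed

text \<open>Points on the axis are limits of points off the axis, for which the constant is uniform.\<close>

lemma local_square_estimate:
  assumes lam: "lam \<ge> 0" and th: "\<theta> > 0"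
  shows "\<exists>C>0. \<forall>f z t S. lambda_analytic lam f \<longrightarrow> 0 < t \<longrightarrow> t \<le> 1 - norm z \<longrightarrow> 0 < S \<longrightarrow>
    (\<forall>w\<in>ball z t. sym_mod f w \<le> S) \<longrightarrow>
    ennreal (sym_mod f z) \<le> ennreal (\<theta> * S) +
      ennreal (C / (S * t\<^sup>2 * (\<bar>Im z\<bar> + t) powr (2 * lam))) * weighted_integral lam (ball z t) (\<lambda>w. (sym_mod f w)\<^sup>2)"
proof -
  obtain C where C: "C > 0" and est: "\<And>f z t S. lambda_analytic lam f \<Longrightarrow> Im z \<noteq> 0 \<Longrightarrow> 0 < t \<Longrightarrow> t \<le> 1 - norm z \<Longrightarrow> 0 < S \<Longrightarrow>
    (\<forall>w\<in>ball z t. sym_mod f w \<le> S) \<Longrightarrow>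
    ennreal (sym_mod f z) \<le> ennreal (\<theta> * S) +
      ennreal (C / (S * t\<^sup>2 * (\<bar>Im z\<bar> + t) powr (2 * lam))) * weighted_integral lam (ball z t) (\<lambda>w. (sym_mod f w)\<^sup>2)"
    using local_square_estimate_off_axis[OF assms] by metis
  define C' where "C' = C * 4 * 2 powr (2 * lam)"
  have CC': "C \<le> C'"
  proof -
    have "1 \<le> 2 powr (2 * lam)" using lam by (intro ge_one_powr_ge_zero) auto
    then have "C * 1 \<le> C * (4 * 2 powr (2 * lam))" using C by (intro mult_left_mono) auto
    then show ?thesis by (simp add: C'_def)
  qed
  show ?thesis
  proof (intro exI[of _ C'] conjI allI impI)
    show "C' > 0" using C by (simp add: C'_def)
    fix f z t S
    assume f: "lambda_analytic lam f" and t: "0 < t" "t \<le> 1 - norm z" and S: "0 < S"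
      and GS: "\<forall>w\<in>ball z t. sym_mod f w \<le> S"
    let ?W = "weighted_integral lam (ball z t) (\<lambda>w. (sym_mod f w)\<^sup>2)"
    define rhs where "rhs = ennreal (\<theta> * S) + ennreal (C' / (S * t\<^sup>2 * (\<bar>Im z\<bar> + t) powr (2 * lam))) * ?W"
    have "ennreal (sym_mod f z) \<le> rhs"
    proof (cases "Im z = 0")
      case False
      have "ennreal (sym_mod f z) \<le> ennreal (\<theta> * S) + ennreal (C / (S * t\<^sup>2 * (\<bar>Im z\<bar> + t) powr (2 * lam))) * ?W"
        by (rule est[OF f False t S GS])
      also have "\<dots> \<le> rhs"
        unfolding rhs_def using S CC' by (intro add_left_mono mult_right_mono ennreal_leI divide_right_mono) auto
      finally show ?thesis .
    next
      case True
      \<comment> \<open>The disc of radius \<open>t / 2\<close> about the shifted point stays inside the given one.\<close>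
      have "ennreal (sym_mod f (z + \<i> * of_real s)) \<le> rhs" if s: "0 < s" "s < t / 2" for s
      proof -
        let ?z = "z + \<i> * of_real s"
        have nz: "norm ?z \<le> norm z + s" using norm_triangle_ineq[of z "\<i> * of_real s"] s by (simp add: norm_mult)
        have sub: "ball ?z (t / 2) \<subseteq> ball z t"
        proof
          fix w assume "w \<in> ball ?z (t / 2)"
          then have "norm (?z - w) < t / 2" by (simp add: dist_norm)
          then show "w \<in> ball z t" using norm_triangle_ineq[of "z - ?z" "?z - w"] s
            by (simp add: dist_norm norm_mult)
        qed
        have "ennreal (sym_mod f ?z) \<le> ennreal (\<theta> * S) +
          ennreal (C / (S * (t / 2)\<^sup>2 * (\<bar>Im ?z\<bar> + t / 2) powr (2 * lam))) * weighted_integral lam (ball ?z (t / 2)) (\<lambda>w. (sym_mod f w)\<^sup>2)"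
          by (rule est[OF f]) (use True s t S GS nz sub in auto)
        also have "\<dots> \<le> rhs"
          unfolding rhs_def
        proof (intro add_left_mono mult_mono ennreal_leI weighted_integral_mono sub)
          have "(t / 2) powr (2 * lam) \<le> (\<bar>Im ?z\<bar> + t / 2) powr (2 * lam)"
            using t lam by (intro powr_mono2) auto
          then have "C / (S * (t / 2)\<^sup>2 * (\<bar>Im ?z\<bar> + t / 2) powr (2 * lam)) \<le> C / (S * (t / 2)\<^sup>2 * (t / 2) powr (2 * lam))"
            using t S C by (intro divide_left_mono mult_left_mono mult_pos_pos) auto
          also have "\<dots> = C' / (S * t\<^sup>2 * (\<bar>Im z\<bar> + t) powr (2 * lam))"
            using True t by (simp add: C'_def powr_divide power_divide)
          finally show "C / (S * (t / 2)\<^sup>2 * (\<bar>Im ?z\<bar> + t / 2) powr (2 * lam)) \<le> C' / (S * t\<^sup>2 * (\<bar>Im z\<bar> + t) powr (2 * lam))" .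
        qed auto
        finally show ?thesis .
      qed
      then have ev: "\<forall>\<^sub>F s in at_right 0. ennreal (sym_mod f (z + \<i> * of_real s)) \<le> rhs"
        using t by (auto simp: eventually_at_right intro!: exI[of _ "t / 2"])
      have zD: "z \<in> ball 0 1" using t by simp
      have lim0: "((\<lambda>s. z + \<i> * of_real s) \<longlongrightarrow> z + \<i> * of_real 0) (at_right 0)"
        by (intro tendsto_intros)
      have "isCont (sym_mod f) z"
        using continuous_on_sym_mod[OF f] zD by (simp add: continuous_on_eq_continuous_at)
      then have "((\<lambda>s. sym_mod f (z + \<i> * of_real s)) \<longlongrightarrow> sym_mod f z) (at_right 0)"
        using lim0 by (intro isCont_tendsto_compose[of z "sym_mod f"]) auto
      then have "((\<lambda>s. ennreal (sym_mod f (z + \<i> * of_real s))) \<longlongrightarrow> ennreal (sym_mod f z)) (at_right 0)"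
        by (rule tendsto_ennrealI)
      from tendsto_upperbound[OF this ev] show ?thesis by simp
    qed
    then show "ennreal (sym_mod f z) \<le> ennreal (\<theta> * S) +
      ennreal (C' / (S * t\<^sup>2 * (\<bar>Im z\<bar> + t) powr (2 * lam))) * ?W" by (simp add: rhs_def)
  qed
qed

section \<open>The sub-mean-value inequality\<close>

lemma measurable_indicator_ball:
  fixes z :: complex and c :: real
  shows "(\<lambda>w. indicator (ball z t) w * c) \<in> borel_measurable borel"
  by (intro borel_measurable_times borel_measurable_indicator borel_measurable_const borel_open open_ball)

lemma plane_integral_ball:
  assumes "c \<ge> 0" "t \<ge> 0"
  shows "plane_integral (\<lambda>w. indicator (ball z t) w * c) = ennreal (c * (pi * t\<^sup>2))"
proof -
  have "plane_integral (\<lambda>w. indicator (ball z t) w * c) =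
    (\<integral>\<^sup>+r. indicator {0<..} r * (ennreal r * (\<integral>\<^sup>+s. indicator {-pi..pi} s * ennreal (indicator (ball z t) (z + rcis r s) * c) \<partial>lborel)) \<partial>lborel)"
    by (rule plane_integral_polar[OF measurable_indicator_ball]) (use assms in simp)
  also have "\<dots> = (\<integral>\<^sup>+r. ennreal (2 * pi * c) * ennreal (indicator {0<..<t} r * r) \<partial>lborel)"
  proof (rule nn_integral_cong)
    fix r
    have ind: "indicator (ball z t) (z + rcis r s) = (indicator {..<t} r :: real)" if "r > 0" for s
      using that by (simp add: indicator_def dist_norm)
    have "(\<integral>\<^sup>+s. indicator {-pi..pi} s * ennreal (indicator (ball z t) (z + rcis r s) * c) \<partial>lborel) = 
      ennreal (indicator {..<t} r * c) * ennreal (2 * pi)" if "r > 0"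
      unfolding ind[OF that]
      by (subst nn_integral_multc) (simp_all add: mult.commute)
    then show "indicator {0<..} r * (ennreal r * (\<integral>\<^sup>+s. indicator {-pi..pi} s * ennreal (indicator (ball z t) (z + rcis r s) * c) \<partial>lborel))
       = ennreal (2 * pi * c) * ennreal (indicator {0<..<t} r * r)"
      using assms(1) by (cases "r > 0"; cases "r < t") (simp_all add: ennreal_mult'[symmetric] mult_ac)
  qed
  also have "\<dots> = ennreal (2 * pi * c) * ennreal (t\<^sup>2 / 2)"
    by (subst nn_integral_cmult) (simp_all add: nn_integral_radius assms)
  also have "\<dots> = ennreal (c * (pi * t\<^sup>2))"
    using assms by (subst ennreal_mult'[symmetric]) (simp_all add: mult_ac)
  finally show ?thesis .
qed

lemma continuous_on_sym_mod_powr: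
  assumes "lambda_analytic lam f" "p > 0"
  shows "continuous_on (ball 0 1) (\<lambda>z. sym_mod f z powr p)"
  by (intro continuous_on_powr' continuous_on_sym_mod[OF assms(1)] continuous_intros) (use assms(2) sym_mod_nonneg in auto)

text \<open>For \<open>p \<le> 2\<close> one has \<open>G\<^bsup>2-p\<^esup> \<le> S\<^bsup>2-p\<^esup>\<close>; for \<open>p > 2\<close> the power \<open>G\<^bsup>2-p\<^esup>\<close> is controlled only where
  \<open>G > \<epsilon> S\<close>, and the rest goes into the first summand.\<close>

lemma square_le_powr:
  fixes G S \<epsilon> p :: real
  assumes "0 \<le> G" "G \<le> S" "S > 0" "\<epsilon> > 0" "p > 0"
  shows "G\<^sup>2 \<le> \<epsilon>\<^sup>2 * S\<^sup>2 + max 1 (\<epsilon> powr (2 - p)) * S powr (2 - p) * G powr p"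
proof (cases "G \<le> \<epsilon> * S")
  case True
  then have "G\<^sup>2 \<le> (\<epsilon> * S)\<^sup>2" using assms by (intro power_mono) auto
  then show ?thesis using assms by (simp add: power_mult_distrib add_increasing2)
next
  case False
  then have G: "G > 0" using assms by (smt (verit) mult_pos_pos)
  have "G powr (2 - p) \<le> max 1 (\<epsilon> powr (2 - p)) * S powr (2 - p)"
  proof (cases "p \<le> 2")
    case True
    then have "G powr (2 - p) \<le> 1 * S powr (2 - p)" using assms by (simp add: powr_mono2)
    also have "\<dots> \<le> max 1 (\<epsilon> powr (2 - p)) * S powr (2 - p)" by (intro mult_right_mono) auto
    finally show ?thesis .
  next
    case p: False
    then have "G powr (2 - p) \<le> (\<epsilon> * S) powr (2 - p)" using assms False by (intro powr_mono2') auto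
    also have "\<dots> = \<epsilon> powr (2 - p) * S powr (2 - p)" by (rule powr_mult)
    also have "\<dots> \<le> max 1 (\<epsilon> powr (2 - p)) * S powr (2 - p)" by (intro mult_right_mono) auto
    finally show ?thesis .
  qed
  then have "G powr (2 - p) * G powr p \<le> max 1 (\<epsilon> powr (2 - p)) * S powr (2 - p) * G powr p"
    by (rule mult_right_mono) simp
  moreover have "G powr (2 - p) * G powr p = G\<^sup>2" using G by (simp add: powr_add[symmetric] powr_numeral)
  ultimately show ?thesis by (simp add: add_increasing)
qed

text \<open>Insert \<open>square_le_powr\<close> into the square estimate. The area of the disc makes the first summand a
  multiple of \<open>\<epsilon>\<^sup>2 S\<close>, and \<open>\<epsilon>\<close> is chosen to make it at most \<open>\<theta> S / 2\<close>.\<close>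

lemma local_power_estimate:
  assumes lam: "lam \<ge> 0" and th: "\<theta> > 0" and p: "p > 0"
  shows "\<exists>C>0. \<forall>f z t S. lambda_analytic lam f \<longrightarrow> 0 < t \<longrightarrow> t \<le> 1 - norm z \<longrightarrow> 0 < S \<longrightarrow>
    (\<forall>w\<in>ball z t. sym_mod f w \<le> S) \<longrightarrow>
    ennreal (sym_mod f z) \<le> ennreal (\<theta> * S) +
      ennreal (C * S powr (1 - p) / (t\<^sup>2 * (\<bar>Im z\<bar> + t) powr (2 * lam))) * weighted_integral lam (ball z t) (\<lambda>w. sym_mod f w powr p)"
proof -
  obtain C where C: "C > 0" and est: "\<And>f z t S. lambda_analytic lam f \<Longrightarrow> 0 < t \<Longrightarrow> t \<le> 1 - norm z \<Longrightarrow> 0 < S \<Longrightarrow>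
    (\<forall>w\<in>ball z t. sym_mod f w \<le> S) \<Longrightarrow>
    ennreal (sym_mod f z) \<le> ennreal (\<theta> / 2 * S) +
      ennreal (C / (S * t\<^sup>2 * (\<bar>Im z\<bar> + t) powr (2 * lam))) * weighted_integral lam (ball z t) (\<lambda>w. (sym_mod f w)\<^sup>2)"
    using local_square_estimate[OF lam, of "\<theta> / 2"] th by (metis half_gt_zero)
  define \<epsilon> where "\<epsilon> = sqrt (\<theta> / (2 * pi * C))"
  have e: "\<epsilon> > 0" "\<epsilon>\<^sup>2 = \<theta> / (2 * pi * C)" using th C by (auto simp: \<epsilon>_def)
  define K where "K = max 1 (\<epsilon> powr (2 - p))"
  have K: "K \<ge> 1" by (simp add: K_def)
  show ?thesis
  proof (intro exI[of _ "C * K"] conjI allI impI)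
    show "C * K > 0" using C K by auto
    fix f z t S
    assume f: "lambda_analytic lam f" and t: "0 < t" "t \<le> 1 - norm z" and S: "0 < S"
      and GS: "\<forall>w\<in>ball z t. sym_mod f w \<le> S"
    let ?W = "weighted_integral lam (ball z t) (\<lambda>w. sym_mod f w powr p)"
    define D where "D = (\<bar>Im z\<bar> + t) powr (2 * lam)"
    have D: "D > 0" using t by (simp add: D_def)
    have sub: "ball z t \<subseteq> ball 0 1" by (rule ball_subset_unit[OF t(2)])
    have "weighted_integral lam (ball z t) (\<lambda>w. (sym_mod f w)\<^sup>2) \<le>
      plane_integral (\<lambda>w. indicator (ball z t) w * (\<epsilon>\<^sup>2 * S\<^sup>2 * D) + indicator (ball z t) w * ((K * S powr (2 - p) * sym_mod f w powr p) * \<bar>Im w\<bar> powr (2 * lam)))"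
      unfolding weighted_integral_def
    proof (rule plane_integral_mono)
      fix w
      show "indicator (ball z t) w * ((sym_mod f w)\<^sup>2 * \<bar>Im w\<bar> powr (2 * lam)) \<le>
        indicator (ball z t) w * (\<epsilon>\<^sup>2 * S\<^sup>2 * D) + indicator (ball z t) w * ((K * S powr (2 - p) * sym_mod f w powr p) * \<bar>Im w\<bar> powr (2 * lam))"
      proof (cases "w \<in> ball z t")
        case True
        have "(sym_mod f w)\<^sup>2 \<le> \<epsilon>\<^sup>2 * S\<^sup>2 + K * S powr (2 - p) * sym_mod f w powr p"
          unfolding K_def using GS True by (intro square_le_powr sym_mod_nonneg S e p) auto
        then have "(sym_mod f w)\<^sup>2 * \<bar>Im w\<bar> powr (2 * lam) \<le> (\<epsilon>\<^sup>2 * S\<^sup>2 + K * S powr (2 - p) * sym_mod f w powr p) * \<bar>Im w\<bar> powr (2 * lam)"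
          by (rule mult_right_mono) simp
        also have "\<dots> = \<epsilon>\<^sup>2 * S\<^sup>2 * \<bar>Im w\<bar> powr (2 * lam) + K * S powr (2 - p) * sym_mod f w powr p * \<bar>Im w\<bar> powr (2 * lam)"
          by (rule distrib_right)
        also have "\<epsilon>\<^sup>2 * S\<^sup>2 * \<bar>Im w\<bar> powr (2 * lam) \<le> \<epsilon>\<^sup>2 * S\<^sup>2 * D"
        proof -
          have "norm (z - w) < t" using True by (simp add: dist_norm)
          moreover have "\<bar>Im z - Im w\<bar> \<le> norm (z - w)" using abs_Im_le_cmod[of "z - w"] by simp
          ultimately have "\<bar>Im w\<bar> \<le> \<bar>Im z\<bar> + t" by linarith
          then show ?thesis unfolding D_def using lam by (intro mult_left_mono powr_mono2) auto
        qed
        finally show ?thesis using True by simp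
      qed simp
    qed
    also have "\<dots> = plane_integral (\<lambda>w. indicator (ball z t) w * (\<epsilon>\<^sup>2 * S\<^sup>2 * D)) +
       plane_integral (\<lambda>w. indicator (ball z t) w * ((K * S powr (2 - p) * sym_mod f w powr p) * \<bar>Im w\<bar> powr (2 * lam)))"
    proof (rule plane_integral_add)
      show "(\<lambda>w. indicator (ball z t) w * ((K * S powr (2 - p) * sym_mod f w powr p) * \<bar>Im w\<bar> powr (2 * lam))) \<in> borel_measurable borel"
        by (intro measurable_indicator_times_weight continuous_intros continuous_on_sym_mod_powr[OF f p] sub) auto
    qed (use D K measurable_indicator_ball in auto)
    also have "plane_integral (\<lambda>w. indicator (ball z t) w * (\<epsilon>\<^sup>2 * S\<^sup>2 * D)) = ennreal (\<epsilon>\<^sup>2 * S\<^sup>2 * D * (pi * t\<^sup>2))"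
      using D t by (intro plane_integral_ball) auto
    also have "plane_integral (\<lambda>w. indicator (ball z t) w * ((K * S powr (2 - p) * sym_mod f w powr p) * \<bar>Im w\<bar> powr (2 * lam))) = 
       ennreal (K * S powr (2 - p)) * ?W"
      unfolding weighted_integral_def[symmetric]
      using K by (intro weighted_integral_cmult continuous_on_sym_mod_powr[OF f p] sub) auto
    finally have W2: "weighted_integral lam (ball z t) (\<lambda>w. (sym_mod f w)\<^sup>2) \<le>
       ennreal (\<epsilon>\<^sup>2 * S\<^sup>2 * D * (pi * t\<^sup>2)) + ennreal (K * S powr (2 - p)) * ?W" .
    have "ennreal (sym_mod f z) \<le> ennreal (\<theta> / 2 * S) + ennreal (C / (S * t\<^sup>2 * D)) * weighted_integral lam (ball z t) (\<lambda>w. (sym_mod f w)\<^sup>2)"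
      unfolding D_def by (rule est[OF f t S GS])
    also have "\<dots> \<le> ennreal (\<theta> / 2 * S) + ennreal (C / (S * t\<^sup>2 * D)) * (ennreal (\<epsilon>\<^sup>2 * S\<^sup>2 * D * (pi * t\<^sup>2)) + ennreal (K * S powr (2 - p)) * ?W)"
      by (intro add_left_mono mult_left_mono W2) auto
    also have "\<dots> = (ennreal (\<theta> / 2 * S) + ennreal (C / (S * t\<^sup>2 * D)) * ennreal (\<epsilon>\<^sup>2 * S\<^sup>2 * D * (pi * t\<^sup>2))) + 
       (ennreal (C / (S * t\<^sup>2 * D)) * ennreal (K * S powr (2 - p))) * ?W"
      by (simp only: distrib_left add.assoc mult.assoc)
    also have "ennreal (\<theta> / 2 * S) + ennreal (C / (S * t\<^sup>2 * D)) * ennreal (\<epsilon>\<^sup>2 * S\<^sup>2 * D * (pi * t\<^sup>2)) = ennreal (\<theta> * S)"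
    proof -
      have "C / (S * t\<^sup>2 * D) * (\<epsilon>\<^sup>2 * S\<^sup>2 * D * (pi * t\<^sup>2)) = \<theta> / 2 * S"
        unfolding e(2) using C S t D by (simp add: field_simps power2_eq_square)
      moreover have "C / (S * t\<^sup>2 * D) \<ge> 0" using C S D by auto
      ultimately have "ennreal (C / (S * t\<^sup>2 * D)) * ennreal (\<epsilon>\<^sup>2 * S\<^sup>2 * D * (pi * t\<^sup>2)) = ennreal (\<theta> / 2 * S)"
        by (simp only: ennreal_mult'[symmetric])
      then show ?thesis using th S by (simp flip: ennreal_plus)
    qed
    also have "ennreal (C / (S * t\<^sup>2 * D)) * ennreal (K * S powr (2 - p)) = ennreal (C * K * S powr (1 - p) / (t\<^sup>2 * D))"
    proof -
      have "S powr (2 - p) = S * S powr (1 - p)"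
        using S powr_add[of S 1 "1 - p"] by simp
      then have "C / (S * t\<^sup>2 * D) * (K * S powr (2 - p)) = C * K * S powr (1 - p) / (t\<^sup>2 * D)"
        using S by simp
      moreover have "C / (S * t\<^sup>2 * D) \<ge> 0" using C S D by auto
      ultimately show ?thesis by (simp only: ennreal_mult'[symmetric])
    qed
    finally show "ennreal (sym_mod f z) \<le> ennreal (\<theta> * S) +
      ennreal (C * K * S powr (1 - p) / (t\<^sup>2 * (\<bar>Im z\<bar> + t) powr (2 * lam))) * ?W"
      by (simp add: D_def)
  qed
qed

text \<open>Maximise \<open>\<Phi> w = G w (d - \<bar>w - z\<bar>)\<^bsup>N\<^esup>\<close>, let \<open>z1\<close> be a maximum point and \<open>t\<close> half its distance to the
  boundary of the disc. On the disc of radius \<open>t\<close> about \<open>z1\<close> one has \<open>G \<le> 2\<^bsup>N\<^esup> G z1\<close>, so for small \<open>\<theta>\<close> the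
  local estimate at \<open>z1\<close> bounds \<open>(G z1)\<^bsup>p\<^esup>\<close> by a mean over this disc. The inequality \<open>\<Phi> z \<le> \<Phi> z1\<close>
  transfers the bound to \<open>z\<close>; the exponent \<open>N = (2 + 2\<lambda>) / p\<close> compensates exactly for the smaller measure
  of the disc about \<open>z1\<close>.\<close>

lemma sub_mean_value:
  assumes lam: "lam \<ge> 0" and p: "p > 0"
  shows "\<exists>C>0. \<forall>f z d. lambda_analytic lam f \<longrightarrow> 0 < d \<longrightarrow> d < 1 - norm z \<longrightarrow>
    ennreal (sym_mod f z powr p) \<le>
      ennreal (C / (d\<^sup>2 * (\<bar>Im z\<bar> + d) powr (2 * lam))) * weighted_integral lam (ball z d) (\<lambda>w. sym_mod f w powr p)"
proof -
  define N where "N = (2 + 2 * lam) / p"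
  have N: "N > 0" "N * p = 2 + 2 * lam" using lam p by (auto simp: N_def)
  \<comment> \<open>Then \<open>\<theta> S\<close> is half the value at the maximum point for \<open>S = 2 powr N\<close> times that value.\<close>
  define \<theta> where "\<theta> = 1 / (2 * 2 powr N)"
  have th: "\<theta> > 0" by (simp add: \<theta>_def)
  obtain C where C: "C > 0" and est: "\<And>f z t S. lambda_analytic lam f \<Longrightarrow> 0 < t \<Longrightarrow> t \<le> 1 - norm z \<Longrightarrow> 0 < S \<Longrightarrow>
    (\<forall>w\<in>ball z t. sym_mod f w \<le> S) \<Longrightarrow>
    ennreal (sym_mod f z) \<le> ennreal (\<theta> * S) +
      ennreal (C * S powr (1 - p) / (t\<^sup>2 * (\<bar>Im z\<bar> + t) powr (2 * lam))) * weighted_integral lam (ball z t) (\<lambda>w. sym_mod f w powr p)"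
    using local_power_estimate[OF lam th p] by metis
  define C0 where "C0 = 2 * C * (2 powr N) powr (1 - p)"
  define C1 where "C1 = C0 * 4 * 4 powr (2 * lam)"
  have C0: "C0 > 0" using C by (simp add: C0_def)
  then have C1: "C1 > 0" by (simp add: C1_def)
  show ?thesis
  proof (intro exI[of _ C1] conjI allI impI C1)
    fix f and z :: complex and d
    assume f: "lambda_analytic lam f" and d: "0 < d" "d < 1 - norm z"
    let ?W = "\<lambda>A. weighted_integral lam A (\<lambda>w. sym_mod f w powr p)"
    define D0 where "D0 = d\<^sup>2 * (\<bar>Im z\<bar> + d) powr (2 * lam)"
    have D0: "D0 > 0" using d by (simp add: D0_def)
    have "ennreal (sym_mod f z powr p) \<le> ennreal (C1 / D0) * ?W (ball z d)"
    proof (cases "?W (ball z d)")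
      case top
      then show ?thesis using C1 D0 by (simp add: ennreal_mult_top)
    next
      case (real i)
      define \<Phi> where "\<Phi> w = sym_mod f w * (d - norm (w - z)) powr N" for w
      have cb: "cball z d \<subseteq> ball 0 1"
      proof
        fix w assume "w \<in> cball z d"
        then have "norm (w - z) \<le> d" by (simp add: dist_norm norm_minus_commute)
        then show "w \<in> ball 0 1" using norm_triangle_ineq[of "w - z" z] d by simp
      qed
      have "continuous_on (cball z d) \<Phi>"
        unfolding \<Phi>_def
        by (intro continuous_intros continuous_on_powr' continuous_on_subset[OF continuous_on_sym_mod[OF f] cb])
          (use N in \<open>auto simp: dist_norm norm_minus_commute\<close>)
      then obtain z1 where z1: "z1 \<in> cball z d" and max: "\<And>w. w \<in> cball z d \<Longrightarrow> \<Phi> w \<le> \<Phi> z1"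
        using continuous_attains_sup[of "cball z d" \<Phi>] d by auto
      have \<Phi>z: "\<Phi> z = sym_mod f z * d powr N" by (simp add: \<Phi>_def)
      show ?thesis
      proof (cases "sym_mod f z = 0")
        case True
        then show ?thesis by simp
      next
        case False
        then have "\<Phi> z > 0" using d sym_mod_nonneg[of f z] by (simp add: \<Phi>z)
        then have pos: "\<Phi> z1 > 0" using max[of z] d by simp
        define g where "g = sym_mod f z1"
        define t where "t = (d - norm (z1 - z)) / 2"
        have t2: "2 * t = d - norm (z1 - z)" by (simp add: t_def)
        have \<Phi>1: "\<Phi> z1 = g * (2 * t) powr N" unfolding \<Phi>_def g_def t2 ..
        have g: "g > 0" using pos sym_mod_nonneg[of f z1] unfolding \<Phi>1 g_def
          by (metis less_eq_real_def mult_zero_left)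
        have t0: "t \<noteq> 0" using pos N unfolding \<Phi>1 by auto
        have "t \<ge> 0" using z1 by (simp add: t_def dist_norm norm_minus_commute)
        with t0 have t: "t > 0" by simp
        define S where "S = 2 powr N * g"
        have S: "S > 0" using g by (simp add: S_def)
        have sub: "ball z1 t \<subseteq> ball z d"
        proof
          fix w assume "w \<in> ball z1 t"
          then have "norm (z1 - w) < t" by (simp add: dist_norm)
          moreover have "norm (z1 - z) = d - 2 * t" using t2 by linarith
          ultimately show "w \<in> ball z d" using norm_triangle_ineq[of "z - z1" "z1 - w"] t
            by (simp add: dist_norm norm_minus_commute)
        qed
        have GS: "\<forall>w\<in>ball z1 t. sym_mod f w \<le> S"
        proof
          fix w assume w: "w \<in> ball z1 t"
          then have "norm (z1 - w) < t" by (simp add: dist_norm)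
          moreover have "norm (z1 - z) = d - 2 * t" using t2 by linarith
          moreover have "norm (w - z) \<le> norm (z1 - z) + norm (z1 - w)"
            using norm_triangle_ineq4[of "z1 - z" "z1 - w"] by simp
          ultimately have "t \<le> d - norm (w - z)" by linarith
          then have "t powr N \<le> (d - norm (w - z)) powr N" using t N by (intro powr_mono2) auto
          then have "sym_mod f w * t powr N \<le> \<Phi> w" unfolding \<Phi>_def by (intro mult_left_mono sym_mod_nonneg)
          also have "\<dots> \<le> \<Phi> z1" using w sub by (intro max) (meson ball_subset_cball subsetD)
          also have "\<dots> = S * t powr N" unfolding \<Phi>1 S_def by (simp add: powr_mult)
          finally show "sym_mod f w \<le> S" using t by simp
        qed
        define D1 where "D1 = t\<^sup>2 * (\<bar>Im z1\<bar> + t) powr (2 * lam)"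
        have D1: "D1 > 0" using t by (simp add: D1_def)
        have z1d: "norm (z1 - z) = d - 2 * t" using t2 by linarith
        have "ennreal g \<le> ennreal (\<theta> * S) + ennreal (C * S powr (1 - p) / D1) * ?W (ball z1 t)"
          unfolding g_def D1_def
        proof (rule est[OF f t _ S GS])
          show "t \<le> 1 - norm z1" using norm_triangle_ineq[of "z1 - z" z] z1d d t by simp
        qed
        also have "\<dots> \<le> ennreal (\<theta> * S) + ennreal (C * S powr (1 - p) / D1) * ennreal i"
          unfolding real(2)[symmetric] by (intro add_left_mono mult_left_mono weighted_integral_mono sub) auto
        also have "\<dots> = ennreal (\<theta> * S + C * S powr (1 - p) / D1 * i)"
        proof -
          have n1: "0 \<le> C * S powr (1 - p) / D1" and n2: "0 \<le> \<theta> * S" using C S D1 th by auto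
          show ?thesis
            unfolding ennreal_plus[OF n2 mult_nonneg_nonneg[OF n1 real(1)]] ennreal_mult'[OF n1] ..
        qed
        finally have "g \<le> \<theta> * S + C * S powr (1 - p) / D1 * i"
          using C S D1 th real(1) by (subst (asm) ennreal_le_iff) auto
        moreover have "\<theta> * S = g / 2" by (simp add: \<theta>_def S_def)
        ultimately have "g \<le> 2 * (C * S powr (1 - p) / D1 * i)" by linarith
        then have a1: "g * g powr (p - 1) \<le> 2 * (C * S powr (1 - p) / D1 * i) * g powr (p - 1)"
          by (rule mult_right_mono) simp
        have a2: "g * g powr (p - 1) = g powr p" using g powr_add[of g 1 "p - 1"] by simp
        have "S powr (1 - p) * g powr (p - 1) = (2 powr N) powr (1 - p)"
        proof -
          have "S powr (1 - p) = (2 powr N) powr (1 - p) * g powr (1 - p)" unfolding S_def by (rule powr_mult)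
          moreover have "g powr (1 - p) * g powr (p - 1) = 1" using g by (simp add: powr_add[symmetric])
          ultimately show ?thesis by (simp add: mult.assoc)
        qed
        then have a3: "2 * (C * S powr (1 - p) / D1 * i) * g powr (p - 1) = C0 * i / D1"
          unfolding C0_def by (metis (no_types, opaque_lifting) mult.assoc mult.commute times_divide_eq_left)
        have gp: "g powr p \<le> C0 * i / D1" using a1 unfolding a2 a3 .
        have "sym_mod f z * d powr N \<le> g * (2 * t) powr N" using max[of z] d unfolding \<Phi>z \<Phi>1 by simp
        then have "sym_mod f z \<le> g * (2 * t / d) powr N" using d t by (simp add: powr_divide field_simps)
        then have "sym_mod f z powr p \<le> (g * (2 * t / d) powr N) powr p"
          using p by (intro powr_mono2 sym_mod_nonneg) auto
        also have "\<dots> = g powr p * (2 * t / d) powr (2 + 2 * lam)"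
          by (simp add: powr_mult powr_powr N(2))
        also have "\<dots> \<le> (C0 * i / D1) * (2 * t / d) powr (2 + 2 * lam)"
          by (rule mult_right_mono[OF gp]) simp
        also have "\<dots> = C0 * i * (4 / d\<^sup>2) * ((2 * t / d) powr (2 * lam) / (\<bar>Im z1\<bar> + t) powr (2 * lam))"
          using d t by (simp add: powr_add D1_def powr_numeral power_divide power_mult_distrib field_simps)
        also have "\<dots> \<le> C0 * i * (4 / d\<^sup>2) * (4 powr (2 * lam) / (\<bar>Im z\<bar> + d) powr (2 * lam))"
        proof (rule mult_left_mono)
          have "\<bar>Im z1 - Im z\<bar> \<le> norm (z1 - z)" using abs_Im_le_cmod[of "z1 - z"] by simp
          then have i1: "\<bar>Im z\<bar> + d \<le> \<bar>Im z1\<bar> + 2 * d" using z1d t by linarith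
          have "2 * t \<le> d" using z1d norm_ge_zero[of "z1 - z"] by linarith
          have "2 * t * (\<bar>Im z\<bar> + d) \<le> 2 * t * (\<bar>Im z1\<bar> + 2 * d)" using i1 t by (intro mult_left_mono) auto
          also have "\<dots> = (2 * t) * \<bar>Im z1\<bar> + 4 * d * t" by (simp add: algebra_simps)
          also have "\<dots> \<le> (4 * d) * \<bar>Im z1\<bar> + 4 * d * t"
            using \<open>2 * t \<le> d\<close> d by (intro add_right_mono mult_right_mono) auto
          also have "\<dots> = 4 * d * (\<bar>Im z1\<bar> + t)" by (simp add: algebra_simps)
          finally have le: "2 * t * (\<bar>Im z\<bar> + d) \<le> 4 * d * (\<bar>Im z1\<bar> + t)" .
          have p1: "\<bar>Im z1\<bar> + t > 0" "\<bar>Im z\<bar> + d > 0" using t d by auto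
          have "(2 * t / d) / (\<bar>Im z1\<bar> + t) \<le> 4 / (\<bar>Im z\<bar> + d)"
            using le p1 d by (simp add: divide_simps mult_ac)
          then have "((2 * t / d) / (\<bar>Im z1\<bar> + t)) powr (2 * lam) \<le> (4 / (\<bar>Im z\<bar> + d)) powr (2 * lam)"
            using t d lam by (intro powr_mono2) auto
          then show "(2 * t / d) powr (2 * lam) / (\<bar>Im z1\<bar> + t) powr (2 * lam) \<le> 4 powr (2 * lam) / (\<bar>Im z\<bar> + d) powr (2 * lam)"
            using t d by (simp add: powr_divide powr_mult)
        qed (use C0 real(1) in auto)
        also have "\<dots> = C1 / D0 * i" by (simp add: C1_def D0_def)
        finally have "ennreal (sym_mod f z powr p) \<le> ennreal (C1 / D0 * i)" by (rule ennreal_leI)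
        also have "\<dots> = ennreal (C1 / D0) * ?W (ball z d)"
          unfolding real(2) using C1 D0 by (intro ennreal_mult') auto
        finally show ?thesis .
      qed
    qed
    then show "ennreal (sym_mod f z powr p) \<le> ennreal (C1 / (d\<^sup>2 * (\<bar>Im z\<bar> + d) powr (2 * lam))) * ?W (ball z d)"
      by (simp add: D0_def)
  qed
qed

section \<open>Growth of functions in the Hardy spaces\<close>

lemma c_tilde_pos: "lam \<ge> 0 \<Longrightarrow> c_tilde lam > 0"
  unfolding c_tilde_def c_const_def by (intro divide_pos_pos mult_pos_pos Gamma_real_pos) auto

lemma continuous_on_circle:
  assumes "continuous_on (ball 0 1) (g :: complex \<Rightarrow> 'a::topological_space)" "0 \<le> r" "r < 1"
  shows "continuous_on A (\<lambda>t. g (rcis r t))"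
proof -
  have "continuous_on ({r} \<times> UNIV) (\<lambda>p. g (0 + rcis (fst p) (snd p)))"
  proof (rule continuous_on_compose2[OF assms(1)])
    have "(\<lambda>p. 0 + rcis (fst p) (snd p)) = (\<lambda>p. of_real (fst p) * exp (\<i> * of_real (snd p)))"
      by (simp add: rcis_def cis_conv_exp)
    then show "continuous_on ({r} \<times> UNIV) (\<lambda>p. 0 + rcis (fst p) (snd p))"
      by (simp only:) (intro continuous_intros)
  qed (use assms in auto)
  from continuous_on_compose2[OF this continuous_on_Pair[OF continuous_on_const continuous_on_id], of r A]
  show ?thesis by (simp add: image_subset_iff)
qed

lemma M_mean_le_hardy_norm:
  assumes "f \<in> hardy_space lam p" "0 \<le> r" "r < 1"
  shows "M_mean lam p f r \<le> hardy_norm lam p f"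
  unfolding hardy_norm_def using assms by (intro cSUP_upper) (auto simp: hardy_space_def)

text \<open>The integral over the circle is a multiple of the \<open>p\<close>-th power of the mean. Its finiteness has to
  be checked, since a divergent Bochner integral would be \<open>0\<close>.\<close>

lemma circle_integral_le_hardy_norm:
  assumes f: "f \<in> hardy_space lam (ereal q)" and lam: "lam \<ge> 0" and q: "q > 0" and r: "0 \<le> r" "r < 1"
  shows "(\<integral>\<^sup>+t. indicator {-pi..pi} t * ennreal (norm (f (rcis r t)) powr q * \<bar>sin t\<bar> powr (2 * lam)) \<partial>lborel)
    \<le> ennreal (hardy_norm lam (ereal q) f powr q / c_tilde lam)"
proof -
  let ?H = "hardy_norm lam (ereal q) f"
  have fl: "lambda_analytic lam f" using f by (simp add: hardy_space_def)
  have cf: "continuous_on A (\<lambda>t. f (rcis r t))" for A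
    by (rule continuous_on_circle[OF continuous_on_lambda_analytic[OF fl] r])
  have mf [measurable]: "(\<lambda>t. f (rcis r t)) \<in> borel_measurable borel"
    by (rule borel_measurable_continuous_onI[OF cf])
  define J where "J = (\<integral>\<^sup>+t. indicator {-pi..pi} t * ennreal (norm (f (rcis r t)) powr q * \<bar>sin t\<bar> powr (2 * lam)) \<partial>lborel)"
  have c: "c_tilde lam > 0" by (rule c_tilde_pos[OF lam])
  have mr: "g \<in> borel_measurable (restrict_space lborel {-pi..pi})" if "g \<in> borel_measurable borel" for g :: "real \<Rightarrow> ennreal"
    using that by (intro measurable_restrict_space1) simp
  have nn: "(\<integral>\<^sup>+t. ennreal (norm (f (rcis r t)) powr q) \<partial>m_measure lam) = ennreal (c_tilde lam) * J"
  proof -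
    have "(\<integral>\<^sup>+t. ennreal (norm (f (rcis r t)) powr q) \<partial>m_measure lam) = 
      (\<integral>\<^sup>+t. ennreal (c_tilde lam * \<bar>sin t\<bar> powr (2 * lam)) * ennreal (norm (f (rcis r t)) powr q) \<partial>restrict_space lborel {-pi..pi})"
      unfolding m_measure_def
    proof (rule nn_integral_density)
      show "(\<lambda>t. ennreal (c_tilde lam * \<bar>sin t\<bar> powr (2 * lam))) \<in> borel_measurable (restrict_space lborel {-pi..pi})"
        by (rule mr) measurable
      show "(\<lambda>t. ennreal (norm (f (rcis r t)) powr q)) \<in> borel_measurable (restrict_space lborel {-pi..pi})"
        by (rule mr) measurable
    qed
    also have "\<dots> = (\<integral>\<^sup>+t. ennreal (c_tilde lam * \<bar>sin t\<bar> powr (2 * lam)) * ennreal (norm (f (rcis r t)) powr q) * indicator {-pi..pi} t \<partial>lborel)"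
      by (rule nn_integral_restrict_space) simp
    also have "\<dots> = (\<integral>\<^sup>+t. ennreal (c_tilde lam) * (indicator {-pi..pi} t * ennreal (norm (f (rcis r t)) powr q * \<bar>sin t\<bar> powr (2 * lam))) \<partial>lborel)"
      using c by (intro nn_integral_cong) (simp add: ennreal_mult' mult_ac)
    also have "\<dots> = ennreal (c_tilde lam) * J"
      unfolding J_def by (rule nn_integral_cmult) measurable
    finally show ?thesis .
  qed
  have Jfin: "J < \<infinity>"
  proof -
    have "compact ((\<lambda>t. f (rcis r t)) ` {-pi..pi})" by (intro compact_continuous_image cf) simp
    then obtain B where B: "\<And>t. t \<in> {-pi..pi} \<Longrightarrow> norm (f (rcis r t)) \<le> B"
      using compact_imp_bounded bounded_iff by (metis image_eqI)
    have "J \<le> (\<integral>\<^sup>+t. ennreal (B powr q) * indicator {-pi..pi} t \<partial>lborel)"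
      unfolding J_def
    proof (rule nn_integral_mono)
      fix t
      show "indicator {-pi..pi} t * ennreal (norm (f (rcis r t)) powr q * \<bar>sin t\<bar> powr (2 * lam)) \<le> ennreal (B powr q) * indicator {-pi..pi} t"
      proof (cases "t \<in> {-pi..pi}")
        case True
        have "norm (f (rcis r t)) powr q * \<bar>sin t\<bar> powr (2 * lam) \<le> B powr q * 1"
          using B[OF True] q lam by (intro mult_mono powr_mono2 powr_le1) auto
        then show ?thesis using True by (simp add: ennreal_leI)
      qed simp
    qed
    also have "\<dots> < \<infinity>" by (simp add: nn_integral_cmult ennreal_mult_less_top)
    finally show ?thesis .
  qed
  define I where "I = (\<integral>t. norm (f (rcis r t)) powr q \<partial>m_measure lam)"
  have "I = enn2real (ennreal (c_tilde lam) * J)"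
    unfolding I_def nn[symmetric]
  proof (rule integral_eq_nn_integral)
    show "(\<lambda>t. norm (f (rcis r t)) powr q) \<in> borel_measurable (m_measure lam)"
    proof -
      have "(\<lambda>t. norm (f (rcis r t)) powr q) \<in> borel_measurable borel" by measurable
      then show ?thesis unfolding m_measure_def by (simp add: measurable_restrict_space1)
    qed
  qed simp
  then have I: "ennreal I = ennreal (c_tilde lam) * J" "I \<ge> 0"
    using Jfin by (simp_all add: ennreal_mult_less_top)
  have "I powr (1 / q) \<le> ?H"
    using M_mean_le_hardy_norm[OF f r] by (simp add: M_mean_def I_def)
  then have "(I powr (1 / q)) powr q \<le> ?H powr q" using q by (intro powr_mono2) auto
  then have "I \<le> ?H powr q" using q I(2) by (simp add: powr_powr)
  then have "ennreal (1 / c_tilde lam) * (ennreal (c_tilde lam) * J) \<le> ennreal (1 / c_tilde lam) * ennreal (?H powr q)"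
    unfolding I(1)[symmetric] by (intro mult_left_mono ennreal_leI) auto
  then show ?thesis
    using c unfolding J_def[symmetric] by (simp add: mult.assoc[symmetric] ennreal_mult'[symmetric])
qed

lemma add_powr_le:
  fixes a b q :: real
  assumes "a \<ge> 0" "b \<ge> 0" "q > 0"
  shows "(a + b) powr q \<le> 2 powr q * (a powr q + b powr q)"
proof -
  have "(a + b) powr q \<le> (2 * max a b) powr q" using assms by (intro powr_mono2) auto
  also have "\<dots> = 2 powr q * max a b powr q" by (rule powr_mult)
  also have "max a b powr q \<le> a powr q + b powr q" by (simp add: max_def)
  finally show ?thesis by simp
qed

text \<open>The measure is invariant under \<open>t \<mapsto> - t\<close>, so both summands of \<open>G\<close> contribute equally.\<close>

lemma sym_circle_integral_le_hardy_norm: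
  assumes f: "f \<in> hardy_space lam (ereal q)" and lam: "lam \<ge> 0" and q: "q > 0" and r: "0 \<le> r" "r < 1"
  shows "(\<integral>\<^sup>+t. indicator {-pi..pi} t * ennreal (sym_mod f (rcis r t) powr q * \<bar>sin t\<bar> powr (2 * lam)) \<partial>lborel)
    \<le> ennreal (2 powr q * 2 * (hardy_norm lam (ereal q) f powr q / c_tilde lam))"
proof -
  have fl: "lambda_analytic lam f" using f by (simp add: hardy_space_def)
  define k where "k t = indicator {-pi..pi} t * ennreal (norm (f (rcis r t)) powr q * \<bar>sin t\<bar> powr (2 * lam))" for t
  have mf [measurable]: "(\<lambda>t. f (rcis r t)) \<in> borel_measurable borel"
    by (rule borel_measurable_continuous_onI[OF continuous_on_circle[OF continuous_on_lambda_analytic[OF fl] r]])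
  have mk [measurable]: "k \<in> borel_measurable borel" unfolding k_def by measurable
  have k: "(\<integral>\<^sup>+t. k t \<partial>lborel) \<le> ennreal (hardy_norm lam (ereal q) f powr q / c_tilde lam)" (is "_ \<le> ?E")
    unfolding k_def by (rule circle_integral_le_hardy_norm[OF assms])
  have k': "(\<integral>\<^sup>+t. k (- t) \<partial>lborel) = (\<integral>\<^sup>+t. k t \<partial>lborel)"
    using nn_integral_real_affine[OF mk, of "-1" 0] by simp
  have "(\<integral>\<^sup>+t. indicator {-pi..pi} t * ennreal (sym_mod f (rcis r t) powr q * \<bar>sin t\<bar> powr (2 * lam)) \<partial>lborel)
    \<le> (\<integral>\<^sup>+t. ennreal (2 powr q) * (k t + k (- t)) \<partial>lborel)"
  proof (rule nn_integral_mono)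
    fix t :: real
    show "indicator {-pi..pi} t * ennreal (sym_mod f (rcis r t) powr q * \<bar>sin t\<bar> powr (2 * lam)) \<le> ennreal (2 powr q) * (k t + k (- t))"
    proof (cases "t \<in> {-pi..pi}")
      case True
      have cn: "cnj (rcis r t) = rcis r (- t)" by (simp add: complex_eq_iff)
      have "sym_mod f (rcis r t) powr q * \<bar>sin t\<bar> powr (2 * lam) \<le> (2 powr q * (norm (f (rcis r t)) powr q + norm (f (rcis r (-t))) powr q)) * \<bar>sin t\<bar> powr (2 * lam)"
        unfolding sym_mod_def cn using q by (intro mult_right_mono add_powr_le) auto
      also have "\<dots> = 2 powr q * (norm (f (rcis r t)) powr q * \<bar>sin t\<bar> powr (2 * lam) + norm (f (rcis r (-t))) powr q * \<bar>sin (-t)\<bar> powr (2 * lam))"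
        by (simp add: algebra_simps)
      finally have "ennreal (sym_mod f (rcis r t) powr q * \<bar>sin t\<bar> powr (2 * lam)) \<le> 
         ennreal (2 powr q * (norm (f (rcis r t)) powr q * \<bar>sin t\<bar> powr (2 * lam) + norm (f (rcis r (-t))) powr q * \<bar>sin (-t)\<bar> powr (2 * lam)))"
        by (rule ennreal_leI)
      also have "\<dots> = ennreal (2 powr q) * (k t + k (- t))"
        using True by (simp add: k_def ennreal_mult' ennreal_plus)
      finally show ?thesis using True by simp
    qed simp
  qed
  also have "\<dots> = ennreal (2 powr q) * ((\<integral>\<^sup>+t. k t \<partial>lborel) + (\<integral>\<^sup>+t. k (- t) \<partial>lborel))"
    by (subst nn_integral_cmult, measurable, subst nn_integral_add) measurable
  also have "\<dots> \<le> ennreal (2 powr q) * (?E + ?E)"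
    unfolding k' by (intro mult_left_mono add_mono k) auto
  also have "\<dots> = ennreal (2 powr q * 2 * (hardy_norm lam (ereal q) f powr q / c_tilde lam))"
    using c_tilde_pos[OF lam] by (simp add: ennreal_mult'[symmetric] ennreal_plus[symmetric] del: ennreal_plus)
  finally show ?thesis .
qed

text \<open>The disc lies in the annulus of width \<open>2 d\<close> about the circle through \<open>z\<close>. The gain is one factor
  \<open>d\<close>, against the two in the area of the disc.\<close>

lemma weighted_integral_le_hardy_norm:
  assumes f: "f \<in> hardy_space lam (ereal q)" and lam: "lam \<ge> 0" and q: "q > 0" and d: "0 < d" "d \<le> 1 - norm z"
  shows "weighted_integral lam (ball z d) (\<lambda>w. sym_mod f w powr q) \<le>
    ennreal (2 * d * (2 powr q * 2 * (hardy_norm lam (ereal q) f powr q / c_tilde lam)))"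
proof -
  have fl: "lambda_analytic lam f" using f by (simp add: hardy_space_def)
  define E where "E = 2 powr q * 2 * (hardy_norm lam (ereal q) f powr q / c_tilde lam)"
  have E: "E \<ge> 0" using c_tilde_pos[OF lam] by (simp add: E_def)
  define h where "h w = indicator (ball z d) w * (sym_mod f w powr q * \<bar>Im w\<bar> powr (2 * lam))" for w
  have hm: "h \<in> borel_measurable borel"
    unfolding h_def by (intro measurable_indicator_times_weight continuous_on_sym_mod_powr[OF fl q] ball_subset_unit[OF d(2)]) simp
  have "weighted_integral lam (ball z d) (\<lambda>w. sym_mod f w powr q) = plane_integral h"
    by (simp add: weighted_integral_def h_def[abs_def])
  also have "\<dots> = (\<integral>\<^sup>+r. indicator {0<..} r * (ennreal r * (\<integral>\<^sup>+t. indicator {-pi..pi} t * ennreal (h (rcis r t)) \<partial>lborel)) \<partial>lborel)"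
    by (rule plane_integral_polar0[OF hm]) (simp add: h_def)
  also have "\<dots> \<le> (\<integral>\<^sup>+r. ennreal E * indicator {norm z - d..norm z + d} r \<partial>lborel)"
  proof (rule nn_integral_mono)
    fix r
    show "indicator {0<..} r * (ennreal r * (\<integral>\<^sup>+t. indicator {-pi..pi} t * ennreal (h (rcis r t)) \<partial>lborel)) \<le> ennreal E * indicator {norm z - d..norm z + d} r"
    proof (cases "r > 0 \<and> \<bar>norm z - r\<bar> < d")
      case True
      then have r: "0 < r" "r < 1" using d by auto
      have "(\<integral>\<^sup>+t. indicator {-pi..pi} t * ennreal (h (rcis r t)) \<partial>lborel) \<le> 
        (\<integral>\<^sup>+t. indicator {-pi..pi} t * ennreal (sym_mod f (rcis r t) powr q * \<bar>sin t\<bar> powr (2 * lam)) \<partial>lborel)"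
      proof (intro nn_integral_mono mult_left_mono ennreal_leI)
        fix t
        have "\<bar>Im (rcis r t)\<bar> powr (2 * lam) \<le> \<bar>sin t\<bar> powr (2 * lam)"
          using r lam by (intro powr_mono2) (auto simp: abs_mult mult_left_le_one_le)
        then have "sym_mod f (rcis r t) powr q * \<bar>Im (rcis r t)\<bar> powr (2 * lam) \<le> sym_mod f (rcis r t) powr q * \<bar>sin t\<bar> powr (2 * lam)"
          by (rule mult_left_mono) simp
        then show "h (rcis r t) \<le> sym_mod f (rcis r t) powr q * \<bar>sin t\<bar> powr (2 * lam)"
          unfolding h_def by (auto simp: indicator_def)
      qed simp
      also have "\<dots> \<le> ennreal E" unfolding E_def using r by (intro sym_circle_integral_le_hardy_norm[OF f lam q]) auto
      finally have "ennreal r * (\<integral>\<^sup>+t. indicator {-pi..pi} t * ennreal (h (rcis r t)) \<partial>lborel) \<le> ennreal 1 * ennreal E"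
        using r by (intro mult_mono ennreal_leI) auto
      then show ?thesis using True by (simp add: abs_less_iff)
    next
      case False
      have "h (rcis r t) = 0" if "r > 0" for t
      proof -
        have "norm z - r \<le> norm (z - rcis r t)" "r - norm z \<le> norm (z - rcis r t)"
          using norm_triangle_ineq2[of z "rcis r t"] norm_triangle_ineq2[of "rcis r t" z] that
          by (auto simp: norm_minus_commute)
        then show ?thesis using False that by (auto simp: h_def indicator_def dist_norm)
      qed
      then show ?thesis by (cases "r > 0") simp_all
    qed
  qed
  also have "\<dots> = ennreal (2 * d * E)"
    using d E by (subst nn_integral_cmult) (simp_all add: ennreal_mult'[symmetric] mult.commute)
  finally show ?thesis by (simp add: E_def)
qed

text \<open>Both factors of \<open>1 - z\<^sup>2 = (1 - z) (1 + z)\<close> are at most \<open>2\<close> in modulus, and the distance of \<open>z\<close> to the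
  nearer one of the points \<open>1\<close>, \<open>-1\<close> is controlled by the distances to the circle and to the axis.\<close>

lemma norm_one_minus_square_le:
  assumes "norm z \<le> 1"
  shows "norm (1 - z\<^sup>2) \<le> 2 * ((1 - norm z) + 2 * \<bar>Im z\<bar>)"
proof -
  have key: "norm (1 - w) \<le> (1 - norm w) + 2 * \<bar>Im w\<bar>" if "norm w \<le> 1" "Re w \<ge> 0" for w :: complex
  proof -
    have "Re w \<le> 1" using that complex_Re_le_cmod[of w] by simp
    moreover have "norm (1 - w) \<le> \<bar>Re (1 - w)\<bar> + \<bar>Im (1 - w)\<bar>" by (rule cmod_le)
    moreover have "norm w \<le> \<bar>Re w\<bar> + \<bar>Im w\<bar>" by (rule cmod_le)
    ultimately show ?thesis using that by simp
  qed
  have e: "norm (1 - z\<^sup>2) = norm (1 - z) * norm (1 + z)"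
    by (simp add: norm_mult[symmetric] power2_eq_square algebra_simps)
  have b: "norm (1 - z) \<le> 2" "norm (1 + z) \<le> 2"
    using norm_triangle_ineq4[of 1 z] norm_triangle_ineq[of 1 z] assms by auto
  show ?thesis
  proof (cases "Re z \<ge> 0")
    case True
    have "norm (1 - z) * norm (1 + z) \<le> ((1 - norm z) + 2 * \<bar>Im z\<bar>) * 2"
      using key[OF assms True] b assms by (intro mult_mono) auto
    then show ?thesis unfolding e by simp
  next
    case False
    have "norm (1 - z) * norm (1 + z) \<le> 2 * ((1 - norm z) + 2 * \<bar>Im z\<bar>)"
      using key[of "-z"] False b assms by (intro mult_mono) auto
    then show ?thesis unfolding e .
  qed
qed

text \<open>\<open>f z\<close> is one of the values over which the supremum on the circle of radius \<open>\<bar>z\<bar>\<close> is taken.\<close>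

lemma hardy_growth_infinity:
  assumes f: "f \<in> hardy_space lam \<infinity>" and z: "z \<in> ball 0 1"
  shows "norm (f z) \<le> hardy_norm lam \<infinity> f"
proof -
  have fl: "lambda_analytic lam f" using f by (simp add: hardy_space_def)
  have nz: "0 \<le> norm z" "norm z < 1" using z by auto
  have bdd: "bdd_above ((\<lambda>t. norm (f (rcis (norm z) t))) ` {-pi..pi})"
    by (intro bounded_imp_bdd_above compact_imp_bounded compact_continuous_image continuous_intros
       continuous_on_circle[OF continuous_on_lambda_analytic[OF fl] nz]) simp
  have "Arg z \<in> {-pi..pi}" using mpi_less_Arg[of z] Arg_le_pi[of z] by simp
  from cSUP_upper[OF this bdd] have "norm (f (rcis (norm z) (Arg z))) \<le> M_mean lam \<infinity> f (norm z)"
    by (simp add: M_mean_def)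
  then show ?thesis using M_mean_le_hardy_norm[OF f nz] by (simp add: rcis_cmod_Arg)
qed

lemma hardy_growth_finite:
  assumes lam: "lam \<ge> 0" and q: "q > 0"
  shows "\<exists>c>0. \<forall>f\<in>hardy_space lam (ereal q). \<forall>z\<in>ball 0 1.
    norm (f z) \<le> c * ((1 - norm z) powr (- (1 / q)) / norm (1 - z\<^sup>2) powr (2 * lam * (1 / q))) * hardy_norm lam (ereal q) f"
proof -
  obtain C where C: "C > 0" and est: "\<And>f z d. lambda_analytic lam f \<Longrightarrow> 0 < d \<Longrightarrow> d < 1 - norm z \<Longrightarrow>
    ennreal (sym_mod f z powr q) \<le>
      ennreal (C / (d\<^sup>2 * (\<bar>Im z\<bar> + d) powr (2 * lam))) * weighted_integral lam (ball z d) (\<lambda>w. sym_mod f w powr q)"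
    using sub_mean_value[OF lam q] by metis
  define B0 where "B0 = 2 powr q * 2 / c_tilde lam"
  define B where "B = C * 4 * B0 * 8 powr (2 * lam)"
  have B0: "B0 > 0" using c_tilde_pos[OF lam] by (simp add: B0_def)
  have B: "B > 0" using C B0 by (simp add: B_def)
  show ?thesis
  proof (intro exI[of _ "B powr (1 / q)"] conjI ballI)
    show "B powr (1 / q) > 0" using B by simp
    fix f z assume f: "f \<in> hardy_space lam (ereal q)" and z: "z \<in> ball (0::complex) 1"
    have fl: "lambda_analytic lam f" using f by (simp add: hardy_space_def)
    define H where "H = hardy_norm lam (ereal q) f"
    have "0 \<le> M_mean lam (ereal q) f 0" by (simp add: M_mean_def)
    also have "\<dots> \<le> H" unfolding H_def by (rule M_mean_le_hardy_norm[OF f]) auto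
    finally have H: "H \<ge> 0" .
    define d where "d = (1 - norm z) / 2"
    have d: "d > 0" "d < 1 - norm z" using z by (auto simp: d_def)
    define Y where "Y = (\<bar>Im z\<bar> + d) powr (2 * lam)"
    have Y: "Y > 0" using d by (simp add: Y_def)
    define X where "X = norm (1 - z\<^sup>2)"
    have X: "X > 0"
    proof -
      have "norm (z\<^sup>2) < 1" using z by (simp add: norm_power power_less_one_iff)
      then have "z\<^sup>2 \<noteq> 1" by auto
      then show ?thesis by (simp add: X_def)
    qed
    have "ennreal (sym_mod f z powr q) \<le> ennreal (C / (d\<^sup>2 * Y)) * weighted_integral lam (ball z d) (\<lambda>w. sym_mod f w powr q)"
      unfolding Y_def by (rule est[OF fl d])
    also have "\<dots> \<le> ennreal (C / (d\<^sup>2 * Y)) * ennreal (2 * d * (2 powr q * 2 * (H powr q / c_tilde lam)))"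
      unfolding H_def using d by (intro mult_left_mono weighted_integral_le_hardy_norm[OF f lam q]) auto
    also have "\<dots> = ennreal (C / (d\<^sup>2 * Y) * (2 * d * (B0 * H powr q)))"
      using C Y by (subst ennreal_mult') (auto simp: B0_def)
    finally have "sym_mod f z powr q \<le> C / (d\<^sup>2 * Y) * (2 * d * (B0 * H powr q))"
      using C Y d B0 by (subst (asm) ennreal_le_iff) auto
    also have "\<dots> = C * 4 * B0 * H powr q * (1 / (1 - norm z)) * (1 / Y)"
    proof -
      have e: "1 - norm z = 2 * d" by (simp add: d_def)
      show ?thesis unfolding e using d(1) Y by (simp add: power2_eq_square field_simps)
    qed
    also have "\<dots> \<le> C * 4 * B0 * H powr q * (1 / (1 - norm z)) * (8 powr (2 * lam) / X powr (2 * lam))"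
    proof (rule mult_left_mono)
      have "X \<le> 8 * (\<bar>Im z\<bar> + d)" 
      proof -
        have "X \<le> 2 * ((1 - norm z) + 2 * \<bar>Im z\<bar>)"
          unfolding X_def using z by (intro norm_one_minus_square_le) simp
        moreover have "1 - norm z = 2 * d" by (simp add: d_def)
        moreover have "x \<le> 8 * (a + d)" if "x \<le> 2 * (b + 2 * a)" "b = 2 * d" "a \<ge> 0" for x a b
          using that d(1) by simp
        ultimately show ?thesis using abs_ge_zero by blast
      qed
      then have "X powr (2 * lam) \<le> (8 * (\<bar>Im z\<bar> + d)) powr (2 * lam)" using X lam by (intro powr_mono2) auto
      also have "\<dots> = 8 powr (2 * lam) * Y" unfolding Y_def by (rule powr_mult)
      finally show "1 / Y \<le> 8 powr (2 * lam) / X powr (2 * lam)" using X Y by (simp add: field_simps)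
    qed (use C B0 z in auto)
    also have "\<dots> = B * ((1 / (1 - norm z)) / X powr (2 * lam)) * H powr q" by (simp add: B_def)
    finally have main: "sym_mod f z powr q \<le> B * ((1 / (1 - norm z)) / X powr (2 * lam)) * H powr q" .
    have nz: "1 - norm z > 0" using z by simp
    have "sym_mod f z = (sym_mod f z powr q) powr (1 / q)"
      using q sym_mod_nonneg[of f z] by (simp add: powr_powr)
    also have "\<dots> \<le> (B * ((1 / (1 - norm z)) / X powr (2 * lam)) * H powr q) powr (1 / q)"
      using q by (intro powr_mono2 main) auto
    also have "\<dots> = B powr (1 / q) * ((1 / (1 - norm z)) powr (1 / q) / (X powr (2 * lam)) powr (1 / q)) * (H powr q) powr (1 / q)"
      using nz X H by (simp add: powr_mult powr_divide)
    also have "(H powr q) powr (1 / q) = H" using q H by (simp add: powr_powr)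
    also have "(X powr (2 * lam)) powr (1 / q) = X powr (2 * lam * (1 / q))" by (simp add: powr_powr)
    also have "(1 / (1 - norm z)) powr (1 / q) = (1 - norm z) powr (- (1 / q))"
      using nz by (simp add: powr_divide powr_minus_divide)
    finally show "norm (f z) \<le> B powr (1 / q) * ((1 - norm z) powr (- (1 / q)) / norm (1 - z\<^sup>2) powr (2 * lam * (1 / q))) * hardy_norm lam (ereal q) f"
      using norm_le_sym_mod[of f z] unfolding X_def H_def by linarith
  qed
qed

theorem theorem4p10:
  fixes lam :: real and p :: ereal
  assumes "lam \<ge> 0"
    and "p \<ge> ereal (2 * lam / (2 * lam + 1))"
    and "p > 0"
  shows "\<exists>c::real. c > 0 \<and> (\<forall>f\<in>hardy_space lam p. \<forall>z\<in>ball 0 1.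
    norm (f z) \<le> c * ((1 - norm z) powr (- recip_exponent p)
      / norm (1 - z\<^sup>2) powr (2 * lam * recip_exponent p)) * hardy_norm lam p f)"
proof (cases p)
  case (real q)
  then have q: "q > 0" using assms(3) by simp
  have "recip_exponent p = 1 / q" using q by (simp add: recip_exponent_def real one_ereal_def)
  then show ?thesis using hardy_growth_finite[OF assms(1) q] real by simp
next
  case PInf
  have "norm (f z) \<le> 1 * ((1 - norm z) powr (- recip_exponent p)
      / norm (1 - z\<^sup>2) powr (2 * lam * recip_exponent p)) * hardy_norm lam p f"
    if "f \<in> hardy_space lam p" "z \<in> ball 0 1" for f z
  proof -
    have "norm (z\<^sup>2) < 1" using that(2) by (simp add: norm_power power_less_one_iff)
    then have "1 - z\<^sup>2 \<noteq> 0" by auto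
    moreover have "recip_exponent p = 0" by (simp add: recip_exponent_def PInf)
    moreover have "1 - norm z \<noteq> 0" using that(2) by auto
    ultimately show ?thesis using hardy_growth_infinity[of f lam z] that PInf by simp
  qed
  then show ?thesis by (intro exI[of _ 1]) auto
qed (use assms(3) in auto)

end
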